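(* Let $\mathcal{P}=\mathcal{T}(V)/(R)$ be an operad defined by an $\mathbb{S}$-module $V=\bigoplus_{n\ge1}V(n)$ with basis $\mathcal{V}=\coprod_{n\ge1}\mathcal{V}(n)$ and relations $R$, and let $\mathcal{C}=(C_n)$ be $\mathcal{A}$ or $\mathcal{B}$. Let $A$ be a $\mathcal{C}\mathrm{Sp}(\mathcal{P})$-algebra with operations $\{\binom{\omega}{e_I}\mid\omega\in\mathcal{V},I\in C_{|\omega|}\}$. For $\omega\in\mathcal{V}$ and $I\in C_{|\omega|}$ define $l_I^\omega:A^{\otimes(|\omega|-|I|)}\otimes A^{\otimes|I|}\to A$ by $$l_I^\omega(\vec x_I)({}_I\vec x)=\binom{\omega}{e_I}(\vec x),\qquad \vec x\in A^{|\omega|}.$$ Then $(A,\{l_I^\omega\mid\omega\in\mathcal{V},I\in C_{|\omega|}\})$ is a $\mathcal{C}$-module for the $\mathcal{P}$-algebra $(A,\mathcal{V}_\star)$, where $\mathcal{V}_\star=\{\binom{\omega}{\star}:=\sum_{I\in C_{|\omega|}}\binom{\omega}{e_I}\mid\omega\in\mathcal{V}\}$. Further, the identity map $\mathrm{id}:A\to A$ is a relative $\mathcal{C}$-Rota-Baxter operator of weight one for the $\mathcal{P}$-algebra $(A,\mathcal{V}_\star)$ associated to the $\mathcal{C}$-module $(A,\{l_I^\omega\})$. Finally, the $\mathcal{C}\mathrm{Sp}(\mathcal{P})$-algebra structure on $A$ derived from the relative Rota-Baxter operator $\alpha=\mathrm{id}$, namely the one with operations $\vec u\mapsto l_I^\omega(\alpha(\vec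 u)_I)({}_I\vec u)$, is precisely the given $\big(A,\{\binom{\omega}{e_I}\mid\omega\in\mathcal{V},I\in C_{|\omega|}\}\big)$.
   Context: $\mathbf{k}$ is the base field, $[n]=\{1,\dots,n\}$, $|\omega|$ is the arity of $\omega$. $B_n$ is the set of nonempty subsets of $[n]$, $A_n$ the set of one-element subsets of $[n]$, $\mathcal{A}=(A_n)_{n\ge1}$, $\mathcal{B}=(B_n)_{n\ge1}$; $\mathcal{C}=(C_n)$ denotes either of them. Trees. Consider planar rooted reduced trees (every vertex has at least one input), including the trivial tree $|$ with one leaf and no vertex. A labeled tree over a graded set $\Omega=\coprod_n\Omega_n$ has each vertex with $\ell$ inputs decorated by an element of $\Omega_\ell$ and the leaves decorated by distinct positive integers; $\mathrm{Lin}(\tau)$ is the set of leaf labels; inputs of a vertex are numbered $1,\dots,\ell$ from left to right. A nontrivial $\tau$ is uniquely a grafting $\tau=\omega(\tau_1\vee\cdots\vee\tau_\ell)$. For $\emptyset\ne J\subseteq\mathrm{Lin}(\tau)$ and a vertex $\omega$ whose subtree is $\omega(\sigma_1\vee\cdots\vee\sigma_\ell)$, put $J\sqcap\omega=\{i\in[\ell]:J\cap\mathrm{Lin}(\sigma_i)\ne\emptyset\}$. Splitting. $\mathcal{V}(n)$ is assumed invariant under $\mathbb{S}_n$. $\mathcal{C}\mathrm{Sp}(V)(n)=V(n)\otimes\bigoplus_{I\in C_n}\mathbf{k}e_I$, $\binom{\omega}{e_I}=\omega\otimes e_I$, $\binom{\omega}{*}=\sum_{I\in C_n}\binom{\omega}{e_I}$,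 action $\binom{\omega}{e_I}^\sigma=\binom{\omega^\sigma}{e_{\sigma(I)}}$. For a labeled tree $\tau$ over $\mathcal{V}$, $\mathcal{C}\mathrm{Sp}(\tau)=\mathcal{C}\mathrm{Sp}_\emptyset(\tau)$ replaces every vertex $\omega$ by $\binom{\omega}{*}$; for $J\subseteq\mathrm{Lin}(\tau)$ with $J\in C_{|\mathrm{Lin}(\tau)|}$ (i.e. $|J|=1$ if $\mathcal{C}=\mathcal{A}$, $J\neq\emptyset$ if $\mathcal{C}=\mathcal{B}$), $\mathcal{C}\mathrm{Sp}_J(|)=|$ and for $\tau=\omega(\tau_1\vee\cdots\vee\tau_\ell)$, $\mathcal{C}\mathrm{Sp}_J(\tau)=\binom{\omega}{e_{J\sqcap\omega}}(\mathcal{C}\mathrm{Sp}_{J\cap\mathrm{Lin}(\tau_1)}(\tau_1)\vee\cdots\vee\mathcal{C}\mathrm{Sp}_{J\cap\mathrm{Lin}(\tau_\ell)}(\tau_\ell))$. The free operad is $\mathcal{T}(V)\cong\bigoplus_{t\in\mathfrak{R}}t[V]$, $\mathfrak{R}$ a set of planar representatives of isomorphism classes of reduced leaf-labeled trees. $R$ consists of locally homogeneous elements $r_s=\sum_ic_{s,i}\tau_{s,i}$, $1\le s\le k$ ($\mathrm{Lin}(\tau_{s,i})=:\mathrm{Lin}(r_s)$ independent of $i$). $\mathcal{C}\mathrm{Sp}(\mathcal{P})=\mathcal{T}(\mathcal{C}\mathrm{Sp}(V))/(\sum_ic_{s,i}\mathcal{C}\mathrm{Sp}_J(\tau_{s,i}):\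 s,\ J\in C_{|\mathrm{Lin}(r_s)|})$. Modules and relative Rota-Baxter operators. For $\vec x=(x_1,\dots,x_n)$ and $I=\{i_1<\cdots<i_t\}\subseteq[n]$, $\vec x_I$ is the tuple obtained from $\vec x$ by deleting the entries in positions $I$, ${}_I\vec x=(x_{i_1},\dots,x_{i_t})$, and $\alpha(\vec x)=(\alpha(x_1),\dots,\alpha(x_n))$. A $\mathcal{C}$-module for a $\mathcal{P}$-algebra $A$ is a $\mathbf{k}$-module $U$ with linear maps $l_I^\omega:A^{\otimes(|\omega|-|I|)}\otimes U^{\otimes|I|}\to U$, $\omega\in\mathcal{V}$, $I\in C_{|\omega|}$, such that $A\oplus U$ is a $\mathcal{P}$-algebra with operations $\widetilde\omega((x_1,u_1),\dots,(x_{|\omega|},u_{|\omega|}))=\big(\omega(\vec x),\sum_{I\in C_{|\omega|}}l_I^\omega(\vec x_I)({}_I\vec u)\big)$. A linear map $\alpha:U\to A$ is a relative $\mathcal{C}$-Rota-Baxter operator of weight one on this module if $\omega(\alpha(\vec u))=\sum_{I\in C_{|\omega|}}\alpha\big(l_I^\omega(\alpha(\vec u)_I)({}_I\vec u)\big)$ for all $\omega\in\mathcal{V}$, $\vec u\in U^{|\omega|}$; the operations $\vec u\mapsto l_I^\omega(\alpha(\vec u)_I)({}_I\vec u)$ then make $U$ a $\mathcal{C}\mathrm{Sp}(\mathcal{P})$-algebra. *)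

theory Defs
  imports
    Complex_Main
    "HOL-Library.Poly_Mapping"
    "HOL-Library.Product_Plus"
    "HOL-Combinatorics.Permutations"
begin

section \<open>Symmetric operads and their algebras\<close>

text \<open>
  Symmetric operads are used in their coordinate-free form: instead of a sequence of
  \<open>\<S>\<^sub>n\<close>-modules \<open>P(n)\<close> there is a space \<open>P[L]\<close> for every finite nonempty set \<open>L\<close> of positive
  integers (the labels of the inputs), a transport map for every bijection of label sets (for
  \<open>L = {1..n}\<close> this contains the action of the symmetric group) and partial compositions
  \<open>P[L] \<otimes> P[M] \<rightarrow> P[(L - {i}) \<union> M]\<close> at \<open>i \<in> L\<close>. There is no component for \<open>L = {}\<close>, as all
  operads considered here are presented by generators of positive arity. The record collects
  the data only; the operations are relevant on \<open>ospace\<close>.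
\<close>

record ('k, 'p) operad =
  ospace :: "nat set \<Rightarrow> 'p set"
  oadd :: "nat set \<Rightarrow> 'p \<Rightarrow> 'p \<Rightarrow> 'p"
  ozero :: "nat set \<Rightarrow> 'p"
  oscale :: "nat set \<Rightarrow> 'k \<Rightarrow> 'p \<Rightarrow> 'p"
  orelabel :: "nat set \<Rightarrow> (nat \<Rightarrow> nat) \<Rightarrow> 'p \<Rightarrow> 'p"
  ocomp :: "nat set \<Rightarrow> nat \<Rightarrow> nat set \<Rightarrow> 'p \<Rightarrow> 'p \<Rightarrow> 'p"
  ounit :: "nat \<Rightarrow> 'p"

definition label_set :: "nat set \<Rightarrow> bool" where
  "label_set L \<longleftrightarrow> finite L \<and> L \<noteq> {} \<and> 0 \<notin> L"

definition relabelling :: "nat set \<Rightarrow> (nat \<Rightarrow> nat) \<Rightarrow> bool" where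
  "relabelling L h \<longleftrightarrow> label_set L \<and> inj_on h L \<and> 0 \<notin> h ` L"

definition composable :: "nat set \<Rightarrow> nat \<Rightarrow> nat set \<Rightarrow> bool" where
  "composable L i M \<longleftrightarrow> label_set L \<and> label_set M \<and> i \<in> L \<and> M \<inter> (L - {i}) = {}"

definition operad_morphism ::
  "('k, 'p) operad \<Rightarrow> ('k, 'q) operad \<Rightarrow> (nat set \<Rightarrow> 'p \<Rightarrow> 'q) \<Rightarrow> bool" where
  "operad_morphism P Q \<phi> \<longleftrightarrow>
     (\<forall>L. label_set L \<longrightarrow>
        (\<forall>x\<in>ospace P L. \<phi> L x \<in> ospace Q L) \<and>
        (\<forall>x\<in>ospace P L. \<forall>y\<in>ospace P L. \<phi> L (oadd P L x y) = oadd Q L (\<phi> L x) (\<phi> L y)) \<and>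
        (\<forall>c. \<forall>x\<in>ospace P L. \<phi> L (oscale P L c x) = oscale Q L c (\<phi> L x))) \<and>
     (\<forall>L h. relabelling L h \<longrightarrow>
        (\<forall>x\<in>ospace P L. \<phi> (h ` L) (orelabel P L h x) = orelabel Q L h (\<phi> L x))) \<and>
     (\<forall>L i M. composable L i M \<longrightarrow>
        (\<forall>x\<in>ospace P L. \<forall>y\<in>ospace P M.
           \<phi> ((L - {i}) \<union> M) (ocomp P L i M x y) = ocomp Q L i M (\<phi> L x) (\<phi> M y))) \<and>
     (\<forall>i>0. \<phi> {i} (ounit P i) = ounit Q i)"

text \<open>The operadic ideal \<open>(G)\<close> generated by elements \<open>G L \<subseteq> P[L]\<close>.\<close>

inductive operad_ideal ::
  "('k, 'p) operad \<Rightarrow> (nat set \<Rightarrow> 'p set) \<Rightarrow> nat set \<Rightarrow> 'p \<Rightarrow> bool"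
  for P :: "('k, 'p) operad" and G :: "nat set \<Rightarrow> 'p set" where
  gen: "label_set L \<Longrightarrow> x \<in> G L \<Longrightarrow> x \<in> ospace P L \<Longrightarrow> operad_ideal P G L x"
| zero: "label_set L \<Longrightarrow> operad_ideal P G L (ozero P L)"
| add: "operad_ideal P G L x \<Longrightarrow> operad_ideal P G L y \<Longrightarrow> operad_ideal P G L (oadd P L x y)"
| scale: "operad_ideal P G L x \<Longrightarrow> operad_ideal P G L (oscale P L c x)"
| relabel: "operad_ideal P G L x \<Longrightarrow> relabelling L h \<Longrightarrow>
    operad_ideal P G (h ` L) (orelabel P L h x)"
| comp_left: "operad_ideal P G L x \<Longrightarrow> y \<in> ospace P M \<Longrightarrow> composable L i M \<Longrightarrow>
    operad_ideal P G ((L - {i}) \<union> M) (ocomp P L i M x y)"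
| comp_right: "x \<in> ospace P L \<Longrightarrow> operad_ideal P G M y \<Longrightarrow> composable L i M \<Longrightarrow>
    operad_ideal P G ((L - {i}) \<union> M) (ocomp P L i M x y)"

definition ocoset ::
  "('k, 'p) operad \<Rightarrow> (nat set \<Rightarrow> 'p \<Rightarrow> bool) \<Rightarrow> nat set \<Rightarrow> 'p \<Rightarrow> 'p set" where
  "ocoset P I L x = {oadd P L x y |y. I L y}"

definition coset_rep :: "'p set \<Rightarrow> 'p" where
  "coset_rep X = (SOME x. x \<in> X)"

definition quotient_operad ::
  "('k, 'p) operad \<Rightarrow> (nat set \<Rightarrow> 'p \<Rightarrow> bool) \<Rightarrow> ('k, 'p set) operad" where
  "quotient_operad P I =
    \<lparr> ospace = (\<lambda>L. ocoset P I L ` ospace P L),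
      oadd = (\<lambda>L X Y. ocoset P I L (oadd P L (coset_rep X) (coset_rep Y))),
      ozero = (\<lambda>L. ocoset P I L (ozero P L)),
      oscale = (\<lambda>L c X. ocoset P I L (oscale P L c (coset_rep X))),
      orelabel = (\<lambda>L h X. ocoset P I (h ` L) (orelabel P L h (coset_rep X))),
      ocomp = (\<lambda>L i M X Y.
        ocoset P I ((L - {i}) \<union> M) (ocomp P L i M (coset_rep X) (coset_rep Y))),
      ounit = (\<lambda>i. ocoset P I {i} (ounit P i)) \<rparr>"

text \<open>
  The endomorphism operad of a vector space. A multilinear map on \<open>A\<^sup>L\<close> is represented by a
  function on all assignments \<open>x :: nat \<Rightarrow> 'a\<close> that only depends on the values of \<open>x\<close> on \<open>L\<close>.
\<close>

definition End_operad :: "('k::field \<Rightarrow> 'a::ab_group_add \<Rightarrow> 'a) \<Rightarrow> ('k, (nat \<Rightarrow> 'a) \<Rightarrow> 'a) operad" where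
  "End_operad sc =
    \<lparr> ospace = (\<lambda>L. {f. (\<forall>x y. (\<forall>i\<in>L. x i = y i) \<longrightarrow> f x = f y) \<and>
                        (\<forall>i\<in>L. \<forall>x. Vector_Spaces.linear sc sc (\<lambda>a. f (x(i := a))))}),
      oadd = (\<lambda>L f g x. f x + g x),
      ozero = (\<lambda>L x. 0),
      oscale = (\<lambda>L c f x. sc c (f x)),
      orelabel = (\<lambda>L h f x. f (x \<circ> h)),
      ocomp = (\<lambda>L i M f g x. f (x(i := g x))),
      ounit = (\<lambda>i x. x i) \<rparr>"


section \<open>Labelled trees and operads presented by generators and relations\<close>

text \<open>
  A basis \<open>\<V>\<close> of an \<open>\<S>\<close>-module \<open>V = \<Oplus>\<^sub>n V(n)\<close> that is permuted by the symmetric groups;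
  \<open>\<V>(n)\<close> is the set of \<open>\<omega> \<in> basis V\<close> with \<open>arity V \<omega> = n\<close>, and \<open>sact V \<sigma> \<omega>\<close> is \<open>\<omega>\<^sup>\<sigma>\<close>.
  The convention is \<open>\<omega>\<^sup>\<sigma>(x\<^sub>1, \<dots>, x\<^sub>n) = \<omega>(x\<^bsub>\<sigma>(1)\<^esub>, \<dots>, x\<^bsub>\<sigma>(n)\<^esub>)\<close>, so that \<open>(\<omega>\<^sup>\<sigma>)\<^sup>\<tau> = \<omega>\<^sup>\<tau>\<^sup>\<circ>\<^sup>\<sigma>\<close>: this is a
  right action for the product of permutations read from left to right, and it is the
  convention for which \<open>e\<^sub>I \<mapsto> e\<^bsub>\<sigma>(I)\<^esub>\<close> is the action on marked input positions.
\<close>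

record 'v sym_basis =
  basis :: "'v set"
  arity :: "'v \<Rightarrow> nat"
  sact :: "(nat \<Rightarrow> nat) \<Rightarrow> 'v \<Rightarrow> 'v"

definition S_module_basis :: "'v sym_basis \<Rightarrow> bool" where
  "S_module_basis V \<longleftrightarrow>
     (\<forall>\<omega>\<in>basis V. arity V \<omega> \<ge> 1 \<and> sact V id \<omega> = \<omega> \<and>
        (\<forall>\<sigma>. \<sigma> permutes {1..arity V \<omega>} \<longrightarrow>
           sact V \<sigma> \<omega> \<in> basis V \<and> arity V (sact V \<sigma> \<omega>) = arity V \<omega> \<and>
           (\<forall>\<tau>. \<tau> permutes {1..arity V \<omega>} \<longrightarrow>
              sact V \<tau> (sact V \<sigma> \<omega>) = sact V (\<tau> \<circ> \<sigma>) \<omega>)))"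

datatype 'v ltree = Leaf nat | Node 'v "'v ltree list"

fun leaves :: "'v ltree \<Rightarrow> nat list" where
  "leaves (Leaf i) = [i]"
| "leaves (Node \<omega> ts) = concat (map leaves ts)"

definition Lin :: "'v ltree \<Rightarrow> nat set" where
  "Lin t = set (leaves t)"

fun decorated :: "'v sym_basis \<Rightarrow> 'v ltree \<Rightarrow> bool" where
  "decorated V (Leaf i) \<longleftrightarrow> True"
| "decorated V (Node \<omega> ts) \<longleftrightarrow>
     \<omega> \<in> basis V \<and> length ts = arity V \<omega> \<and> (\<forall>t\<in>set ts. decorated V t)"

definition labelled_tree :: "'v sym_basis \<Rightarrow> 'v ltree \<Rightarrow> bool" where
  "labelled_tree V t \<longleftrightarrow> decorated V t \<and> distinct (leaves t) \<and> 0 \<notin> Lin t"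

fun relabel_tree :: "(nat \<Rightarrow> nat) \<Rightarrow> 'v ltree \<Rightarrow> 'v ltree" where
  "relabel_tree h (Leaf j) = Leaf (h j)"
| "relabel_tree h (Node \<omega> ts) = Node \<omega> (map (relabel_tree h) ts)"

fun subst_tree :: "nat \<Rightarrow> 'v ltree \<Rightarrow> 'v ltree \<Rightarrow> 'v ltree" where
  "subst_tree i s (Leaf j) = (if j = i then s else Leaf j)"
| "subst_tree i s (Node \<omega> ts) = Node \<omega> (map (subst_tree i s) ts)"

text \<open>
  The type \<open>'b \<Rightarrow>\<^sub>0 'k\<close> is the vector space with basis \<open>'b\<close>; a linear combination of trees is
  an element of \<open>'v ltree \<Rightarrow>\<^sub>0 'k\<close>.
\<close>

abbreviation basis_vec :: "'b \<Rightarrow> 'b \<Rightarrow>\<^sub>0 'k::field" where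
  "basis_vec b \<equiv> Poly_Mapping.single b 1"

definition scale_pm :: "'k::field \<Rightarrow> ('b \<Rightarrow>\<^sub>0 'k) \<Rightarrow> ('b \<Rightarrow>\<^sub>0 'k)" where
  "scale_pm c f = Poly_Mapping.map ((*) c) f"

definition lin_ext :: "('b \<Rightarrow> ('c \<Rightarrow>\<^sub>0 'k::field)) \<Rightarrow> ('b \<Rightarrow>\<^sub>0 'k) \<Rightarrow> ('c \<Rightarrow>\<^sub>0 'k)" where
  "lin_ext F f = (\<Sum>b\<in>Poly_Mapping.keys f. scale_pm (Poly_Mapping.lookup f b) (F b))"

definition tree_space :: "'v sym_basis \<Rightarrow> nat set \<Rightarrow> ('v ltree \<Rightarrow>\<^sub>0 'k::field) set" where
  "tree_space V L = {f. \<forall>t\<in>Poly_Mapping.keys f. labelled_tree V t \<and> Lin t = L}"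

definition tree_operad :: "'v sym_basis \<Rightarrow> ('k::field, 'v ltree \<Rightarrow>\<^sub>0 'k) operad" where
  "tree_operad V =
    \<lparr> ospace = tree_space V,
      oadd = (\<lambda>L f g. f + g),
      ozero = (\<lambda>L. 0),
      oscale = (\<lambda>L c f. scale_pm c f),
      orelabel = (\<lambda>L h f. lin_ext (\<lambda>t. basis_vec (relabel_tree h t)) f),
      ocomp = (\<lambda>L i M f g. lin_ext (\<lambda>t. lin_ext (\<lambda>s. basis_vec (subst_tree i s t)) g) f),
      ounit = (\<lambda>i. basis_vec (Leaf i)) \<rparr>"

text \<open>
  In \<^const>\<open>tree_operad\<close> all planar labelled trees are linearly independent. The free operad
  \<open>\<T>(V)\<close> on the \<open>\<S>\<close>-module \<open>V\<close> arises by identifying isomorphic trees, i.e. the planar trees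
  \<open>\<omega>\<^sup>\<sigma>(\<tau>\<^sub>1 \<or> \<dots> \<or> \<tau>\<^sub>n)\<close> and \<open>\<omega>(\<tau>\<^bsub>\<sigma>(1)\<^esub> \<or> \<dots> \<or> \<tau>\<^bsub>\<sigma>(n)\<^esub>)\<close>; a choice of planar representatives of
  the isomorphism classes gives a basis of it.
\<close>

definition tree_iso_relators :: "'v sym_basis \<Rightarrow> nat set \<Rightarrow> ('v ltree \<Rightarrow>\<^sub>0 'k::field) set" where
  "tree_iso_relators V L =
     {basis_vec (Node (sact V \<sigma> \<omega>) ts) -
      basis_vec (Node \<omega> (map (\<lambda>j. ts ! (\<sigma> j - 1)) [1..<Suc (arity V \<omega>)])) |\<omega> \<sigma> ts.
        labelled_tree V (Node \<omega> ts) \<and> \<sigma> permutes {1..arity V \<omega>} \<and> Lin (Node \<omega> ts) = L}"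

definition free_ideal ::
  "'v sym_basis \<Rightarrow> nat set \<Rightarrow> ('v ltree \<Rightarrow>\<^sub>0 'k::field) \<Rightarrow> bool" where
  "free_ideal V = operad_ideal (tree_operad V) (tree_iso_relators V)"

definition free_operad :: "'v sym_basis \<Rightarrow> ('k::field, ('v ltree \<Rightarrow>\<^sub>0 'k) set) operad" where
  "free_operad V = quotient_operad (tree_operad V) (free_ideal V)"

definition free_class ::
  "'v sym_basis \<Rightarrow> nat set \<Rightarrow> ('v ltree \<Rightarrow>\<^sub>0 'k::field) \<Rightarrow> ('v ltree \<Rightarrow>\<^sub>0 'k) set" where
  "free_class V L f = ocoset (tree_operad V) (free_ideal V) L f"

definition locally_homogeneous :: "'v sym_basis \<Rightarrow> ('v ltree \<Rightarrow>\<^sub>0 'k::field) \<Rightarrow> bool" where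
  "locally_homogeneous V r \<longleftrightarrow> (\<exists>L. label_set L \<and> r \<in> tree_space V L)"

definition relation_ideal ::
  "'v sym_basis \<Rightarrow> ('v ltree \<Rightarrow>\<^sub>0 'k::field) set \<Rightarrow> nat set \<Rightarrow> ('v ltree \<Rightarrow>\<^sub>0 'k) set \<Rightarrow> bool" where
  "relation_ideal V R =
     operad_ideal (free_operad V) (\<lambda>L. free_class V L ` (R \<inter> tree_space V L))"

definition presented_operad ::
  "'v sym_basis \<Rightarrow> ('v ltree \<Rightarrow>\<^sub>0 'k::field) set \<Rightarrow> ('k, ('v ltree \<Rightarrow>\<^sub>0 'k) set set) operad" where
  "presented_operad V R = quotient_operad (free_operad V) (relation_ideal V R)"

text \<open>The image in \<open>(\<T>(V)/(R))[{1..n}]\<close> of a generator \<open>\<omega>\<close> of arity \<open>n\<close>.\<close>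

definition corolla :: "'v sym_basis \<Rightarrow> 'v \<Rightarrow> 'v ltree" where
  "corolla V \<omega> = Node \<omega> (map Leaf [1..<Suc (arity V \<omega>)])"

definition generator ::
  "'v sym_basis \<Rightarrow> ('v ltree \<Rightarrow>\<^sub>0 'k::field) set \<Rightarrow> 'v \<Rightarrow> ('v ltree \<Rightarrow>\<^sub>0 'k) set set" where
  "generator V R \<omega> =
     ocoset (free_operad V) (relation_ideal V R) {1..arity V \<omega>}
       (free_class V {1..arity V \<omega>} (basis_vec (corolla V \<omega>)))"

text \<open>
  \<open>(A, {\<omega> | \<omega> \<in> \<V>})\<close> is an algebra over \<open>\<T>(V)/(R)\<close>: there is a (necessarily unique) operad
  morphism to the endomorphism operad of \<open>A\<close> that sends each generator to the given operation.
  An \<open>n\<close>-tuple is a list of length \<open>n\<close>.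
\<close>

definition operad_algebra ::
  "'v sym_basis \<Rightarrow> ('v ltree \<Rightarrow>\<^sub>0 'k::field) set \<Rightarrow> ('k \<Rightarrow> 'a::ab_group_add \<Rightarrow> 'a) \<Rightarrow>
   ('v \<Rightarrow> 'a list \<Rightarrow> 'a) \<Rightarrow> bool" where
  "operad_algebra V R sc ops \<longleftrightarrow> vector_space sc \<and>
     (\<exists>\<phi>. operad_morphism (presented_operad V R) (End_operad sc) \<phi> \<and>
        (\<forall>\<omega>\<in>basis V. \<forall>xs. length xs = arity V \<omega> \<longrightarrow>
           \<phi> {1..arity V \<omega>} (generator V R \<omega>) (\<lambda>i. xs ! (i - 1)) = ops \<omega> xs))"


section \<open>Splitting of operads\<close>

text \<open>
  A family \<open>\<C>\<close> is given as a function on label sets, with \<open>C\<^sub>n = C {1..n}\<close>; the subsets \<open>J\<close> of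
  \<open>Lin \<tau>\<close> with \<open>J \<in> C\<^bsub>|Lin \<tau>|\<^esub>\<close> are the elements of \<open>C (Lin \<tau>)\<close>.
\<close>

definition A_family :: "nat set \<Rightarrow> nat set set" where
  "A_family S = {{i} |i. i \<in> S}"

definition B_family :: "nat set \<Rightarrow> nat set set" where
  "B_family S = {J. J \<noteq> {} \<and> J \<subseteq> S}"

text \<open>The pair \<open>(\<omega>, I)\<close> stands for the basis element \<open>\<omega> \<otimes> e\<^sub>I\<close> of \<open>\<C>Sp(V)\<close>.\<close>

definition Sp_basis :: "(nat set \<Rightarrow> nat set set) \<Rightarrow> 'v sym_basis \<Rightarrow> ('v \<times> nat set) sym_basis" where
  "Sp_basis C V =
    \<lparr> basis = {(\<omega>, I). \<omega> \<in> basis V \<and> I \<in> C {1..arity V \<omega>}},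
      arity = (\<lambda>(\<omega>, I). arity V \<omega>),
      sact = (\<lambda>\<sigma> (\<omega>, I). (sact V \<sigma> \<omega>, \<sigma> ` I)) \<rparr>"

fun lin_list :: "('b \<Rightarrow>\<^sub>0 'k::field) list \<Rightarrow> ('b list \<Rightarrow>\<^sub>0 'k)" where
  "lin_list [] = basis_vec []"
| "lin_list (f # fs) = lin_ext (\<lambda>t. lin_ext (\<lambda>ts. basis_vec (t # ts)) (lin_list fs)) f"

text \<open>Multilinear grafting: the root is decorated by a linear combination of generators.\<close>

definition graft ::
  "('v \<Rightarrow>\<^sub>0 'k::field) \<Rightarrow> ('v ltree \<Rightarrow>\<^sub>0 'k) list \<Rightarrow> ('v ltree \<Rightarrow>\<^sub>0 'k)" where
  "graft w fs = lin_ext (\<lambda>\<omega>. lin_ext (\<lambda>ts. basis_vec (Node \<omega> ts)) (lin_list fs)) w"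

definition Sp_star ::
  "(nat set \<Rightarrow> nat set set) \<Rightarrow> 'v sym_basis \<Rightarrow> 'v \<Rightarrow> (('v \<times> nat set) \<Rightarrow>\<^sub>0 'k::field)" where
  "Sp_star C V \<omega> = (\<Sum>I\<in>C {1..arity V \<omega>}. basis_vec (\<omega>, I))"

definition meet_inputs :: "nat set \<Rightarrow> 'v ltree list \<Rightarrow> nat set" where
  "meet_inputs J ts = {i \<in> {1..length ts}. J \<inter> Lin (ts ! (i - 1)) \<noteq> {}}"

text \<open>\<open>\<C>Sp\<^sub>J(\<tau>)\<close> for \<open>J \<subseteq> Lin \<tau>\<close>, including \<open>J = {}\<close>.\<close>

fun Sp_tree ::
  "(nat set \<Rightarrow> nat set set) \<Rightarrow> 'v sym_basis \<Rightarrow> nat set \<Rightarrow> 'v ltree \<Rightarrow>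
   (('v \<times> nat set) ltree \<Rightarrow>\<^sub>0 'k::field)" where
  "Sp_tree C V J (Leaf i) = basis_vec (Leaf i)"
| "Sp_tree C V J (Node \<omega> ts) =
     graft (if J = {} then Sp_star C V \<omega> else basis_vec (\<omega>, meet_inputs J ts))
       (map (\<lambda>t. Sp_tree C V (J \<inter> Lin t) t) ts)"

text \<open>
  For a locally homogeneous relation \<open>r\<close>, the union below is the common leaf set \<open>Lin r\<close> of the
  trees in \<open>r\<close> (if \<open>r = 0\<close>, all splittings of \<open>r\<close> vanish as well).
\<close>

definition relation_Lin :: "('v ltree \<Rightarrow>\<^sub>0 'k::field) \<Rightarrow> nat set" where
  "relation_Lin r = (\<Union>t\<in>Poly_Mapping.keys r. Lin t)"

definition Sp_relations ::
  "(nat set \<Rightarrow> nat set set) \<Rightarrow> 'v sym_basis \<Rightarrow> ('v ltree \<Rightarrow>\<^sub>0 'k::field) set \<Rightarrow>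
   (('v \<times> nat set) ltree \<Rightarrow>\<^sub>0 'k) set" where
  "Sp_relations C V R = {lin_ext (Sp_tree C V J) r |r J. r \<in> R \<and> J \<in> C (relation_Lin r)}"

text \<open>
  \<open>\<C>Sp(\<P>)\<close> is \<open>presented_operad (Sp_basis C V) (Sp_relations C V R)\<close> for
  \<open>\<P> = presented_operad V R\<close>.
\<close>

abbreviation Sp_algebra ::
  "(nat set \<Rightarrow> nat set set) \<Rightarrow> 'v sym_basis \<Rightarrow> ('v ltree \<Rightarrow>\<^sub>0 'k::field) set \<Rightarrow>
   ('k \<Rightarrow> 'a::ab_group_add \<Rightarrow> 'a) \<Rightarrow> ('v \<times> nat set \<Rightarrow> 'a list \<Rightarrow> 'a) \<Rightarrow> bool" where
  "Sp_algebra C V R sc ops \<equiv> operad_algebra (Sp_basis C V) (Sp_relations C V R) sc ops"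


section \<open>\<open>\<C>\<close>-modules and relative Rota-Baxter operators\<close>

text \<open>\<^const>\<open>nths\<close> counts positions from 0, whereas the sets \<open>I\<close> are subsets of \<open>{1..n}\<close>.\<close>

definition del_pos :: "nat set \<Rightarrow> 'a list \<Rightarrow> 'a list" where
  "del_pos I xs = nths xs {j. Suc j \<notin> I}"

definition sel_pos :: "nat set \<Rightarrow> 'a list \<Rightarrow> 'a list" where
  "sel_pos I xs = nths xs {j. Suc j \<in> I}"

text \<open>
  A linear map \<open>A\<^bsup>\<otimes>(|\<omega>|-|I|)\<^esup> \<otimes> U\<^bsup>\<otimes>|I|\<^esup> \<rightarrow> U\<close> is a function of two tuples, of lengths
  \<open>|\<omega>|-|I|\<close> and \<open>|I|\<close>, that is linear in each entry of either tuple.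
\<close>

definition multilinear_actions ::
  "(nat set \<Rightarrow> nat set set) \<Rightarrow> 'v sym_basis \<Rightarrow> ('k::field \<Rightarrow> 'a::ab_group_add \<Rightarrow> 'a) \<Rightarrow>
   ('k \<Rightarrow> 'u::ab_group_add \<Rightarrow> 'u) \<Rightarrow> ('v \<Rightarrow> nat set \<Rightarrow> 'a list \<Rightarrow> 'u list \<Rightarrow> 'u) \<Rightarrow> bool" where
  "multilinear_actions C V scA scU l \<longleftrightarrow>
     (\<forall>\<omega>\<in>basis V. \<forall>I\<in>C {1..arity V \<omega>}. \<forall>xs us.
        length xs = arity V \<omega> - card I \<and> length us = card I \<longrightarrow>
          (\<forall>i<length xs. Vector_Spaces.linear scA scU (\<lambda>a. l \<omega> I (xs[i := a]) us)) \<and>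
          (\<forall>j<length us. Vector_Spaces.linear scU scU (\<lambda>u. l \<omega> I xs (us[j := u]))))"

definition sum_scale :: "('k \<Rightarrow> 'a \<Rightarrow> 'a) \<Rightarrow> ('k \<Rightarrow> 'u \<Rightarrow> 'u) \<Rightarrow> 'k \<Rightarrow> 'a \<times> 'u \<Rightarrow> 'a \<times> 'u" where
  "sum_scale scA scU c z = (scA c (fst z), scU c (snd z))"

definition sum_ops ::
  "(nat set \<Rightarrow> nat set set) \<Rightarrow> 'v sym_basis \<Rightarrow> ('v \<Rightarrow> 'a list \<Rightarrow> 'a) \<Rightarrow>
   ('v \<Rightarrow> nat set \<Rightarrow> 'a list \<Rightarrow> 'u::ab_group_add list \<Rightarrow> 'u) \<Rightarrow> 'v \<Rightarrow> ('a \<times> 'u) list \<Rightarrow> 'a \<times> 'u" where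
  "sum_ops C V ops l \<omega> zs =
     (ops \<omega> (map fst zs),
      \<Sum>I\<in>C {1..arity V \<omega>}. l \<omega> I (del_pos I (map fst zs)) (sel_pos I (map snd zs)))"

definition C_module ::
  "(nat set \<Rightarrow> nat set set) \<Rightarrow> 'v sym_basis \<Rightarrow> ('v ltree \<Rightarrow>\<^sub>0 'k::field) set \<Rightarrow>
   ('k \<Rightarrow> 'a::ab_group_add \<Rightarrow> 'a) \<Rightarrow> ('v \<Rightarrow> 'a list \<Rightarrow> 'a) \<Rightarrow>
   ('k \<Rightarrow> 'u::ab_group_add \<Rightarrow> 'u) \<Rightarrow> ('v \<Rightarrow> nat set \<Rightarrow> 'a list \<Rightarrow> 'u list \<Rightarrow> 'u) \<Rightarrow> bool" where
  "C_module C V R scA ops scU l \<longleftrightarrow>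
     operad_algebra V R scA ops \<and> vector_space scU \<and> multilinear_actions C V scA scU l \<and>
     operad_algebra V R (sum_scale scA scU) (sum_ops C V ops l)"

definition derived_ops ::
  "('u \<Rightarrow> 'a) \<Rightarrow> ('v \<Rightarrow> nat set \<Rightarrow> 'a list \<Rightarrow> 'u list \<Rightarrow> 'u) \<Rightarrow> 'v \<times> nat set \<Rightarrow> 'u list \<Rightarrow> 'u" where
  "derived_ops \<alpha> l = (\<lambda>(\<omega>, I) us. l \<omega> I (del_pos I (map \<alpha> us)) (sel_pos I us))"

definition relative_Rota_Baxter ::
  "(nat set \<Rightarrow> nat set set) \<Rightarrow> 'v sym_basis \<Rightarrow> ('v ltree \<Rightarrow>\<^sub>0 'k::field) set \<Rightarrow>
   ('k \<Rightarrow> 'a::ab_group_add \<Rightarrow> 'a) \<Rightarrow> ('v \<Rightarrow> 'a list \<Rightarrow> 'a) \<Rightarrow>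
   ('k \<Rightarrow> 'u::ab_group_add \<Rightarrow> 'u) \<Rightarrow> ('v \<Rightarrow> nat set \<Rightarrow> 'a list \<Rightarrow> 'u list \<Rightarrow> 'u) \<Rightarrow>
   ('u \<Rightarrow> 'a) \<Rightarrow> bool" where
  "relative_Rota_Baxter C V R scA ops scU l \<alpha> \<longleftrightarrow>
     C_module C V R scA ops scU l \<and> Vector_Spaces.linear scU scA \<alpha> \<and>
     (\<forall>\<omega>\<in>basis V. \<forall>us. length us = arity V \<omega> \<longrightarrow>
        ops \<omega> (map \<alpha> us) =
          (\<Sum>I\<in>C {1..arity V \<omega>}. \<alpha> (l \<omega> I (del_pos I (map \<alpha> us)) (sel_pos I us))))"

definition star_ops ::
  "(nat set \<Rightarrow> nat set set) \<Rightarrow> 'v sym_basis \<Rightarrow> ('v \<times> nat set \<Rightarrow> 'a list \<Rightarrow> 'a::ab_group_add) \<Rightarrow>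
   'v \<Rightarrow> 'a list \<Rightarrow> 'a" where
  "star_ops C V ops \<omega> xs = (\<Sum>I\<in>C {1..arity V \<omega>}. ops (\<omega>, I) xs)"

text \<open>
  The map \<open>l\<^sub>I\<^sup>\<omega>\<close> with \<open>l\<^sub>I\<^sup>\<omega>(x\<^sub>I)(\<^sub>Ix) = (\<omega>, I)(x)\<close>: an \<open>|\<omega>|\<close>-tuple is determined by its entries
  outside and inside \<open>I\<close>, and these are arbitrary tuples of lengths \<open>|\<omega>|-|I|\<close> and \<open>|I|\<close>.
\<close>

definition split_actions ::
  "'v sym_basis \<Rightarrow> ('v \<times> nat set \<Rightarrow> 'a list \<Rightarrow> 'a) \<Rightarrow> 'v \<Rightarrow> nat set \<Rightarrow> 'a list \<Rightarrow> 'a list \<Rightarrow> 'a" where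
  "split_actions V ops \<omega> I ys zs =
     ops (\<omega>, I) (THE xs. length xs = arity V \<omega> \<and> del_pos I xs = ys \<and> sel_pos I xs = zs)"

end

theory Submission
  imports Defs "HOL-Library.FuncSet"
begin

text \<open>
  An algebra over a presented operad amounts to multilinear equivariant operations for which every
  relation evaluates to zero: the morphism to the endomorphism operad is forced to be the
  evaluation of trees, and it descends to both quotients. In \<open>A \<oplus> A\<close> with the operations of the
  module, expanding by multilinearity along a tree \<open>\<tau>\<close> gives
  \<open>\<tau>(x, u) = (Sp\<^sub>\<emptyset>(\<tau>)(x), \<Sum>J. Sp\<^sub>J(\<tau>)(x\<^sup>J))\<close>,
  where \<open>x\<^sup>J\<close> has the entries \<open>u\<^sub>i\<close> at the leaves in \<open>J\<close> and \<open>x\<^sub>i\<close> elsewhere, and \<open>J\<close> ranges over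
  the elements of \<open>C (Lin \<tau>)\<close>. The second component of a relation vanishes because every
  \<open>Sp\<^sub>J\<close> of it is a relation of \<open>\<C>Sp(\<P>)\<close>. Restricting to the diagonal \<open>u = x\<close> shows
  \<open>Sp\<^sub>\<emptyset> = (\<Sum>J. Sp\<^sub>J)\<close>, so the first component vanishes as well.
\<close>

section \<open>Quotients of operads by ideals\<close>

text \<open>Hypothesis and conclusion both speak of morphisms out of a quotient of a quotient whose
  operations use chosen coset representatives. The criterion for algebras is therefore needed in
  both directions: \<open>operad_algebraD\<close> unpacks the hypothesis on the split operad,
  \<open>operad_algebraI\<close> produces the structures on A and on A \<oplus> A; in between only
  trees occur. The expansion along a tree closes up because of one property of both families,
  \<open>family_union\<close>: a member of \<open>C\<close> on a disjoint union amounts to a member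
  of \<open>C\<close> on the index set, namely the blocks that are met, together with a member of
  \<open>C\<close> on each of these blocks. The diagonal argument is there because the empty set
  belongs to neither family, so the starred splitting of a relation is not itself among the defining
  relations of the split operad. Its vanishing has to be deduced from that of the other
  splittings.\<close>

lemma label_set_relabelling: "relabelling L h \<Longrightarrow> label_set (h ` L)"
  by (auto simp: relabelling_def label_set_def)

lemma label_set_composable: "composable L i M \<Longrightarrow> label_set ((L - {i}) \<union> M)"
  by (auto simp: composable_def label_set_def)

lemma operad_morphismD:
  assumes "operad_morphism P Q \<phi>"
  shows morphism_closed: "\<lbrakk>label_set L; x \<in> ospace P L\<rbrakk> \<Longrightarrow> \<phi> L x \<in> ospace Q L"
    and morphism_add: "\<lbrakk>label_set L; x \<in> ospace P L; y \<in> ospace P L\<rbrakk> \<Longrightarrow>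
      \<phi> L (oadd P L x y) = oadd Q L (\<phi> L x) (\<phi> L y)"
    and morphism_scale: "\<lbrakk>label_set L; x \<in> ospace P L\<rbrakk> \<Longrightarrow>
      \<phi> L (oscale P L c x) = oscale Q L c (\<phi> L x)"
    and morphism_relabel: "\<lbrakk>relabelling L h; x \<in> ospace P L\<rbrakk> \<Longrightarrow>
      \<phi> (h ` L) (orelabel P L h x) = orelabel Q L h (\<phi> L x)"
    and morphism_comp: "\<lbrakk>composable L i M; x \<in> ospace P L; y \<in> ospace P M\<rbrakk> \<Longrightarrow>
      \<phi> ((L - {i}) \<union> M) (ocomp P L i M x y) = ocomp Q L i M (\<phi> L x) (\<phi> M y)"
    and morphism_unit: "i > 0 \<Longrightarrow> \<phi> {i} (ounit P i) = ounit Q i"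
  using assms unfolding operad_morphism_def by simp_all

text \<open>The laws behind coset arithmetic. A locale serves here because they are used for three
  sources of morphisms (the trees and the two successive quotients) and for the endomorphism operad
  as a target. Subtraction is scaling by -1.\<close>

locale additive_operad =
  fixes P :: "('k::field, 'p) operad"
  assumes add_closed: "\<lbrakk>label_set L; x \<in> ospace P L; y \<in> ospace P L\<rbrakk> \<Longrightarrow> oadd P L x y \<in> ospace P L"
    and zero_closed: "label_set L \<Longrightarrow> ozero P L \<in> ospace P L"
    and scale_closed: "\<lbrakk>label_set L; x \<in> ospace P L\<rbrakk> \<Longrightarrow> oscale P L c x \<in> ospace P L"
    and add_assoc: "\<lbrakk>label_set L; x \<in> ospace P L; y \<in> ospace P L; z \<in> ospace P L\<rbrakk> \<Longrightarrow>
      oadd P L (oadd P L x y) z = oadd P L x (oadd P L y z)"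
    and add_commute: "\<lbrakk>label_set L; x \<in> ospace P L; y \<in> ospace P L\<rbrakk> \<Longrightarrow> oadd P L x y = oadd P L y x"
    and add_zero: "\<lbrakk>label_set L; x \<in> ospace P L\<rbrakk> \<Longrightarrow> oadd P L x (ozero P L) = x"
    and add_inverse: "\<lbrakk>label_set L; x \<in> ospace P L\<rbrakk> \<Longrightarrow> oadd P L x (oscale P L (-1) x) = ozero P L"
    and scale_add: "\<lbrakk>label_set L; x \<in> ospace P L; y \<in> ospace P L\<rbrakk> \<Longrightarrow>
      oscale P L c (oadd P L x y) = oadd P L (oscale P L c x) (oscale P L c y)"
    and relabel_closed: "\<lbrakk>relabelling L h; x \<in> ospace P L\<rbrakk> \<Longrightarrow> orelabel P L h x \<in> ospace P (h ` L)"
    and relabel_add: "\<lbrakk>relabelling L h; x \<in> ospace P L; y \<in> ospace P L\<rbrakk> \<Longrightarrow>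
      orelabel P L h (oadd P L x y) = oadd P (h ` L) (orelabel P L h x) (orelabel P L h y)"
    and comp_closed: "\<lbrakk>composable L i M; x \<in> ospace P L; y \<in> ospace P M\<rbrakk> \<Longrightarrow>
      ocomp P L i M x y \<in> ospace P ((L - {i}) \<union> M)"
    and comp_add_left: "\<lbrakk>composable L i M; x \<in> ospace P L; x' \<in> ospace P L; y \<in> ospace P M\<rbrakk> \<Longrightarrow>
      ocomp P L i M (oadd P L x x') y =
        oadd P ((L - {i}) \<union> M) (ocomp P L i M x y) (ocomp P L i M x' y)"
    and comp_add_right: "\<lbrakk>composable L i M; x \<in> ospace P L; y \<in> ospace P M; y' \<in> ospace P M\<rbrakk> \<Longrightarrow>
      ocomp P L i M x (oadd P M y y') =
        oadd P ((L - {i}) \<union> M) (ocomp P L i M x y) (ocomp P L i M x y')"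
    and unit_closed: "i > 0 \<Longrightarrow> ounit P i \<in> ospace P {i}"
begin

text \<open>Cancel by the inverse. Since 0 + 0 = 0, every additive map sends zero to an element of
  this kind; preservation of zero by scaling, relabelling, composition and morphisms is obtained in
  this way.\<close>

lemma idem_zero:
  assumes "label_set L" "x \<in> ospace P L" "oadd P L x x = x"
  shows "x = ozero P L"
  by (metis add_assoc add_inverse add_zero assms scale_closed)

lemma scale_zero: "label_set L \<Longrightarrow> oscale P L c (ozero P L) = ozero P L"
  by (metis add_zero idem_zero scale_add scale_closed zero_closed)

lemma relabel_zero: "relabelling L h \<Longrightarrow> orelabel P L h (ozero P L) = ozero P (h ` L)"
  by (metis add_zero idem_zero label_set_relabelling relabel_add relabel_closed relabelling_def
      zero_closed)

lemma comp_zero_left: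
  "\<lbrakk>composable L i M; y \<in> ospace P M\<rbrakk> \<Longrightarrow> ocomp P L i M (ozero P L) y = ozero P ((L - {i}) \<union> M)"
  by (metis add_zero idem_zero label_set_composable comp_add_left comp_closed composable_def
      zero_closed)

lemma comp_zero_right:
  "\<lbrakk>composable L i M; x \<in> ospace P L\<rbrakk> \<Longrightarrow> ocomp P L i M x (ozero P M) = ozero P ((L - {i}) \<union> M)"
  by (metis add_zero idem_zero label_set_composable comp_add_right comp_closed composable_def
      zero_closed)

lemma ideal_space:
  assumes "operad_ideal P G L x"
  shows "label_set L \<and> x \<in> ospace P L"
  using assms
proof induction
  case (comp_left L x y M i)
  then show ?case using label_set_composable comp_closed by auto
next
  case (comp_right x L M y i)
  then show ?case using label_set_composable comp_closed by auto
qed (auto simp: zero_closed add_closed scale_closed label_set_relabelling relabel_closed)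

lemma coset_eq:
  assumes L: "label_set L" "x \<in> ospace P L" and y: "operad_ideal P G L y"
  shows "ocoset P (operad_ideal P G) L (oadd P L x y) = ocoset P (operad_ideal P G) L x"
proof -
  have ys: "y \<in> ospace P L" using ideal_space[OF y] by simp
  have "oadd P L x z \<in> ocoset P (operad_ideal P G) L (oadd P L x y)" if z: "operad_ideal P G L z" for z
  proof -
    have zs: "z \<in> ospace P L" using ideal_space[OF z] by simp
    \<comment> \<open>The witness is z - y: added to x + y it gives x + z.\<close>
    let ?w = "oadd P L (oscale P L (-1) y) z"
    have "operad_ideal P G L ?w" using y z by (intro operad_ideal.add operad_ideal.scale)
    moreover have "oadd P L (oadd P L x y) ?w = oadd P L x z"
    proof -
      have "oadd P L (oadd P L x y) ?w = oadd P L x (oadd P L (oadd P L y (oscale P L (-1) y)) z)"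
        using L ys zs by (simp add: add_assoc add_closed scale_closed)
      then show ?thesis
        using L ys zs by (simp add: add_inverse zero_closed add_commute[of L "ozero P L"] add_zero)
    qed
    ultimately show ?thesis unfolding ocoset_def by force
  qed
  moreover have "oadd P L (oadd P L x y) z \<in> ocoset P (operad_ideal P G) L x"
    if z: "operad_ideal P G L z" for z
    using ideal_space[OF z] add_assoc[OF L ys] operad_ideal.add[OF y z] unfolding ocoset_def by auto
  ultimately show ?thesis unfolding ocoset_def by blast
qed

text \<open>\<open>coset_rep\<close> is a Hilbert choice. The coset is inhabited, as it contains x +
  0, so the choice differs from x by an element of the ideal.\<close>

lemma coset_repE:
  assumes "label_set L" "x \<in> ospace P L"
  obtains y where "operad_ideal P G L y"
    "coset_rep (ocoset P (operad_ideal P G) L x) = oadd P L x y"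
proof -
  have "oadd P L x (ozero P L) \<in> ocoset P (operad_ideal P G) L x"
    unfolding ocoset_def using operad_ideal.zero assms(1) by blast
  then have "coset_rep (ocoset P (operad_ideal P G) L x) \<in> ocoset P (operad_ideal P G) L x"
    unfolding coset_rep_def by (rule someI)
  then show ?thesis using that unfolding ocoset_def by auto
qed

section \<open>Computing in the quotient with arbitrary representatives\<close>

lemma quotient_ospace:
  "ospace (quotient_operad P I) L = ocoset P I L ` ospace P L"
  by (simp add: quotient_operad_def)

lemma quotient_zero:
  "ozero (quotient_operad P I) L = ocoset P I L (ozero P L)"
  by (simp add: quotient_operad_def)

lemma quotient_unit:
  "ounit (quotient_operad P I) i = ocoset P I {i} (ounit P i)"
  by (simp add: quotient_operad_def)

text \<open>The chosen representatives are x + u and y + v with errors in the ideal; their sum is x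
  + y plus the error u + v, which \<open>coset_eq\<close> absorbs. The next two lemmas push a single
  error through a map in the same way.\<close>

lemma quotient_add:
  fixes G :: "nat set \<Rightarrow> 'p set"
  assumes L: "label_set L" "x \<in> ospace P L" "y \<in> ospace P L"
  defines "I \<equiv> operad_ideal P G"
  shows "oadd (quotient_operad P I) L (ocoset P I L x) (ocoset P I L y) = ocoset P I L (oadd P L x y)"
proof -
  obtain u where u: "I L u" "coset_rep (ocoset P I L x) = oadd P L x u"
    using coset_repE L unfolding I_def by metis
  obtain v where v: "I L v" "coset_rep (ocoset P I L y) = oadd P L y v"
    using coset_repE L unfolding I_def by metis
  have us: "u \<in> ospace P L" "v \<in> ospace P L" using ideal_space u v unfolding I_def by auto
  have "oadd P L (oadd P L x u) (oadd P L y v) = oadd P L (oadd P L x y) (oadd P L u v)"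
  proof -
    have "oadd P L u (oadd P L y v) = oadd P L y (oadd P L u v)"
      using L us add_assoc[of L u y v] add_assoc[of L y u v] add_commute[of L u y] by simp
    then show ?thesis using L us by (simp add: add_assoc add_closed)
  qed
  moreover have "I L (oadd P L u v)" using u v unfolding I_def by (intro operad_ideal.add)
  ultimately show ?thesis
    using coset_eq[of L "oadd P L x y" G "oadd P L u v"] L add_closed u v
    by (simp add: quotient_operad_def I_def)
qed

lemma quotient_scale:
  fixes G :: "nat set \<Rightarrow> 'p set"
  assumes L: "label_set L" "x \<in> ospace P L"
  defines "I \<equiv> operad_ideal P G"
  shows "oscale (quotient_operad P I) L c (ocoset P I L x) = ocoset P I L (oscale P L c x)"
proof -
  obtain u where u: "I L u" "coset_rep (ocoset P I L x) = oadd P L x u"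
    using coset_repE L unfolding I_def by metis
  have "u \<in> ospace P L" using ideal_space u unfolding I_def by auto
  then show ?thesis
    using coset_eq[of L "oscale P L c x" G "oscale P L c u"] L u operad_ideal.scale[of P G L u c]
    by (simp add: quotient_operad_def I_def scale_add scale_closed)
qed

lemma quotient_relabel:
  fixes G :: "nat set \<Rightarrow> 'p set"
  assumes L: "relabelling L h" "x \<in> ospace P L"
  defines "I \<equiv> operad_ideal P G"
  shows "orelabel (quotient_operad P I) L h (ocoset P I L x) = ocoset P I (h ` L) (orelabel P L h x)"
proof -
  obtain u where u: "I L u" "coset_rep (ocoset P I L x) = oadd P L x u"
    using coset_repE L unfolding I_def relabelling_def by metis
  have "u \<in> ospace P L" using ideal_space u unfolding I_def by auto
  then show ?thesis
    using coset_eq[of "h ` L" "orelabel P L h x" G "orelabel P L h u"] L u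
      operad_ideal.relabel[of P G L u h] label_set_relabelling[of L h]
    by (simp add: quotient_operad_def I_def relabel_add relabel_closed)
qed

text \<open>The two errors are removed one after the other: u first, composed with the full y + v (a
  left composite of an ideal element), then v, composed with x alone (a right composite).\<close>

lemma quotient_comp:
  fixes G :: "nat set \<Rightarrow> 'p set"
  assumes L: "composable L i M" "x \<in> ospace P L" "y \<in> ospace P M"
  defines "I \<equiv> operad_ideal P G"
  shows "ocomp (quotient_operad P I) L i M (ocoset P I L x) (ocoset P I M y) =
    ocoset P I ((L - {i}) \<union> M) (ocomp P L i M x y)"
proof -
  let ?K = "(L - {i}) \<union> M"
  obtain u where u: "I L u" "coset_rep (ocoset P I L x) = oadd P L x u"
    using coset_repE L unfolding I_def composable_def by metis
  obtain v where v: "I M v" "coset_rep (ocoset P I M y) = oadd P M y v"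
    using coset_repE L unfolding I_def composable_def by metis
  have us: "u \<in> ospace P L" "v \<in> ospace P M" using ideal_space u v unfolding I_def by auto
  have ls: "label_set L" "label_set M" using L unfolding composable_def by auto
  have yv: "oadd P M y v \<in> ospace P M" using add_closed ls us L by auto
  have "ocoset P I ?K (ocomp P L i M (oadd P L x u) (oadd P M y v)) =
      ocoset P I ?K (oadd P ?K (ocomp P L i M x (oadd P M y v)) (ocomp P L i M u (oadd P M y v)))"
    using comp_add_left[OF L(1) L(2) us(1) yv] by simp
  also have "\<dots> = ocoset P I ?K (ocomp P L i M x (oadd P M y v))"
    unfolding I_def
    by (intro coset_eq label_set_composable comp_closed operad_ideal.comp_left L yv u(1)[unfolded I_def])
  also have "\<dots> = ocoset P I ?K (oadd P ?K (ocomp P L i M x y) (ocomp P L i M x v))"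
    using comp_add_right[OF L us(2)] by simp
  also have "\<dots> = ocoset P I ?K (ocomp P L i M x y)"
    unfolding I_def
    by (intro coset_eq label_set_composable comp_closed operad_ideal.comp_right L v(1)[unfolded I_def])
  finally show ?thesis using u v by (simp add: quotient_operad_def)
qed

lemmas quotient_simps =
  quotient_ospace quotient_zero quotient_unit quotient_add quotient_scale quotient_relabel quotient_comp

text \<open>The presented operad is a quotient of the free operad, which is itself a quotient, so
  the locale has to apply to its own quotients.\<close>

lemma additive_quotient: "additive_operad (quotient_operad P (operad_ideal P G))"
proof unfold_locales
  fix L :: "nat set" and h i M
  let ?Q = "quotient_operad P (operad_ideal P G)"
  {
    assume L: "label_set L"
    show "ozero ?Q L \<in> ospace ?Q L" using L by (simp add: quotient_simps zero_closed)
    fix x y z assume x: "x \<in> ospace ?Q L"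
    show "oscale ?Q L c x \<in> ospace ?Q L" for c
      using L x by (auto simp: quotient_simps scale_closed)
    show "oadd ?Q L x (ozero ?Q L) = x"
      using L x by (auto simp: quotient_simps zero_closed add_zero)
    show "oadd ?Q L x (oscale ?Q L (-1) x) = ozero ?Q L"
      using L x by (auto simp: quotient_simps scale_closed add_inverse)
    assume y: "y \<in> ospace ?Q L"
    show "oadd ?Q L x y \<in> ospace ?Q L"
      using L x y by (auto simp: quotient_simps add_closed)
    show "oadd ?Q L x y = oadd ?Q L y x"
      using L x y by (auto simp: quotient_simps add_commute)
    show "oscale ?Q L c (oadd ?Q L x y) = oadd ?Q L (oscale ?Q L c x) (oscale ?Q L c y)" for c
      using L x y by (auto simp: quotient_simps scale_closed add_closed scale_add)
    assume z: "z \<in> ospace ?Q L"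
    show "oadd ?Q L (oadd ?Q L x y) z = oadd ?Q L x (oadd ?Q L y z)"
      using L x y z by (auto simp: quotient_simps add_closed add_assoc)
  }
  {
    assume h: "relabelling L h"
    then have L: "label_set L" "label_set (h ` L)"
      using label_set_relabelling by (auto simp: relabelling_def)
    fix x y assume x: "x \<in> ospace ?Q L"
    show "orelabel ?Q L h x \<in> ospace ?Q (h ` L)"
      using h x by (auto simp: quotient_simps relabel_closed)
    assume y: "y \<in> ospace ?Q L"
    show "orelabel ?Q L h (oadd ?Q L x y) = oadd ?Q (h ` L) (orelabel ?Q L h x) (orelabel ?Q L h y)"
      using h L x y by (auto simp: quotient_simps add_closed relabel_closed relabel_add)
  }
  {
    assume c: "composable L i M"
    have L: "label_set L" "label_set M" "label_set ((L - {i}) \<union> M)"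
      using c label_set_composable by (auto simp: composable_def)
    fix x y x' y' assume x: "x \<in> ospace ?Q L" and y: "y \<in> ospace ?Q M"
    show "ocomp ?Q L i M x y \<in> ospace ?Q ((L - {i}) \<union> M)"
      using c x y by (auto simp: quotient_simps comp_closed)
    show "ocomp ?Q L i M (oadd ?Q L x x') y =
        oadd ?Q ((L - {i}) \<union> M) (ocomp ?Q L i M x y) (ocomp ?Q L i M x' y)"
      if "x' \<in> ospace ?Q L"
      using c L x y that by (auto simp: quotient_simps add_closed comp_closed comp_add_left)
    show "ocomp ?Q L i M x (oadd ?Q M y y') =
        oadd ?Q ((L - {i}) \<union> M) (ocomp ?Q L i M x y) (ocomp ?Q L i M x y')"
      if "y' \<in> ospace ?Q M"
      using c L x y that by (auto simp: quotient_simps add_closed comp_closed comp_add_right)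
  }
  show "ounit ?Q i \<in> ospace ?Q {i}" if "i > 0"
    using that by (simp add: quotient_simps unit_closed)
qed

lemma operad_morphism_coset:
  "operad_morphism P (quotient_operad P (operad_ideal P G)) (ocoset P (operad_ideal P G))"
  by (auto simp: operad_morphism_def quotient_simps)

text \<open>The way in which an algebra structure is exploited: relators and relations are zero in
  their quotients, hence are sent to zero by every morphism defined there.\<close>

lemma coset_ideal:
  assumes "operad_ideal P G L x"
  shows "ocoset P (operad_ideal P G) L x = ozero (quotient_operad P (operad_ideal P G)) L"
proof -
  have "label_set L" "x \<in> ospace P L" using ideal_space[OF assms] by auto
  moreover have "oadd P L (ozero P L) x = x"
    using calculation add_commute zero_closed add_zero by metis
  ultimately show ?thesis
    using coset_eq[OF _ zero_closed assms] by (simp add: quotient_zero)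
qed

section \<open>Morphisms out of a quotient\<close>

lemma morphism_zero:
  assumes "additive_operad Q" "operad_morphism P Q \<phi>" "label_set L"
  shows "\<phi> L (ozero P L) = ozero Q L"
proof -
  have "ozero P L \<in> ospace P L" "oadd P L (ozero P L) (ozero P L) = ozero P L"
    using assms(3) by (simp_all add: zero_closed add_zero)
  then show ?thesis
    using additive_operad.idem_zero[OF assms(1,3)] morphism_closed[OF assms(2,3)]
      morphism_add[OF assms(2,3)] by metis
qed

text \<open>The kernel of a morphism is closed under every rule generating the ideal, so it suffices
  to kill the generators. In the composition rules one factor is sent to zero, and composing with
  zero in \<open>Q\<close> gives zero.\<close>

lemma morphism_ideal:
  assumes Q: "additive_operad Q" and \<phi>: "operad_morphism P Q \<phi>"
    and gen: "\<And>L x. \<lbrakk>label_set L; x \<in> G L; x \<in> ospace P L\<rbrakk> \<Longrightarrow> \<phi> L x = ozero Q L"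
    and "operad_ideal P G L x"
  shows "\<phi> L x = ozero Q L"
  using assms(4)
proof induction
  case (add L x y)
  then have "label_set L" "x \<in> ospace P L" "y \<in> ospace P L" using ideal_space by blast+
  then show ?case
    using \<phi> add additive_operad.add_zero[OF Q] additive_operad.zero_closed[OF Q]
    unfolding operad_morphism_def by simp
next
  case (scale L x c)
  then have "label_set L" "x \<in> ospace P L" using ideal_space by blast+
  then show ?case using \<phi> scale additive_operad.scale_zero[OF Q]
    unfolding operad_morphism_def by simp
next
  case (relabel L x h)
  then have "x \<in> ospace P L" using ideal_space by blast
  then show ?case using \<phi> relabel additive_operad.relabel_zero[OF Q]
    unfolding operad_morphism_def by auto
next
  case (comp_left L x y M i)
  then have "x \<in> ospace P L" "\<phi> M y \<in> ospace Q M"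
    using ideal_space[OF comp_left(1)] morphism_closed[OF \<phi>] by (auto simp: composable_def)
  then show ?case
    using comp_left morphism_comp[OF \<phi>] additive_operad.comp_zero_left[OF Q] by simp
next
  case (comp_right x L M y i)
  then have "y \<in> ospace P M" "\<phi> L x \<in> ospace Q L"
    using ideal_space[OF comp_right(2)] morphism_closed[OF \<phi>] by (auto simp: composable_def)
  then show ?case
    using comp_right morphism_comp[OF \<phi>] additive_operad.comp_zero_right[OF Q] by simp
qed (use gen morphism_zero[OF Q \<phi>] in auto)

text \<open>The universal property of the quotient. The lift applies \<open>\<phi>\<close> to the
  chosen representative, whose difference from any other one is killed by
  \<open>\<phi>\<close>.\<close>

lemma quotient_lift:
  assumes Q: "additive_operad Q" and \<phi>: "operad_morphism P Q \<phi>"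
    and gen: "\<And>L x. \<lbrakk>label_set L; x \<in> G L; x \<in> ospace P L\<rbrakk> \<Longrightarrow> \<phi> L x = ozero Q L"
  obtains \<psi> where "operad_morphism (quotient_operad P (operad_ideal P G)) Q \<psi>"
    "\<And>L x. \<lbrakk>label_set L; x \<in> ospace P L\<rbrakk> \<Longrightarrow> \<psi> L (ocoset P (operad_ideal P G) L x) = \<phi> L x"
proof
  let ?\<psi> = "\<lambda>L X. \<phi> L (coset_rep X)"
  show eq: "?\<psi> L (ocoset P (operad_ideal P G) L x) = \<phi> L x" if L: "label_set L" "x \<in> ospace P L" for L x
  proof -
    obtain u where u: "operad_ideal P G L u"
      "coset_rep (ocoset P (operad_ideal P G) L x) = oadd P L x u"
      using coset_repE L by metis
    have "\<phi> L (oadd P L x u) = oadd Q L (\<phi> L x) (\<phi> L u)" "\<phi> L x \<in> ospace Q L"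
      using L ideal_space[OF u(1)] by (auto intro: morphism_add[OF \<phi>] morphism_closed[OF \<phi>])
    then show ?thesis
      using u morphism_ideal[OF Q \<phi> gen u(1)] additive_operad.add_zero[OF Q] L by simp
  qed
  have ls: "label_set L" if "relabelling L h" for L h using that by (simp add: relabelling_def)
  have lc: "label_set L" "label_set M" if "composable L i M" for L i M
    using that by (simp_all add: composable_def)
  have li: "label_set {i}" if "i > 0" for i using that by (simp add: label_set_def)
  show "operad_morphism (quotient_operad P (operad_ideal P G)) Q ?\<psi>"
    unfolding operad_morphism_def
  proof (intro conjI allI impI ballI, goal_cases)
    case (1 L x)
    then show ?case using operad_morphismD[OF \<phi>] by (auto simp: quotient_simps eq)
  next
    case (2 L x y)
    then show ?case using operad_morphismD[OF \<phi>] by (auto simp: quotient_simps eq add_closed)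
  next
    case (3 L c x)
    then show ?case using operad_morphismD[OF \<phi>] by (auto simp: quotient_simps eq scale_closed)
  next
    case (4 L h x)
    then obtain a where "a \<in> ospace P L" "x = ocoset P (operad_ideal P G) L a"
      by (auto simp: quotient_simps)
    with 4 show ?case using operad_morphismD[OF \<phi>]
      by (simp add: quotient_simps eq relabel_closed label_set_relabelling ls)
  next
    case (5 L i M x y)
    then obtain a b where "a \<in> ospace P L" "x = ocoset P (operad_ideal P G) L a"
      "b \<in> ospace P M" "y = ocoset P (operad_ideal P G) M b"
      by (auto simp: quotient_simps)
    with 5 show ?case using operad_morphismD[OF \<phi>] lc[OF 5(1)]
      by (simp add: quotient_simps eq comp_closed label_set_composable)
  next
    case (6 i)
    then show ?case using operad_morphismD[OF \<phi>] by (simp add: quotient_simps eq unit_closed li)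
  qed
qed

end

lemma operad_morphism_comp:
  assumes "operad_morphism P Q \<phi>" "operad_morphism Q S \<psi>"
  shows "operad_morphism P S (\<lambda>L x. \<psi> L (\<phi> L x))"
proof -
  have "label_set L" if "relabelling L h" for L h using that by (simp add: relabelling_def)
  moreover have "label_set L" "label_set M" if "composable L i M" for L i M
    using that by (simp_all add: composable_def)
  ultimately show ?thesis using assms unfolding operad_morphism_def by simp
qed

section \<open>Evaluation of trees\<close>

text \<open>Linear extension with values in an arbitrary space. \<open>lin_ext\<close> is the case
  of formal combinations as values, so facts about both are shown once.\<close>

definition lin_eval :: "('k::field \<Rightarrow> 'a::ab_group_add \<Rightarrow> 'a) \<Rightarrow> ('b \<Rightarrow> 'a) \<Rightarrow> ('b \<Rightarrow>\<^sub>0 'k) \<Rightarrow> 'a" where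
  "lin_eval sc F f = (\<Sum>b\<in>Poly_Mapping.keys f. sc (Poly_Mapping.lookup f b) (F b))"

lemma lin_ext_eq_lin_eval: "lin_ext = lin_eval scale_pm"
  by (simp add: fun_eq_iff lin_ext_def lin_eval_def)

lemma lookup_scale_pm [simp]: "Poly_Mapping.lookup (scale_pm c f) b = c * Poly_Mapping.lookup f b"
  by (simp add: scale_pm_def Poly_Mapping.map.rep_eq when_def)

lemma keys_scale_pm: "Poly_Mapping.keys (scale_pm c f) \<subseteq> Poly_Mapping.keys f"
  by (auto simp: in_keys_iff)

lemma vector_space_scale_pm: "vector_space scale_pm"
  by unfold_locales (auto intro!: poly_mapping_eqI simp: lookup_add algebra_simps)

text \<open>Two combinations have different supports, and scaling or adding may shrink a support; a
  common finite index set makes their sums comparable.\<close>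

lemma lin_eval_superset:
  assumes "vector_space sc" "finite S" "Poly_Mapping.keys f \<subseteq> S"
  shows "lin_eval sc F f = (\<Sum>b\<in>S. sc (Poly_Mapping.lookup f b) (F b))"
proof -
  interpret vector_space sc by fact
  show ?thesis unfolding lin_eval_def
    using assms(2,3) by (intro sum.mono_neutral_left) (auto simp: in_keys_iff)
qed

lemma lin_eval_cong:
  "(\<And>b. b \<in> Poly_Mapping.keys f \<Longrightarrow> F b = G b) \<Longrightarrow> lin_eval sc F f = lin_eval sc G f"
  by (simp add: lin_eval_def)

lemma lin_eval_single:
  assumes "vector_space sc"
  shows "lin_eval sc F (basis_vec b) = F b"
proof -
  interpret vector_space sc by fact
  show ?thesis by (simp add: lin_eval_def)
qed

lemma linear_lin_eval:
  assumes "vector_space sc"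
  shows "Vector_Spaces.linear scale_pm sc (lin_eval sc F)"
proof -
  interpret vector_space sc by fact
  have "lin_eval sc F (f + g) = lin_eval sc F f + lin_eval sc F g" for f g
  proof -
    let ?S = "Poly_Mapping.keys f \<union> Poly_Mapping.keys g"
    have "finite ?S" "Poly_Mapping.keys (f + g) \<subseteq> ?S" by (auto simp: keys_add)
    then show ?thesis
      using lin_eval_superset[OF assms, of ?S]
      by (simp add: lookup_add scale_left_distrib sum.distrib)
  qed
  moreover have "lin_eval sc F (scale_pm c f) = sc c (lin_eval sc F f)" for c f
    using lin_eval_superset[OF assms _ keys_scale_pm]
    by (simp add: lin_eval_def scale_sum_right)
  ultimately show ?thesis
    using assms vector_space_scale_pm by (simp add: Vector_Spaces.linear_iff)
qed

lemma lin_eval_add: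
  "vector_space sc \<Longrightarrow> lin_eval sc F (f + g) = lin_eval sc F f + lin_eval sc F g"
  using linear_lin_eval[of sc F] by (simp add: Vector_Spaces.linear_iff)

lemma lin_eval_scale:
  "vector_space sc \<Longrightarrow> lin_eval sc F (scale_pm c f) = sc c (lin_eval sc F f)"
  using linear_lin_eval[of sc F] by (simp add: Vector_Spaces.linear_iff)

lemma lin_eval_zero [simp]: "lin_eval sc F 0 = 0"
  by (simp add: lin_eval_def)

lemma lin_eval_diff:
  assumes "vector_space sc"
  shows "lin_eval sc F (f - g) = lin_eval sc F f - lin_eval sc F g"
  using lin_eval_add[OF assms, of F "f - g" g] by simp

lemma lin_eval_sum:
  assumes "vector_space sc"
  shows "lin_eval sc F (\<Sum>j\<in>S. f j) = (\<Sum>j\<in>S. lin_eval sc F (f j))"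
  by (induction S rule: infinite_finite_induct) (simp_all add: lin_eval_add[OF assms])

lemma linear_image_lin_eval:
  assumes "Vector_Spaces.linear s1 s2 T"
  shows "T (lin_eval s1 F f) = lin_eval s2 (\<lambda>b. T (F b)) f"
proof -
  interpret Vector_Spaces.linear s1 s2 T by fact
  show ?thesis by (simp add: lin_eval_def sum scale)
qed

lemma lin_eval_lin_ext:
  assumes "vector_space sc"
  shows "lin_eval sc F (lin_ext G f) = lin_eval sc (\<lambda>b. lin_eval sc F (G b)) f"
  unfolding lin_ext_eq_lin_eval by (rule linear_image_lin_eval[OF linear_lin_eval[OF assms]])

lemma lin_eval_add_fun:
  assumes "vector_space sc"
  shows "lin_eval sc (\<lambda>b. F b + G b) f = lin_eval sc F f + lin_eval sc G f"
proof -
  interpret vector_space sc by fact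
  show ?thesis by (simp add: lin_eval_def scale_right_distrib sum.distrib)
qed

lemma lin_eval_scale_fun:
  assumes "vector_space sc"
  shows "lin_eval sc (\<lambda>b. sc c (F b)) f = sc c (lin_eval sc F f)"
proof -
  interpret vector_space sc by fact
  show ?thesis by (simp add: lin_eval_def scale_sum_right mult.commute)
qed

lemma lin_eval_sum_fun:
  assumes "vector_space sc"
  shows "lin_eval sc (\<lambda>b. \<Sum>j\<in>S. F j b) f = (\<Sum>j\<in>S. lin_eval sc (F j) f)"
proof -
  interpret vector_space sc by fact
  show ?thesis by (simp add: lin_eval_def scale_sum_right sum.swap[of _ S])
qed

lemma lin_ext_basis_vec: "lin_ext basis_vec f = f"
proof -
  have "(\<Sum>b\<in>Poly_Mapping.keys f. Poly_Mapping.lookup f b * (1 when b = k)) = Poly_Mapping.lookup f k" for k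
    by (simp add: when_def if_distrib[of "(*) _"] sum.delta in_keys_iff cong: if_cong)
  then show ?thesis
    unfolding lin_ext_def by (intro poly_mapping_eqI) (simp add: lookup_sum lookup_single)
qed

lemma lin_ext_add: "lin_ext F (f + g) = lin_ext F f + lin_ext F g"
  by (simp add: lin_ext_eq_lin_eval lin_eval_add vector_space_scale_pm)

lemma lin_ext_add_fun: "lin_ext (\<lambda>b. F b + G b) f = lin_ext F f + lin_ext G f"
  by (simp add: lin_ext_eq_lin_eval lin_eval_add_fun vector_space_scale_pm)

lemma lin_ext_basis: "lin_ext F (basis_vec b) = F b"
  by (simp add: lin_ext_eq_lin_eval lin_eval_single vector_space_scale_pm)

section \<open>Labelled trees under combination, relabelling and substitution\<close>

lemma tree_space_add: "f \<in> tree_space V L \<Longrightarrow> g \<in> tree_space V L \<Longrightarrow> f + g \<in> tree_space V L"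
  using keys_add by (fastforce simp: tree_space_def)

lemma tree_space_diff:
  fixes f g :: "'v ltree \<Rightarrow>\<^sub>0 'k::field"
  shows "f \<in> tree_space V L \<Longrightarrow> g \<in> tree_space V L \<Longrightarrow> f - g \<in> tree_space V L"
  using keys_diff[of f g] by (fastforce simp: tree_space_def)

lemma tree_space_zero: "0 \<in> tree_space V L"
  by (simp add: tree_space_def)

lemma tree_space_scale: "f \<in> tree_space V L \<Longrightarrow> scale_pm c f \<in> tree_space V L"
  using keys_scale_pm by (fastforce simp: tree_space_def)

lemma tree_space_sum: "(\<And>j. j \<in> S \<Longrightarrow> f j \<in> tree_space V L) \<Longrightarrow> (\<Sum>j\<in>S. f j) \<in> tree_space V L"
  by (induction S rule: infinite_finite_induct) (auto simp: tree_space_zero tree_space_add)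

lemma tree_space_lin_ext:
  "(\<And>t. t \<in> Poly_Mapping.keys f \<Longrightarrow> F t \<in> tree_space V L) \<Longrightarrow> lin_ext F f \<in> tree_space V L"
  unfolding lin_ext_def by (intro tree_space_sum tree_space_scale)

lemma tree_space_basis:
  "(basis_vec t :: 'v ltree \<Rightarrow>\<^sub>0 'k::field) \<in> tree_space V L \<longleftrightarrow> labelled_tree V t \<and> Lin t = L"
  by (simp add: tree_space_def)

lemma Lin_Leaf [simp]: "Lin (Leaf i) = {i}"
  by (simp add: Lin_def)

lemma Lin_Node [simp]: "Lin (Node \<omega> ts) = (\<Union>t\<in>set ts. Lin t)"
  by (auto simp: Lin_def)

lemma leaves_relabel_tree: "leaves (relabel_tree h t) = map h (leaves t)"
  by (induction t) (auto simp: map_concat comp_def intro!: arg_cong[where f = concat])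

lemma decorated_relabel_tree: "decorated V (relabel_tree h t) = decorated V t"
  by (induction t) auto

lemma labelled_relabel_tree:
  assumes "labelled_tree V t" "relabelling (Lin t) h"
  shows "labelled_tree V (relabel_tree h t)" "Lin (relabel_tree h t) = h ` Lin t"
  using assms by (auto simp: labelled_tree_def relabelling_def decorated_relabel_tree
      leaves_relabel_tree Lin_def distinct_map)

lemma leaves_subst_tree:
  "leaves (subst_tree i s t) = concat (map (\<lambda>j. if j = i then leaves s else [j]) (leaves t))"
proof (induction t)
  case (Node \<omega> ts)
  then show ?case by (induction ts) auto
qed simp

lemma decorated_subst_tree: "decorated V s \<Longrightarrow> decorated V t \<Longrightarrow> decorated V (subst_tree i s t)"
  by (induction t) auto

lemma distinct_subst_list:
  assumes "distinct xs" "distinct ys" "set ys \<inter> (set xs - {i}) = {}"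
  shows "distinct (concat (map (\<lambda>j. if j = i then ys else [j]) xs))"
  using assms by (induction xs) (auto split: if_splits)

lemma labelled_subst_tree:
  assumes "labelled_tree V t" "labelled_tree V s" "composable (Lin t) i (Lin s)"
  shows "labelled_tree V (subst_tree i s t)" "Lin (subst_tree i s t) = (Lin t - {i}) \<union> Lin s"
proof -
  show L: "Lin (subst_tree i s t) = (Lin t - {i}) \<union> Lin s"
    using assms(3) by (auto simp: composable_def Lin_def leaves_subst_tree split: if_splits)
  show "labelled_tree V (subst_tree i s t)"
    using assms distinct_subst_list[of "leaves t" "leaves s" i]
    unfolding labelled_tree_def L by (auto simp: composable_def decorated_subst_tree leaves_subst_tree Lin_def)
qed

lemma tree_operad_sel:
  "ospace (tree_operad V) = tree_space V"
  "oadd (tree_operad V) = (\<lambda>L f g. f + g)"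
  "ozero (tree_operad V) = (\<lambda>L. 0)"
  "oscale (tree_operad V) = (\<lambda>L c f. scale_pm c f)"
  "orelabel (tree_operad V) = (\<lambda>L h f. lin_ext (\<lambda>t. basis_vec (relabel_tree h t)) f)"
  "ocomp (tree_operad V) = (\<lambda>L i M f g. lin_ext (\<lambda>t. lin_ext (\<lambda>s. basis_vec (subst_tree i s t)) g) f)"
  "ounit (tree_operad V) = (\<lambda>i. basis_vec (Leaf i))"
  by (simp_all add: tree_operad_def)

lemma tree_space_relabel:
  assumes "relabelling L h" "f \<in> tree_space V L"
  shows "lin_ext (\<lambda>t. basis_vec (relabel_tree h t)) f \<in> tree_space V (h ` L)"
  using assms labelled_relabel_tree[of V _ h]
  by (auto simp: tree_space_basis tree_space_def[of V L] intro!: tree_space_lin_ext[of f])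

lemma tree_space_subst:
  assumes "composable L i M" "f \<in> tree_space V L" "g \<in> tree_space V M"
  shows "lin_ext (\<lambda>t. lin_ext (\<lambda>s. basis_vec (subst_tree i s t)) g) f \<in> tree_space V ((L - {i}) \<union> M)"
proof (intro tree_space_lin_ext)
  fix t s assume "t \<in> Poly_Mapping.keys f" "s \<in> Poly_Mapping.keys g"
  then have "labelled_tree V t" "Lin t = L" "labelled_tree V s" "Lin s = M"
    using assms(2,3) by (auto simp: tree_space_def)
  then show "basis_vec (subst_tree i s t) \<in> tree_space V ((L - {i}) \<union> M)"
    using labelled_subst_tree[of V t s i] assms(1) by (simp add: tree_space_basis)
qed

lemma additive_tree_operad: "additive_operad (tree_operad V :: ('k::field, 'v ltree \<Rightarrow>\<^sub>0 'k) operad)"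
proof unfold_locales
  fix L :: "nat set" and x y z :: "'v ltree \<Rightarrow>\<^sub>0 'k" and c :: 'k
  let ?T = "tree_operad V :: ('k, 'v ltree \<Rightarrow>\<^sub>0 'k) operad"
  show "oadd ?T L x (oscale ?T L (-1) x) = ozero ?T L"
    by (auto simp: tree_operad_def lookup_add intro: poly_mapping_eqI)
  show "oscale ?T L c (oadd ?T L x y) = oadd ?T L (oscale ?T L c x) (oscale ?T L c y)"
    by (auto simp: tree_operad_def lookup_add algebra_simps intro: poly_mapping_eqI)
  show "ounit ?T i \<in> ospace ?T {i}" if "i > 0" for i
    using that by (auto simp: tree_operad_def tree_space_basis labelled_tree_def)
qed (auto simp: tree_operad_def tree_space_relabel tree_space_subst tree_space_add tree_space_zero tree_space_scale add_ac lin_ext_add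
    lin_ext_add_fun)

section \<open>The endomorphism operad\<close>

lemma additive_End_operad:
  assumes "vector_space sc"
  shows "additive_operad (End_operad sc)"
proof -
  interpret vector_space sc by fact
  let ?E = "End_operad sc"
  show ?thesis
  proof unfold_locales
    fix L :: "nat set" and x y :: "(nat \<Rightarrow> 'b) \<Rightarrow> 'b" and c
    assume L: "label_set L" and x: "x \<in> ospace ?E L"
    show "oscale ?E L c x \<in> ospace ?E L"
      using x by (auto simp: End_operad_def Vector_Spaces.linear_iff algebra_simps)
    assume y: "y \<in> ospace ?E L"
    show "oadd ?E L x y \<in> ospace ?E L"
    proof -
      have "x u + y u = x v + y v" if "\<forall>i\<in>L. u i = v i" for u v
      proof -
        have "x u = x v" "y u = y v" using x y that by (simp_all add: End_operad_def)
        then show ?thesis by simp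
      qed
      then show ?thesis
        using x y by (simp add: End_operad_def Vector_Spaces.linear_iff algebra_simps)
    qed
  next
    fix L :: "nat set"
    show "ozero ?E L \<in> ospace ?E L"
      using assms by (auto simp: End_operad_def Vector_Spaces.linear_iff)
  next
    fix L :: "nat set" and h and f :: "(nat \<Rightarrow> 'b) \<Rightarrow> 'b"
    assume h: "relabelling L h" and f: "f \<in> ospace ?E L"
    have "f (x(h i := a) \<circ> h) = f ((x \<circ> h)(i := a))" if "i \<in> L" for i x a
    proof -
      \<comment> \<open>Injectivity of h on L: no other input reads the label h i.\<close>
      have "\<forall>j\<in>L. (x(h i := a) \<circ> h) j = ((x \<circ> h)(i := a)) j"
        using h that by (auto simp: relabelling_def inj_on_def)
      then show ?thesis using f by (auto simp: End_operad_def)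
    qed
    moreover have "f (x \<circ> h) = f (y \<circ> h)" if "\<forall>i\<in>h ` L. x i = y i" for x y
    proof -
      have "\<forall>j\<in>L. (x \<circ> h) j = (y \<circ> h) j" using that by auto
      then show ?thesis using f unfolding End_operad_def by simp
    qed
    ultimately show "orelabel ?E L h f \<in> ospace ?E (h ` L)"
      using f by (auto simp: End_operad_def)
  next
    fix L M :: "nat set" and i and f g g' :: "(nat \<Rightarrow> 'b) \<Rightarrow> 'b"
    assume c: "composable L i M" and f: "f \<in> ospace ?E L" and g: "g \<in> ospace ?E M"
    have fc: "f x = f y" if "\<forall>j\<in>L. x j = y j" for x y using f that by (simp add: End_operad_def)
    have gc: "g x = g y" if "\<forall>j\<in>M. x j = y j" for x y using g that by (simp add: End_operad_def)
    have fl: "Vector_Spaces.linear sc sc (\<lambda>a. f (x(j := a)))" if "j \<in> L" for j x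
      using f that by (simp add: End_operad_def)
    have gl: "Vector_Spaces.linear sc sc (\<lambda>a. g (x(j := a)))" if "j \<in> M" for j x
      using g that by (simp add: End_operad_def)
    have iL: "i \<in> L" and disj: "M \<inter> (L - {i}) = {}" using c by (auto simp: composable_def)
    have 1: "f (x(i := g x)) = f (y(i := g y))" if "\<forall>j\<in>(L - {i}) \<union> M. x j = y j" for x y
    proof -
      have "g x = g y" using that by (intro gc) auto
      then show ?thesis using that by (intro fc) auto
    qed
    \<comment> \<open>A label j in M can act on f only through the value of g: either j = i, and its
      value is overwritten, or j is not in L. For j outside M the value of g is constant and the
      updates at i and j commute.\<close>
    have 2: "Vector_Spaces.linear sc sc (\<lambda>a. f ((x(j := a))(i := g (x(j := a)))))"
      if j: "j \<in> (L - {i}) \<union> M" for x j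
    proof (cases "j \<in> M")
      case True
      then have "j = i \<or> j \<notin> L" using disj by auto
      then have "f ((x(j := a))(i := g (x(j := a)))) = f (x(i := g (x(j := a))))" for a
        by (intro fc) auto
      moreover have "Vector_Spaces.linear sc sc ((\<lambda>a. f (x(i := a))) \<circ> (\<lambda>a. g (x(j := a))))"
        using fl[OF iL] gl[OF True] Vector_Spaces.linear_compose by blast
      ultimately show ?thesis by (simp add: comp_def)
    next
      case False
      then have "g (x(j := a)) = g x" for a by (intro gc) auto
      moreover have "j \<noteq> i" "j \<in> L" using False j by auto
      ultimately show ?thesis using fl[of j "x(i := g x)"] by (simp add: fun_upd_twist)
    qed
    show "ocomp ?E L i M f g \<in> ospace ?E ((L - {i}) \<union> M)"
      using 1 2 by (simp add: End_operad_def)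
    show "ocomp ?E L i M f (oadd ?E M g g') =
        oadd ?E ((L - {i}) \<union> M) (ocomp ?E L i M f g) (ocomp ?E L i M f g')"
      using fl[OF iL] by (auto simp: End_operad_def Vector_Spaces.linear_iff)
  qed (use assms in \<open>auto simp: End_operad_def algebra_simps Vector_Spaces.linear_iff\<close>)
qed

section \<open>Evaluating trees by operations given on the generators\<close>

fun eval_tree :: "('v \<Rightarrow> 'a list \<Rightarrow> 'a) \<Rightarrow> 'v ltree \<Rightarrow> (nat \<Rightarrow> 'a) \<Rightarrow> 'a" where
  "eval_tree ops (Leaf i) x = x i"
| "eval_tree ops (Node \<omega> ts) x = ops \<omega> (map (\<lambda>t. eval_tree ops t x) ts)"

definition multilinear_ops ::
  "'v sym_basis \<Rightarrow> ('k::field \<Rightarrow> 'a::ab_group_add \<Rightarrow> 'a) \<Rightarrow> ('v \<Rightarrow> 'a list \<Rightarrow> 'a) \<Rightarrow> bool" where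
  "multilinear_ops V sc ops \<longleftrightarrow> (\<forall>\<omega>\<in>basis V. \<forall>xs. length xs = arity V \<omega> \<longrightarrow>
     (\<forall>i<arity V \<omega>. Vector_Spaces.linear sc sc (\<lambda>a. ops \<omega> (xs[i := a]))))"

definition equivariant_ops :: "'v sym_basis \<Rightarrow> ('v \<Rightarrow> 'a list \<Rightarrow> 'a) \<Rightarrow> bool" where
  "equivariant_ops V ops \<longleftrightarrow> (\<forall>\<omega>\<in>basis V. \<forall>\<sigma> xs. \<sigma> permutes {1..arity V \<omega>} \<longrightarrow>
     length xs = arity V \<omega> \<longrightarrow>
     ops (sact V \<sigma> \<omega>) xs = ops \<omega> (map (\<lambda>j. xs ! (\<sigma> j - 1)) [1..<Suc (arity V \<omega>)]))"

lemma eval_tree_cong: "(\<And>i. i \<in> Lin t \<Longrightarrow> x i = y i) \<Longrightarrow> eval_tree ops t x = eval_tree ops t y"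
proof (induction t)
  case (Node \<omega> ts)
  then have "map (\<lambda>t. eval_tree ops t x) ts = map (\<lambda>t. eval_tree ops t y) ts" by auto
  then show ?case by (simp del: map_eq_conv)
qed simp

lemma eval_relabel_tree: "eval_tree ops (relabel_tree h t) x = eval_tree ops t (x \<circ> h)"
  by (induction t) (auto intro!: arg_cong[where f = "ops _"])

lemma eval_subst_tree:
  "eval_tree ops (subst_tree i s t) x = eval_tree ops t (x(i := eval_tree ops s x))"
  by (induction t) (auto intro!: arg_cong[where f = "ops _"])

lemma distinct_leaves_children:
  assumes "distinct (concat (map leaves ts))" "k < length ts" "l < length ts" "k \<noteq> l"
  shows "Lin (ts ! k) \<inter> Lin (ts ! l) = {}"
  using assms unfolding Lin_def
proof (induction ts arbitrary: k l)
  case (Cons t ts)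
  have "set (leaves t) \<inter> set (leaves (ts ! j)) = {}" if "j < length ts" for j
    using Cons.prems(1) that nth_mem by fastforce
  then show ?case using Cons by (auto simp: nth_Cons split: nat.splits)
qed simp

lemma distinct_leaves_child:
  "distinct (concat (map leaves ts)) \<Longrightarrow> t \<in> set ts \<Longrightarrow> distinct (leaves t)"
  by (induction ts) auto

lemma labelled_tree_child:
  "labelled_tree V (Node \<omega> ts) \<Longrightarrow> t \<in> set ts \<Longrightarrow> labelled_tree V t"
  using distinct_leaves_child by (auto simp: labelled_tree_def)

text \<open>Leaf labels are distinct, so i lies below exactly one child k. Only entry k of the
  argument list of the root varies, and the evaluation is a composite of two linear maps.\<close>

lemma eval_tree_linear:
  assumes sc: "vector_space sc" and ops: "multilinear_ops V sc ops"
    and "decorated V t" "distinct (leaves t)" "i \<in> Lin t"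
  shows "Vector_Spaces.linear sc sc (\<lambda>a. eval_tree ops t (x(i := a)))"
  using assms(3-5)
proof (induction t)
  case (Leaf j)
  then show ?case using sc by (simp add: Vector_Spaces.linear_iff)
next
  case (Node \<omega> ts)
  then obtain k where k: "k < length ts" "i \<in> Lin (ts ! k)"
    by (auto simp: in_set_conv_nth)
  have "map (\<lambda>t. eval_tree ops t (x(i := a))) ts =
      (map (\<lambda>t. eval_tree ops t x) ts)[k := eval_tree ops (ts ! k) (x(i := a))]" for a
  proof (rule nth_equalityI)
    fix l assume l: "l < length (map (\<lambda>t. eval_tree ops t (x(i := a))) ts)"
    show "map (\<lambda>t. eval_tree ops t (x(i := a))) ts ! l =
      (map (\<lambda>t. eval_tree ops t x) ts)[k := eval_tree ops (ts ! k) (x(i := a))] ! l"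
    proof (cases "l = k")
      case False
      then have "i \<notin> Lin (ts ! l)"
        using distinct_leaves_children[of ts k l] Node.prems k l by auto
      then have "eval_tree ops (ts ! l) (x(i := a)) = eval_tree ops (ts ! l) x"
        by (intro eval_tree_cong) auto
      then show ?thesis using False l by simp
    qed (use l in simp)
  qed simp
  then have eq: "(\<lambda>a. eval_tree ops (Node \<omega> ts) (x(i := a))) =
    (\<lambda>b. ops \<omega> ((map (\<lambda>t. eval_tree ops t x) ts)[k := b])) \<circ> (\<lambda>a. eval_tree ops (ts ! k) (x(i := a)))"
    by auto
  have "Vector_Spaces.linear sc sc (\<lambda>a. eval_tree ops (ts ! k) (x(i := a)))"
    using Node.prems k distinct_leaves_child[of ts "ts ! k"] by (intro Node.IH) auto
  moreover have "Vector_Spaces.linear sc sc (\<lambda>b. ops \<omega> ((map (\<lambda>t. eval_tree ops t x) ts)[k := b]))"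
    using ops Node.prems k unfolding multilinear_ops_def by auto
  ultimately show ?case unfolding eq by (rule Vector_Spaces.linear_compose)
qed

lemma End_operad_sel:
  "oadd (End_operad sc) = (\<lambda>L f g x. f x + g x)"
  "ozero (End_operad sc) = (\<lambda>L x. 0)"
  "oscale (End_operad sc) = (\<lambda>L c f x. sc c (f x))"
  "orelabel (End_operad sc) = (\<lambda>L h f x. f (x \<circ> h))"
  "ocomp (End_operad sc) = (\<lambda>L i M f g x. f (x(i := g x)))"
  "ounit (End_operad sc) = (\<lambda>i x. x i)"
  by (simp_all add: End_operad_def)

lemma End_ospace_iff:
  "f \<in> ospace (End_operad sc) L \<longleftrightarrow> (\<forall>x y. (\<forall>i\<in>L. x i = y i) \<longrightarrow> f x = f y) \<and>
     (\<forall>i\<in>L. \<forall>x. Vector_Spaces.linear sc sc (\<lambda>a. f (x(i := a))))"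
  by (simp add: End_operad_def)

lemma eval_morphism:
  assumes sc: "vector_space sc" and ops: "multilinear_ops V sc ops"
  shows "operad_morphism (tree_operad V) (End_operad sc)
    (\<lambda>L f x. lin_eval sc (\<lambda>t. eval_tree ops t x) f)"
  unfolding operad_morphism_def
proof (intro conjI allI impI ballI, goal_cases)
  case (1 L f)
  have f: "labelled_tree V t" "Lin t = L" if "t \<in> Poly_Mapping.keys f" for t
    using 1 that by (auto simp: tree_operad_sel tree_space_def)
  have "Vector_Spaces.linear sc sc (\<lambda>a. lin_eval sc (\<lambda>t. eval_tree ops t (x(i := a))) f)"
    if i: "i \<in> L" for i x
  proof -
    have l: "Vector_Spaces.linear sc sc (\<lambda>a. eval_tree ops t (x(i := a)))" if "t \<in> Poly_Mapping.keys f" for t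
      using f[OF that] i by (intro eval_tree_linear[OF sc ops]) (auto simp: labelled_tree_def)
    have "lin_eval sc (\<lambda>t. eval_tree ops t (x(i := a + b))) f =
      lin_eval sc (\<lambda>t. eval_tree ops t (x(i := a)) + eval_tree ops t (x(i := b))) f" for a b
      using l by (intro lin_eval_cong) (simp add: Vector_Spaces.linear_iff)
    moreover have "lin_eval sc (\<lambda>t. eval_tree ops t (x(i := sc c a))) f =
      lin_eval sc (\<lambda>t. sc c (eval_tree ops t (x(i := a)))) f" for c a
      using l by (intro lin_eval_cong) (simp add: Vector_Spaces.linear_iff)
    ultimately show ?thesis using sc
      by (simp add: Vector_Spaces.linear_iff lin_eval_add_fun lin_eval_scale_fun[OF sc])
  qed
  moreover have "lin_eval sc (\<lambda>t. eval_tree ops t x) f = lin_eval sc (\<lambda>t. eval_tree ops t y) f"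
    if "\<forall>i\<in>L. x i = y i" for x y
    using f that by (intro lin_eval_cong eval_tree_cong) auto
  ultimately show ?case by (simp add: End_ospace_iff)
next
  case (5 L i M f g)
  \<comment> \<open>Compatibility with composition rests on linearity of t in the input i: the
    combination of trees substituted at i can be pulled into that argument.\<close>
  have "lin_eval sc (\<lambda>s. eval_tree ops t (x(i := eval_tree ops s x))) g =
      eval_tree ops t (x(i := lin_eval sc (\<lambda>s. eval_tree ops s x) g))"
    if "t \<in> Poly_Mapping.keys f" for t x
  proof -
    have "labelled_tree V t" "Lin t = L" using 5 that by (auto simp: tree_operad_sel tree_space_def)
    then have "Vector_Spaces.linear sc sc (\<lambda>a. eval_tree ops t (x(i := a)))"
      using 5 by (intro eval_tree_linear[OF sc ops]) (auto simp: labelled_tree_def composable_def)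
    from linear_image_lin_eval[OF this, of "\<lambda>s. eval_tree ops s x" g] show ?thesis by simp
  qed
  then show ?case
    by (auto simp: tree_operad_sel End_operad_sel lin_eval_lin_ext lin_eval_single sc eval_subst_tree
        intro!: lin_eval_cong)
qed (use sc in \<open>simp_all add: tree_operad_sel End_operad_sel lin_eval_add lin_eval_scale lin_eval_lin_ext
      lin_eval_single eval_relabel_tree\<close>)

section \<open>Algebras over a presented operad\<close>

text \<open>The two trees of a relator hand the same subtrees to the permuted generator and, in the
  order given by \<sigma>, to the generator itself. Equivariance at the list of values of these
  subtrees makes the two evaluations equal.\<close>

lemma lin_eval_iso_relator:
  assumes sc: "vector_space sc" and eq: "equivariant_ops V ops" and f: "f \<in> tree_iso_relators V L"
  shows "lin_eval sc (\<lambda>t. eval_tree ops t x) f = 0"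
proof -
  obtain \<omega> \<sigma> ts where t: "labelled_tree V (Node \<omega> ts)" "\<sigma> permutes {1..arity V \<omega>}"
    and feq: "f = basis_vec (Node (sact V \<sigma> \<omega>) ts) -
      basis_vec (Node \<omega> (map (\<lambda>j. ts ! (\<sigma> j - 1)) [1..<Suc (arity V \<omega>)]))"
    using f unfolding tree_iso_relators_def by blast
  have len: "length ts = arity V \<omega>" and \<omega>: "\<omega> \<in> basis V" using t by (auto simp: labelled_tree_def)
  have "\<sigma> j - 1 < length ts" if "j \<in> set [1..<Suc (arity V \<omega>)]" for j
    using permutes_in_image[OF t(2), of j] that len by auto
  then have "map (\<lambda>j. map (\<lambda>t. eval_tree ops t x) ts ! (\<sigma> j - 1)) [1..<Suc (arity V \<omega>)] =
    map (\<lambda>j. eval_tree ops (ts ! (\<sigma> j - 1)) x) [1..<Suc (arity V \<omega>)]"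
    by (intro map_cong refl) (simp add: nth_map)
  then have "eval_tree ops (Node (sact V \<sigma> \<omega>) ts) x =
      ops \<omega> (map (\<lambda>j. eval_tree ops (ts ! (\<sigma> j - 1)) x) [1..<Suc (arity V \<omega>)])"
    using eq[unfolded equivariant_ops_def, rule_format, OF \<omega> t(2), of "map (\<lambda>t. eval_tree ops t x) ts"] len
    by (simp only: eval_tree.simps length_map)
  then have "eval_tree ops (Node (sact V \<sigma> \<omega>) ts) x =
      eval_tree ops (Node \<omega> (map (\<lambda>j. ts ! (\<sigma> j - 1)) [1..<Suc (arity V \<omega>)])) x"
    by (simp add: comp_def del: upt_Suc)
  then show ?thesis by (simp only: feq lin_eval_diff[OF sc] lin_eval_single[OF sc] diff_self)
qed

section \<open>Corollas, and the passage between tuples and assignments\<close>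

lemma Lin_corolla: "Lin (corolla V \<omega>) = {1..arity V \<omega>}"
  by (auto simp: corolla_def simp del: upt_Suc)

lemma labelled_corolla:
  assumes "\<omega> \<in> basis V"
  shows "labelled_tree V (corolla V \<omega>)"
proof -
  have "leaves (corolla V \<omega>) = [1..<Suc (arity V \<omega>)]"
    by (simp add: corolla_def comp_def del: upt_Suc)
  then show ?thesis using assms
    by (auto simp: labelled_tree_def Lin_corolla) (auto simp: corolla_def)
qed

lemma eval_corolla: "eval_tree ops (corolla V \<omega>) x = ops \<omega> (map x [1..<Suc (arity V \<omega>)])"
  by (simp add: corolla_def comp_def del: upt_Suc)

text \<open>Recovers a tuple from the assignment that \<open>operad_algebra\<close> reads off from
  it: labels start at 1, list positions at 0.\<close>

lemma map_nth_pred: "length xs = n \<Longrightarrow> map (\<lambda>i. xs ! (i - 1)) [1..<Suc n] = xs"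
  by (intro nth_equalityI) (auto simp del: upt_Suc)

lemma label_set_arity: "S_module_basis V \<Longrightarrow> \<omega> \<in> basis V \<Longrightarrow> label_set {1..arity V \<omega>}"
  by (auto simp: S_module_basis_def label_set_def)

text \<open>Arities are at least 1, so every vertex has a first child, and descending ends at a
  leaf.\<close>

lemma label_set_Lin:
  assumes "S_module_basis V" "labelled_tree V t"
  shows "label_set (Lin t)"
proof -
  have "decorated V t \<Longrightarrow> Lin t \<noteq> {}"
  proof (induction t)
    case (Node \<omega> ts)
    then have "ts \<noteq> []" using assms(1) by (auto simp: S_module_basis_def)
    then have "hd ts \<in> set ts" by simp
    then show ?case using Node by auto
  qed simp
  then show ?thesis using assms(2) by (auto simp: labelled_tree_def label_set_def Lin_def)
qed

lemma End_ospace_cong: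
  "f \<in> ospace (End_operad sc) L \<Longrightarrow> \<forall>i\<in>L. x i = y i \<Longrightarrow> f x = f y"
  by (simp add: End_operad_def)

lemma End_ospace_linear:
  "f \<in> ospace (End_operad sc) L \<Longrightarrow> i \<in> L \<Longrightarrow> Vector_Spaces.linear sc sc (\<lambda>a. f (x(i := a)))"
  by (simp add: End_operad_def)

text \<open>Each hypothesis serves one stage: multilinearity puts evaluation into the endomorphism
  operad, equivariance lets it descend to the free operad, and \<open>rel\<close> lets it descend to
  the presented one.\<close>

lemma operad_algebraI:
  fixes V :: "'v sym_basis" and R :: "('v ltree \<Rightarrow>\<^sub>0 'k::field) set"
  assumes V: "S_module_basis V" and sc: "vector_space sc" and ml: "multilinear_ops V sc ops"
    and eq: "equivariant_ops V ops"
    and rel: "\<And>r x. r \<in> R \<Longrightarrow> lin_eval sc (\<lambda>t. eval_tree ops t x) r = 0"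
  shows "operad_algebra V R sc ops"
proof -
  let ?T = "tree_operad V :: ('k, 'v ltree \<Rightarrow>\<^sub>0 'k) operad" and ?E = "End_operad sc"
  interpret T: additive_operad ?T by (rule additive_tree_operad)
  interpret F: additive_operad "free_operad V :: ('k, ('v ltree \<Rightarrow>\<^sub>0 'k) set) operad"
    unfolding free_operad_def free_ideal_def by (rule T.additive_quotient)
  note E = additive_End_operad[OF sc]
  obtain \<phi> where \<phi>: "operad_morphism (free_operad V) ?E \<phi>"
    and \<phi>_eq: "\<And>L (f :: 'v ltree \<Rightarrow>\<^sub>0 'k). label_set L \<Longrightarrow> f \<in> tree_space V L \<Longrightarrow>
      \<phi> L (free_class V L f) = (\<lambda>x. lin_eval sc (\<lambda>t. eval_tree ops t x) f)"
  proof (rule T.quotient_lift[OF E eval_morphism[OF sc ml], of "tree_iso_relators V"])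
    fix L and f :: "'v ltree \<Rightarrow>\<^sub>0 'k" assume "f \<in> tree_iso_relators V L"
    then show "(\<lambda>x. lin_eval sc (\<lambda>t. eval_tree ops t x) f) = ozero ?E L"
      using lin_eval_iso_relator[OF sc eq] by (simp add: End_operad_sel)
  qed (simp add: that free_operad_def free_ideal_def free_class_def tree_operad_sel)
  obtain \<psi> where \<psi>: "operad_morphism (presented_operad V R) ?E \<psi>"
    and \<psi>_eq: "\<And>L X. label_set L \<Longrightarrow> X \<in> ospace (free_operad V) L \<Longrightarrow>
      \<psi> L (ocoset (free_operad V) (relation_ideal V R) L X) = \<phi> L X"
  proof (rule F.quotient_lift[OF E \<phi>, of "\<lambda>L. free_class V L ` (R \<inter> tree_space V L)"])
    fix L X assume "label_set L" "X \<in> free_class V L ` (R \<inter> tree_space V L)"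
    then show "\<phi> L X = ozero ?E L"
      using \<phi>_eq rel by (auto simp: End_operad_sel)
  qed (simp add: that presented_operad_def relation_ideal_def)
  have "\<psi> {1..arity V \<omega>} (generator V R \<omega>) (\<lambda>i. xs ! (i - 1)) = ops \<omega> xs"
    if \<omega>: "\<omega> \<in> basis V" and xs: "length xs = arity V \<omega>" for \<omega> xs
  proof -
    note L = label_set_arity[OF V \<omega>]
    have c: "basis_vec (corolla V \<omega>) \<in> tree_space V {1..arity V \<omega>}"
      using \<omega> by (simp add: tree_space_basis Lin_corolla labelled_corolla)
    then have "free_class V {1..arity V \<omega>} (basis_vec (corolla V \<omega>)) \<in>
        ospace (free_operad V :: ('k, ('v ltree \<Rightarrow>\<^sub>0 'k) set) operad) {1..arity V \<omega>}"
      unfolding free_operad_def T.quotient_ospace free_class_def tree_operad_sel by (rule imageI)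
    from \<psi>_eq[OF L this] have "\<psi> {1..arity V \<omega>} (generator V R \<omega>) (\<lambda>i. xs ! (i - 1)) =
        eval_tree ops (corolla V \<omega>) (\<lambda>i. xs ! (i - 1))"
      by (simp only: generator_def \<phi>_eq[OF L c] lin_eval_single[OF sc])
    then show ?thesis using map_nth_pred[OF xs] by (simp only: eval_corolla)
  qed
  then show ?thesis unfolding operad_algebra_def using sc \<psi> by blast
qed

lemma subst_tree_notin: "i \<notin> Lin t \<Longrightarrow> subst_tree i s t = t"
proof (induction t)
  case (Node \<omega> ts)
  then show ?case by (auto intro!: map_idI)
qed simp

text \<open>
  A tree is built from the corolla of its root, relabelled so that its leaves are fresh, by
  substituting the subtrees one after the other.
\<close>

lemma morphism_eq_eval_tree:
  fixes V :: "'v sym_basis" and sc :: "'k::field \<Rightarrow> 'a::ab_group_add \<Rightarrow> 'a"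
  assumes V: "S_module_basis V" and \<psi>: "operad_morphism (tree_operad V) (End_operad sc) \<psi>"
    and gen: "\<And>\<omega> xs. \<omega> \<in> basis V \<Longrightarrow> length xs = arity V \<omega> \<Longrightarrow>
      \<psi> {1..arity V \<omega>} (basis_vec (corolla V \<omega>)) (\<lambda>i. xs ! (i - 1)) = ops \<omega> xs"
    and "labelled_tree V t"
  shows "\<psi> (Lin t) (basis_vec t) = eval_tree ops t"
  using assms(4)
proof (induction t)
  case (Leaf i)
  then show ?case using morphism_unit[OF \<psi>, of i]
    by (auto simp: tree_operad_sel End_operad_sel labelled_tree_def fun_eq_iff)
next
  case (Node \<omega> ts)
  let ?n = "arity V \<omega>"
  have \<omega>: "\<omega> \<in> basis V" and n: "length ts = ?n" and dist: "distinct (concat (map leaves ts))"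
    using Node.prems by (auto simp: labelled_tree_def)
  have child: "labelled_tree V (ts ! k)" if "k < ?n" for k
    using labelled_tree_child[OF Node.prems] that n by simp
  have "finite (Lin (Node \<omega> ts))" by (simp add: Lin_def)
  \<comment> \<open>Labels above this bound are free for temporary leaves.\<close>
  then obtain N where N: "j \<le> N" if "j \<in> Lin (Node \<omega> ts)" for j
    unfolding finite_nat_set_iff_bounded_le by blast
  have N': "j \<le> N" if "j \<in> Lin (ts ! k)" "k < ?n" for j k
    using that N[of j] n nth_mem[of k ts] by fastforce
  \<comment> \<open>Stage k: the first k inputs carry their subtrees, the others are leaves with the
    temporary labels N + k + 1, ..., N + n.\<close>
  define P where "P k = Node \<omega> (take k ts @ map Leaf [N + k + 1..<N + ?n + 1])" for k
  have "labelled_tree V (P k) \<and> \<psi> (Lin (P k)) (basis_vec (P k)) = eval_tree ops (P k)"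
    if "k \<le> ?n" for k
    using that
  proof (induction k)
    case 0
    let ?h = "\<lambda>i. N + i"
    have P0: "P 0 = relabel_tree ?h (corolla V \<omega>)"
      unfolding P_def corolla_def by (auto intro!: nth_equalityI simp del: upt_Suc)
    have h: "relabelling {1..?n} ?h"
      using label_set_arity[OF V \<omega>] by (auto simp: relabelling_def)
    have c: "basis_vec (corolla V \<omega>) \<in> ospace (tree_operad V) {1..?n}"
      using \<omega> by (simp add: tree_operad_sel tree_space_basis Lin_corolla labelled_corolla)
    have "\<psi> {1..?n} (basis_vec (corolla V \<omega>)) x = eval_tree ops (corolla V \<omega>) x" for x
    proof -
      \<comment> \<open>\<open>gen\<close> covers only assignments read off from a list. The image
        of the corolla depends only on the labels 1, ..., n, so x may be replaced by the list of its
        values there.\<close>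
      let ?xs = "map x [1..<Suc ?n]"
      have "\<forall>i\<in>{1..?n}. x i = ?xs ! (i - 1)" by (auto simp del: upt_Suc)
      then have "\<psi> {1..?n} (basis_vec (corolla V \<omega>)) x =
          \<psi> {1..?n} (basis_vec (corolla V \<omega>)) (\<lambda>i. ?xs ! (i - 1))"
        by (rule End_ospace_cong[OF morphism_closed[OF \<psi> label_set_arity[OF V \<omega>] c]])
      also have "\<dots> = ops \<omega> ?xs" using \<omega> by (intro gen) simp_all
      finally show ?thesis by (simp add: eval_corolla)
    qed
    then have "\<psi> (?h ` {1..?n}) (basis_vec (P 0)) = eval_tree ops (P 0)"
      using morphism_relabel[OF \<psi> h c]
      by (simp add: tree_operad_sel End_operad_sel lin_ext_basis P0 eval_relabel_tree fun_eq_iff)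
    moreover have "Lin (P 0) = ?h ` {1..?n}" "labelled_tree V (P 0)"
      unfolding P0 using labelled_relabel_tree[OF labelled_corolla[OF \<omega>]] h by (simp_all add: Lin_corolla)
    ultimately show ?case by simp
  next
    case (Suc k)
    then have k: "k < ?n" and lab: "labelled_tree V (P k)"
      and ev: "\<psi> (Lin (P k)) (basis_vec (P k)) = eval_tree ops (P k)" by auto
    let ?i = "N + k + 1"
    have LinP: "Lin (P k) = (\<Union>l<k. Lin (ts ! l)) \<union> {?i..<N + ?n + 1}"
      unfolding P_def using k n by (auto simp: nth_image[symmetric] simp del: upt_Suc)
    \<comment> \<open>Composability: the next subtree is disjoint from the earlier ones because the
      leaves of the whole tree are distinct, and from the temporary labels because these exceed
      N.\<close>
    have "Lin (ts ! k) \<inter> Lin (ts ! l) = {}" if "l < k" for l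
      using distinct_leaves_children[OF dist, of k l] that k n by auto
    moreover have "Lin (ts ! k) \<inter> {?i..<N + ?n + 1} = {}"
      using N' k by fastforce
    ultimately have comp: "composable (Lin (P k)) ?i (Lin (ts ! k))"
      using label_set_Lin[OF V lab] label_set_Lin[OF V child[OF k]] k
      unfolding composable_def by (auto simp: LinP)
    have "map (subst_tree ?i (ts ! k)) (take k ts) = take k ts"
    proof (intro map_idI subst_tree_notin)
      fix t assume "t \<in> set (take k ts)"
      then obtain l where "l < k" "t = ts ! l" using k n by (auto simp: in_set_conv_nth)
      then show "?i \<notin> Lin t" using N'[of ?i l] k by auto
    qed
    moreover have "map (subst_tree ?i (ts ! k)) (map Leaf [?i..<N + ?n + 1]) =
        ts ! k # map Leaf [Suc ?i..<N + ?n + 1]"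
      using k by (simp add: upt_conv_Cons del: upt_Suc)
    ultimately have P: "P (Suc k) = subst_tree ?i (ts ! k) (P k)"
      unfolding P_def using k n by (simp add: take_Suc_conv_app_nth del: upt_Suc)
    note lin = labelled_subst_tree[OF lab child[OF k] comp]
    have "\<psi> ((Lin (P k) - {?i}) \<union> Lin (ts ! k)) (basis_vec (P (Suc k))) =
        (\<lambda>x. eval_tree ops (P k) (x(?i := eval_tree ops (ts ! k) x)))"
      using morphism_comp[OF \<psi> comp, of "basis_vec (P k)" "basis_vec (ts ! k)"] lab child[OF k] ev
        Node.IH[OF _ child[OF k]] k n
      by (simp add: tree_operad_sel End_operad_sel tree_space_basis lin_ext_basis P)
    then show ?case using lin by (simp add: P eval_subst_tree fun_eq_iff)
  qed
  moreover have "P ?n = Node \<omega> ts" by (simp add: P_def n[symmetric])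
  ultimately show ?case by force
qed

text \<open>A morphism is additive only for two elements of the space, so one tree is split off at a
  time. Keeping S inside the support of f keeps every summand in
  \<open>tree_space V L\<close>.\<close>

lemma morphism_lin_eval:
  fixes V :: "'v sym_basis" and sc :: "'k::field \<Rightarrow> 'a::ab_group_add \<Rightarrow> 'a"
  assumes sc: "vector_space sc" and \<psi>: "operad_morphism (tree_operad V) (End_operad sc) \<psi>"
    and L: "label_set L" and f: "f \<in> tree_space V L"
  shows "\<psi> L f x = lin_eval sc (\<lambda>t. \<psi> L (basis_vec t) x) f"
proof -
  have zero: "\<psi> L 0 = (\<lambda>x. 0)"
    using additive_operad.morphism_zero[OF additive_tree_operad additive_End_operad[OF sc] \<psi> L]
    by (simp add: tree_operad_sel End_operad_sel)
  let ?g = "\<lambda>t. scale_pm (Poly_Mapping.lookup f t) (basis_vec t)"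
  have "\<psi> L (\<Sum>t\<in>S. ?g t) x = (\<Sum>t\<in>S. sc (Poly_Mapping.lookup f t) (\<psi> L (basis_vec t) x))"
    if "S \<subseteq> Poly_Mapping.keys f" for S
    using finite_subset[OF that finite_keys] that
  proof (induction S rule: finite_induct)
    case (insert t S)
    then have b: "basis_vec t \<in> tree_space V L" using f by (auto simp: tree_space_def)
    then have g: "?g t \<in> tree_space V L" by (rule tree_space_scale)
    have "(\<Sum>t\<in>S. ?g t) \<in> tree_space V L"
      using insert.prems f by (intro tree_space_sum tree_space_scale) (auto simp: tree_space_def)
    then have "\<psi> L (?g t + (\<Sum>t\<in>S. ?g t)) = (\<lambda>x. \<psi> L (?g t) x + \<psi> L (\<Sum>t\<in>S. ?g t) x)"
      using morphism_add[OF \<psi> L] g by (simp add: tree_operad_sel End_operad_sel)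
    moreover have "\<psi> L (?g t) = (\<lambda>x. sc (Poly_Mapping.lookup f t) (\<psi> L (basis_vec t) x))"
      using morphism_scale[OF \<psi> L] b by (simp add: tree_operad_sel End_operad_sel)
    ultimately show ?case using insert by simp
  qed (simp add: zero)
  from this[of "Poly_Mapping.keys f"] show ?thesis
    using lin_ext_basis_vec[of f] by (simp add: lin_ext_def lin_eval_def)
qed

text \<open>Composing the morphism with both projections gives a morphism on
  \<open>tree_operad\<close>, which is evaluation of trees. Its value on corollas gives
  multilinearity; elements that vanish in the first and second quotient give equivariance and the
  relations. Homogeneity of r is asked for since the ideal is generated by the relations lying in a
  single \<open>tree_space V L\<close>.\<close>

lemma operad_algebraD:
  fixes V :: "'v sym_basis" and R :: "('v ltree \<Rightarrow>\<^sub>0 'k::field) set"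
    and sc :: "'k \<Rightarrow> 'a::ab_group_add \<Rightarrow> 'a"
  assumes V: "S_module_basis V" and alg: "operad_algebra V R sc ops"
  shows operad_algebra_vector_space: "vector_space sc"
    and operad_algebra_multilinear: "multilinear_ops V sc ops"
    and operad_algebra_equivariant: "equivariant_ops V ops"
    and operad_algebra_relation: "\<And>r x. \<lbrakk>r \<in> R; locally_homogeneous V r\<rbrakk> \<Longrightarrow>
      lin_eval sc (\<lambda>t. eval_tree ops t x) r = 0"
proof -
  let ?T = "tree_operad V :: ('k, 'v ltree \<Rightarrow>\<^sub>0 'k) operad" and ?E = "End_operad sc"
  let ?F = "free_operad V :: ('k, ('v ltree \<Rightarrow>\<^sub>0 'k) set) operad"
  interpret T: additive_operad ?T by (rule additive_tree_operad)
  interpret F: additive_operad ?F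
    unfolding free_operad_def free_ideal_def by (rule T.additive_quotient)
  interpret P: additive_operad "presented_operad V R"
    unfolding presented_operad_def relation_ideal_def by (rule F.additive_quotient)
  show sc: "vector_space sc" using alg by (simp add: operad_algebra_def)
  note E = additive_End_operad[OF sc]
  obtain \<phi> where \<phi>: "operad_morphism (presented_operad V R) ?E \<phi>"
    and gen: "\<And>\<omega> xs. \<omega> \<in> basis V \<Longrightarrow> length xs = arity V \<omega> \<Longrightarrow>
      \<phi> {1..arity V \<omega>} (generator V R \<omega>) (\<lambda>i. xs ! (i - 1)) = ops \<omega> xs"
    using alg unfolding operad_algebra_def by blast
  let ?p = "\<lambda>L. ocoset ?F (relation_ideal V R) L"
  have p: "operad_morphism ?F (presented_operad V R) ?p"
    unfolding presented_operad_def relation_ideal_def by (rule F.operad_morphism_coset)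
  have q: "operad_morphism ?T ?F (free_class V)"
    unfolding free_operad_def free_ideal_def free_class_def by (rule T.operad_morphism_coset)
  note \<phi>p = operad_morphism_comp[OF p \<phi>]
  define \<psi> where "\<psi> L f = \<phi> L (?p L (free_class V L f))" for L f
  have \<psi>: "operad_morphism ?T ?E \<psi>"
    unfolding \<psi>_def by (rule operad_morphism_comp[OF q \<phi>p])
  have gen': "\<psi> {1..arity V \<omega>} (basis_vec (corolla V \<omega>)) (\<lambda>i. xs ! (i - 1)) = ops \<omega> xs"
    if "\<omega> \<in> basis V" "length xs = arity V \<omega>" for \<omega> xs
    using gen[OF that] unfolding \<psi>_def generator_def .
  note tree = morphism_eq_eval_tree[OF V \<psi> gen']
  have ev: "\<psi> L f x = lin_eval sc (\<lambda>t. eval_tree ops t x) f" if "label_set L" "f \<in> tree_space V L" for L f x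
    unfolding morphism_lin_eval[OF sc \<psi> that]
    using that tree by (intro lin_eval_cong) (auto simp: tree_space_def)
  have c: "basis_vec (corolla V \<omega>) \<in> ospace ?T {1..arity V \<omega>}" if "\<omega> \<in> basis V" for \<omega>
    using that by (simp add: tree_operad_sel tree_space_basis Lin_corolla labelled_corolla)
  show "multilinear_ops V sc ops"
    unfolding multilinear_ops_def
  proof (intro ballI allI impI)
    fix \<omega> and xs :: "'a list" and i assume \<omega>: "\<omega> \<in> basis V" and xs: "length xs = arity V \<omega>" and i: "i < arity V \<omega>"
    let ?c = "\<psi> {1..arity V \<omega>} (basis_vec (corolla V \<omega>))"
    have c: "?c \<in> ospace ?E {1..arity V \<omega>}"
      by (rule morphism_closed[OF \<psi> label_set_arity[OF V \<omega>] c[OF \<omega>]])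
    \<comment> \<open>Entry i of the list is the value at the label i + 1.\<close>
    have "?c ((\<lambda>j. xs ! (j - 1))(Suc i := a)) = ops \<omega> (xs[i := a])" for a
    proof -
      have "\<forall>j\<in>{1..arity V \<omega>}. ((\<lambda>j. xs ! (j - 1))(Suc i := a)) j = xs[i := a] ! (j - 1)"
        using xs by (auto simp: nth_list_update)
      then have "?c ((\<lambda>j. xs ! (j - 1))(Suc i := a)) = ?c (\<lambda>j. xs[i := a] ! (j - 1))"
        by (rule End_ospace_cong[OF c])
      then show ?thesis using gen'[OF \<omega>, of "xs[i := a]"] xs by simp
    qed
    moreover have "Suc i \<in> {1..arity V \<omega>}" using i by simp
    ultimately show "Vector_Spaces.linear sc sc (\<lambda>a. ops \<omega> (xs[i := a]))"
      using End_ospace_linear[OF c, of "Suc i" "\<lambda>j. xs ! (j - 1)"] by simp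
  qed
  have relator: "lin_eval sc (\<lambda>t. eval_tree ops t x) f = 0"
    if L: "label_set L" and f: "f \<in> tree_iso_relators V L" "f \<in> tree_space V L" for L f x
  proof -
    have "free_class V L f = ozero ?F L"
      unfolding free_operad_def free_ideal_def free_class_def
      using L f by (intro T.coset_ideal operad_ideal.gen) (simp_all add: tree_operad_sel)
    then have "\<psi> L f = ozero ?E L"
      unfolding \<psi>_def by (simp add: F.morphism_zero[OF E \<phi>p L])
    then show ?thesis using ev[OF L f(2), of x] by (simp add: End_operad_sel)
  qed
  show "equivariant_ops V ops"
    unfolding equivariant_ops_def
  proof (intro ballI allI impI)
    fix \<omega> \<sigma> and xs :: "'a list"
    assume \<omega>: "\<omega> \<in> basis V" and \<sigma>: "\<sigma> permutes {1..arity V \<omega>}" and xs: "length xs = arity V \<omega>"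
    let ?n = "arity V \<omega>" and ?x = "\<lambda>i. xs ! (i - 1)"
    let ?ts = "map Leaf [1..<Suc ?n] :: 'v ltree list"
    \<comment> \<open>The relator of a corolla already contains equivariance: \<open>?t1\<close> is
      the corolla of the permuted generator, \<open>?t2\<close> the corolla of \<omega> with its
      leaves relabelled by \<sigma>.\<close>
    let ?t1 = "Node (sact V \<sigma> \<omega>) ?ts" and ?t2 = "Node \<omega> (map (\<lambda>j. ?ts ! (\<sigma> j - 1)) [1..<Suc ?n])"
    have s: "sact V \<sigma> \<omega> \<in> basis V" "arity V (sact V \<sigma> \<omega>) = ?n"
      using V \<omega> \<sigma> by (auto simp: S_module_basis_def)
    have range: "\<sigma> j \<in> {1..?n}" if "j \<in> {1..?n}" for j using permutes_in_image[OF \<sigma>] that by blast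
    have sub: "map (\<lambda>j. ?ts ! (\<sigma> j - 1)) [1..<Suc ?n] = map (\<lambda>j. Leaf (\<sigma> j)) [1..<Suc ?n]"
      using range by (intro map_cong refl) (fastforce simp del: upt_Suc)
    have t1: "?t1 = corolla V (sact V \<sigma> \<omega>)" by (simp add: corolla_def s)
    have t2: "?t2 = relabel_tree \<sigma> (corolla V \<omega>)"
      unfolding sub by (simp add: corolla_def comp_def del: upt_Suc)
    have "relabelling {1..?n} \<sigma>"
      using label_set_arity[OF V \<omega>] permutes_inj_on[OF \<sigma>] permutes_image[OF \<sigma>]
      by (auto simp: relabelling_def label_set_def)
    then have l2: "labelled_tree V ?t2" "Lin ?t2 = {1..?n}"
      using labelled_relabel_tree[OF labelled_corolla[OF \<omega>], of \<sigma>] permutes_image[OF \<sigma>]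
      unfolding t2 by (simp_all add: Lin_corolla)
    have l1: "labelled_tree V ?t1" "Lin ?t1 = {1..?n}"
      unfolding t1 using s labelled_corolla[of "sact V \<sigma> \<omega>" V] by (simp_all add: Lin_corolla)
    have "basis_vec ?t1 - basis_vec ?t2 \<in> tree_iso_relators V {1..?n}"
      unfolding tree_iso_relators_def
      using \<sigma> labelled_corolla[OF \<omega>] Lin_corolla[of V \<omega>] unfolding corolla_def by blast
    moreover have "basis_vec ?t1 - basis_vec ?t2 \<in> tree_space V {1..?n}"
      using l1 l2 by (intro tree_space_diff) (simp_all only: tree_space_basis simp_thms)
    ultimately have "lin_eval sc (\<lambda>t. eval_tree ops t ?x) (basis_vec ?t1 - basis_vec ?t2) = 0"
      by (rule relator[OF label_set_arity[OF V \<omega>]])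
    then have "eval_tree ops ?t1 ?x = eval_tree ops ?t2 ?x"
      by (simp only: lin_eval_diff[OF sc] lin_eval_single[OF sc] right_minus_eq)
    then show "ops (sact V \<sigma> \<omega>) xs = ops \<omega> (map (\<lambda>j. xs ! (\<sigma> j - 1)) [1..<Suc ?n])"
      unfolding t1 t2 eval_relabel_tree eval_corolla s map_nth_pred[OF xs] by (simp add: comp_def)
  qed
  fix r x assume r: "r \<in> R" "locally_homogeneous V r"
  then obtain L where L: "label_set L" "r \<in> tree_space V L" unfolding locally_homogeneous_def by blast
  have "?p L (free_class V L r) = ozero (presented_operad V R) L"
    unfolding presented_operad_def relation_ideal_def
    using L r morphism_closed[OF q]
    by (intro F.coset_ideal operad_ideal.gen) (auto simp: tree_operad_sel)
  then have "\<psi> L r = ozero ?E L"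
    unfolding \<psi>_def by (simp add: P.morphism_zero[OF E \<phi> L(1)])
  then show "lin_eval sc (\<lambda>t. eval_tree ops t x) r = 0"
    using ev[OF L] by (simp add: End_operad_sel)
qed

section \<open>Splitting of trees\<close>

lemma family_finite: "\<lbrakk>C = A_family \<or> C = B_family; finite S\<rbrakk> \<Longrightarrow> finite (C S)"
  by (auto simp: A_family_def B_family_def Setcompr_eq_image)

lemma family_subset: "\<lbrakk>C = A_family \<or> C = B_family; J \<in> C S\<rbrakk> \<Longrightarrow> J \<subseteq> S"
  by (auto simp: A_family_def B_family_def)

lemma family_nonempty: "\<lbrakk>C = A_family \<or> C = B_family; J \<in> C S\<rbrakk> \<Longrightarrow> J \<noteq> {}"
  by (auto simp: A_family_def B_family_def)

lemma family_singleton: "C = A_family \<or> C = B_family \<Longrightarrow> C {i} = {{i}}"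
  by (auto simp: A_family_def B_family_def)

lemma family_image:
  assumes "C = A_family \<or> C = B_family"
  shows "C (h ` S) = (`) h ` C S"
  using assms
proof
  assume "C = A_family"
  then show ?thesis by (auto simp: A_family_def Setcompr_eq_image image_image)
next
  assume "C = B_family"
  then show ?thesis by (auto simp: B_family_def elim!: subset_imageE)
qed

lemma family_permutes:
  assumes "C = A_family \<or> C = B_family" "\<sigma> permutes S"
  shows "bij_betw ((`) \<sigma>) (C S) (C S)"
proof -
  have "inj ((`) \<sigma>)" using permutes_inj[OF assms(2)] by (simp add: inj_image_eq_iff inj_def)
  then show ?thesis
    using family_image[OF assms(1), of \<sigma> S] permutes_image[OF assms(2)]
    by (simp add: bij_betw_def inj_on_subset[OF _ subset_UNIV])
qed

text \<open>For singletons: J lies in the only block that it meets and is a singleton there. For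
  nonempty sets: a nonempty trace is automatically a member, and some block is met as soon as J is
  nonempty. This makes the family compatible with the recursion over the children of a
  vertex.\<close>

lemma family_union:
  assumes C: "C = A_family \<or> C = B_family"
    and disj: "\<And>i j. \<lbrakk>i \<in> K; j \<in> K; i \<noteq> j\<rbrakk> \<Longrightarrow> L i \<inter> L j = {}"
  shows "J \<in> C (\<Union>i\<in>K. L i) \<longleftrightarrow> J \<subseteq> (\<Union>i\<in>K. L i) \<and> {i \<in> K. J \<inter> L i \<noteq> {}} \<in> C K \<and>
    (\<forall>i\<in>K. J \<inter> L i \<noteq> {} \<longrightarrow> J \<inter> L i \<in> C (L i))" (is "?l \<longleftrightarrow> ?r")
  using C
proof
  assume A: "C = A_family"
  show ?thesis
  proof
    assume ?l
    then obtain i j where i: "i \<in> K" "j \<in> L i" "J = {j}" using A by (auto simp: A_family_def)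
    then have "i' = i" if "i' \<in> K" "j \<in> L i'" for i' using disj that by blast
    then have "{i \<in> K. J \<inter> L i \<noteq> {}} = {i}" using i by blast
    then show ?r using i A by (auto simp: A_family_def)
  next
    assume r: ?r
    then obtain i where i: "i \<in> K" "{i \<in> K. J \<inter> L i \<noteq> {}} = {i}" using A by (auto simp: A_family_def)
    then have "J \<inter> L i \<in> C (L i)" using r by blast
    then obtain j where "J \<inter> L i = {j}" using A by (auto simp: A_family_def)
    \<comment> \<open>Every element of J lies in some block, and i is the only block that J
      meets.\<close>
    moreover have "J \<subseteq> L i"
    proof
      fix k assume "k \<in> J"
      moreover from this obtain i' where "i' \<in> K" "k \<in> L i'" using r by blast
      ultimately have "i' \<in> {i \<in> K. J \<inter> L i \<noteq> {}}" by blast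
      then show "k \<in> L i" using \<open>k \<in> L i'\<close> unfolding i by simp
    qed
    ultimately have "J = {j}" "j \<in> L i" by auto
    then show ?l using A i by (auto simp: A_family_def)
  qed
next
  assume B: "C = B_family"
  have "\<exists>i\<in>K. J \<inter> L i \<noteq> {}" if "J \<noteq> {}" "J \<subseteq> (\<Union>i\<in>K. L i)" using that by blast
  then show ?thesis using B by (auto simp: B_family_def)
qed

lemma S_module_basis_Sp:
  assumes C: "C = A_family \<or> C = B_family" and V: "S_module_basis V"
  shows "S_module_basis (Sp_basis C V)"
proof -
  have "\<sigma> ` I \<in> C {1..n}" if "I \<in> C {1..n}" "\<sigma> permutes {1..n}" for \<sigma> I and n :: nat
    using family_permutes[OF C that(2)] that(1) by (auto simp: bij_betw_def)
  then show ?thesis using V by (auto simp: S_module_basis_def Sp_basis_def image_comp)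
qed

lemma Sp_basis_sel:
  "basis (Sp_basis C V) = {(\<omega>, I). \<omega> \<in> basis V \<and> I \<in> C {1..arity V \<omega>}}"
  "arity (Sp_basis C V) (\<omega>, I) = arity V \<omega>"
  "sact (Sp_basis C V) \<sigma> (\<omega>, I) = (sact V \<sigma> \<omega>, \<sigma> ` I)"
  by (simp_all add: Sp_basis_def)

section \<open>Supports and evaluation of grafted combinations\<close>

lemma keys_sum_subset:
  "Poly_Mapping.keys (\<Sum>j\<in>S. f j) \<subseteq> (\<Union>j\<in>S. Poly_Mapping.keys (f j))"
proof (induction S rule: infinite_finite_induct)
  case (insert j S)
  then show ?case using keys_add[of "f j" "\<Sum>j\<in>S. f j"] by auto
qed auto

lemma keys_lin_ext: "Poly_Mapping.keys (lin_ext F f) \<subseteq> (\<Union>b\<in>Poly_Mapping.keys f. Poly_Mapping.keys (F b))"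
  unfolding lin_ext_def using keys_sum_subset keys_scale_pm by fastforce

lemma keys_lin_list:
  "ts \<in> Poly_Mapping.keys (lin_list fs) \<Longrightarrow> list_all2 (\<lambda>t f. t \<in> Poly_Mapping.keys f) ts fs"
proof (induction fs arbitrary: ts)
  case (Cons f fs)
  then obtain t where t: "t \<in> Poly_Mapping.keys f"
    "ts \<in> Poly_Mapping.keys (lin_ext (\<lambda>ts. basis_vec (t # ts)) (lin_list fs))"
    using keys_lin_ext by fastforce
  then obtain ts' where "ts' \<in> Poly_Mapping.keys (lin_list fs)" "ts = t # ts'"
    using keys_lin_ext by fastforce
  then show ?case using Cons.IH t by simp
qed simp

lemma keys_graft:
  assumes "s \<in> Poly_Mapping.keys (graft w fs)"
  obtains \<omega> ts where "s = Node \<omega> ts" "\<omega> \<in> Poly_Mapping.keys w"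
    "list_all2 (\<lambda>t f. t \<in> Poly_Mapping.keys f) ts fs"
proof -
  obtain \<omega> where \<omega>: "\<omega> \<in> Poly_Mapping.keys w"
    "s \<in> Poly_Mapping.keys (lin_ext (\<lambda>ts. basis_vec (Node \<omega> ts)) (lin_list fs))"
    using assms keys_lin_ext unfolding graft_def by fastforce
  then obtain ts where "ts \<in> Poly_Mapping.keys (lin_list fs)" "s = Node \<omega> ts"
    using keys_lin_ext by fastforce
  then show ?thesis using that \<omega> keys_lin_list by blast
qed

lemma keys_Sp_star: "Poly_Mapping.keys (Sp_star C V \<omega>) \<subseteq> {(\<omega>, I) |I. I \<in> C {1..arity V \<omega>}}"
  unfolding Sp_star_def using keys_sum_subset by fastforce

text \<open>\<open>pre\<close> holds the values of the trees already picked. The induction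
  hypothesis evaluates everything to the right of the current entry; linearity in that entry then
  pulls its combination inside.\<close>

lemma lin_eval_lin_list:
  assumes sc: "vector_space sc"
    and ml: "\<And>xs i. \<lbrakk>length xs = length pre + length fs; i < length xs\<rbrakk> \<Longrightarrow>
      Vector_Spaces.linear sc sc (\<lambda>a. g (xs[i := a]))"
  shows "lin_eval sc (\<lambda>ts. g (pre @ map F ts)) (lin_list fs) = g (pre @ map (lin_eval sc F) fs)"
  using ml
proof (induction fs arbitrary: pre)
  case Nil
  then show ?case by (simp add: lin_eval_single[OF sc])
next
  case (Cons f fs)
  have IH: "lin_eval sc (\<lambda>ts. g ((pre @ [F t]) @ map F ts)) (lin_list fs) =
      g ((pre @ [F t]) @ map (lin_eval sc F) fs)" for t
    using Cons.prems by (intro Cons.IH) auto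
  \<comment> \<open>The 0 is a placeholder at position \<open>length pre\<close>, overwritten by the
    update.\<close>
  have "Vector_Spaces.linear sc sc (\<lambda>a. g ((pre @ 0 # map (lin_eval sc F) fs)[length pre := a]))"
    by (rule Cons.prems) simp_all
  then have lin: "Vector_Spaces.linear sc sc (\<lambda>a. g (pre @ a # map (lin_eval sc F) fs))" by simp
  show ?case
    using IH linear_image_lin_eval[OF lin, of F f]
    by (simp add: lin_eval_lin_ext lin_eval_single sc)
qed

lemma lin_eval_graft:
  assumes sc: "vector_space sc" and ml: "multilinear_ops W sc ops"
    and w: "\<And>\<omega>. \<omega> \<in> Poly_Mapping.keys w \<Longrightarrow> \<omega> \<in> basis W \<and> arity W \<omega> = length fs"
  shows "lin_eval sc (\<lambda>t. eval_tree ops t x) (graft w fs) =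
    lin_eval sc (\<lambda>\<omega>. ops \<omega> (map (lin_eval sc (\<lambda>t. eval_tree ops t x)) fs)) w"
proof -
  have "lin_eval sc (\<lambda>ts. ops \<omega> (map (\<lambda>t. eval_tree ops t x) ts)) (lin_list fs) =
      ops \<omega> (map (lin_eval sc (\<lambda>t. eval_tree ops t x)) fs)" if "\<omega> \<in> Poly_Mapping.keys w" for \<omega>
    using lin_eval_lin_list[OF sc, of "[]" fs "ops \<omega>" "\<lambda>t. eval_tree ops t x"] ml w[OF that]
    by (simp add: multilinear_ops_def)
  then show ?thesis
    unfolding graft_def by (simp add: lin_eval_lin_ext lin_eval_single sc cong: lin_eval_cong)
qed

text \<open>
  The two kinds of splitting that occur in the recursion: \<open>J = {}\<close>, where every vertex becomes
  starred, and \<open>J \<in> C (Lin t)\<close>.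
\<close>

definition splittable :: "(nat set \<Rightarrow> nat set set) \<Rightarrow> nat set \<Rightarrow> 'v ltree \<Rightarrow> bool" where
  "splittable C J t \<longleftrightarrow> J = {} \<or> J \<in> C (Lin t)"

section \<open>The recursion of the splitting through the children of a vertex\<close>

lemma Lin_children: "(\<Union>i\<in>{1..length ts}. Lin (ts ! (i - 1))) = Lin (Node \<omega> ts)"
proof -
  have "(\<lambda>i. i - 1) ` {1..length ts} = {..<length ts}"
    by (auto simp: image_iff intro!: bexI[of _ "Suc _"])
  then have "(\<Union>i\<in>{1..length ts}. Lin (ts ! (i - 1))) = (\<Union>i<length ts. Lin (ts ! i))"
    by (metis (no_types, lifting) SUP_cong image_image)
  then show ?thesis by (force simp: set_conv_nth)
qed

lemma disjoint_children:
  "\<lbrakk>labelled_tree V (Node \<omega> ts); i \<in> {1..length ts}; j \<in> {1..length ts}; i \<noteq> j\<rbrakk> \<Longrightarrow>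
    Lin (ts ! (i - 1)) \<inter> Lin (ts ! (j - 1)) = {}"
  by (intro distinct_leaves_children) (auto simp: labelled_tree_def)

lemma family_Node:
  assumes "C = A_family \<or> C = B_family" "labelled_tree V (Node \<omega> ts)"
  shows "J \<in> C (Lin (Node \<omega> ts)) \<longleftrightarrow> J \<subseteq> Lin (Node \<omega> ts) \<and> meet_inputs J ts \<in> C {1..length ts} \<and>
    (\<forall>i\<in>{1..length ts}. J \<inter> Lin (ts ! (i - 1)) \<noteq> {} \<longrightarrow>
      J \<inter> Lin (ts ! (i - 1)) \<in> C (Lin (ts ! (i - 1))))"
  using family_union[OF assms(1), of "{1..length ts}" "\<lambda>i. Lin (ts ! (i - 1))" J]
    disjoint_children[OF assms(2)]
  unfolding Lin_children[of ts \<omega>] meet_inputs_def by blast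

text \<open>A child missed by J receives the empty set, hence the starred splitting; a child that is
  met receives a member of the family by \<open>family_Node\<close>.\<close>

lemma splittable_child:
  assumes C: "C = A_family \<or> C = B_family" "labelled_tree V (Node \<omega> ts)"
    and J: "splittable C J (Node \<omega> ts)" and t: "t \<in> set ts"
  shows "splittable C (J \<inter> Lin t) t"
proof (cases "J \<in> C (Lin (Node \<omega> ts))")
  case True
  obtain k where k: "k < length ts" "t = ts ! k" using t by (auto simp: in_set_conv_nth)
  then have "Suc k \<in> {1..length ts}" by simp
  with True show ?thesis
    unfolding family_Node[OF C] splittable_def k(2) by (metis diff_Suc_1)
qed (use J in \<open>simp add: splittable_def\<close>)

lemma splittable_meet:
  assumes C: "C = A_family \<or> C = B_family" "labelled_tree V (Node \<omega> ts)"
    and J: "splittable C J (Node \<omega> ts)" "J \<noteq> {}"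
  shows "(\<omega>, meet_inputs J ts) \<in> basis (Sp_basis C V)"
  using J C(2) unfolding splittable_def family_Node[OF C]
  by (auto simp: Sp_basis_sel labelled_tree_def)

lemma Sp_root_keys:
  assumes C: "C = A_family \<or> C = B_family" "labelled_tree V (Node \<omega> ts)"
    and J: "splittable C J (Node \<omega> ts)"
    and p: "p \<in> Poly_Mapping.keys (if J = {} then Sp_star C V \<omega>
      else basis_vec (\<omega>, meet_inputs J ts) :: ('v \<times> nat set) \<Rightarrow>\<^sub>0 'k::field)"
  shows "p \<in> basis (Sp_basis C V) \<and> arity (Sp_basis C V) p = length ts"
proof (cases "J = {}")
  case True
  then show ?thesis using p keys_Sp_star[of C V \<omega>] C(2)
    by (auto simp: Sp_basis_sel labelled_tree_def)
next
  case False
  then show ?thesis using p splittable_meet[OF C J] C(2)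
    by (auto simp: Sp_basis_sel labelled_tree_def)
qed

text \<open>Splitting alters the decorations only. Hence it yields labelled trees with the same leaf
  set, and their evaluation reads the same inputs.\<close>

lemma Sp_tree_keys:
  assumes C: "C = A_family \<or> C = B_family" and "labelled_tree V t" "splittable C J t"
    and "s \<in> Poly_Mapping.keys (Sp_tree C V J t :: ('v \<times> nat set) ltree \<Rightarrow>\<^sub>0 'k::field)"
  shows "decorated (Sp_basis C V) s \<and> leaves s = leaves t"
  using assms(2-)
proof (induction t arbitrary: J s)
  case (Leaf i)
  then show ?case by simp
next
  case (Node \<omega> ts)
  let ?fs = "map (\<lambda>t. Sp_tree C V (J \<inter> Lin t) t :: ('v \<times> nat set) ltree \<Rightarrow>\<^sub>0 'k) ts"
  obtain p ss where s: "s = Node p ss"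
    and p: "p \<in> Poly_Mapping.keys (if J = {} then Sp_star C V \<omega>
      else basis_vec (\<omega>, meet_inputs J ts) :: ('v \<times> nat set) \<Rightarrow>\<^sub>0 'k)"
    and ss: "list_all2 (\<lambda>s f. s \<in> Poly_Mapping.keys f) ss ?fs"
    by (rule keys_graft[OF Node.prems(3)[unfolded Sp_tree.simps]])
  have len: "length ss = length ts" using list_all2_lengthD[OF ss] by simp
  have child: "decorated (Sp_basis C V) (ss ! k) \<and> leaves (ss ! k) = leaves (ts ! k)"
    if k: "k < length ts" for k
    using list_all2_nthD[OF ss, of k] k len Node.prems
    by (intro Node.IH[of "ts ! k" "J \<inter> Lin (ts ! k)"] labelled_tree_child[OF Node.prems(1)]
        splittable_child[OF C Node.prems(1,2)]) simp_all
  have "map leaves ss = map leaves ts"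
    using child len by (intro nth_equalityI) simp_all
  moreover have "\<forall>s\<in>set ss. decorated (Sp_basis C V) s"
    using child len by (auto simp: in_set_conv_nth)
  ultimately show ?case
    using Sp_root_keys[OF C Node.prems(1,2) p] len by (simp add: s)
qed

lemma Sp_tree_space:
  assumes "C = A_family \<or> C = B_family" "labelled_tree V t" "splittable C J t"
  shows "(Sp_tree C V J t :: ('v \<times> nat set) ltree \<Rightarrow>\<^sub>0 'k::field) \<in> tree_space (Sp_basis C V) (Lin t)"
  using Sp_tree_keys[OF assms, where 'k = 'k] assms(2)
  by (fastforce simp: tree_space_def labelled_tree_def Lin_def)

section \<open>Evaluation of split trees\<close>

definition eval_Sp ::
  "(nat set \<Rightarrow> nat set set) \<Rightarrow> 'v sym_basis \<Rightarrow> ('k::field \<Rightarrow> 'a::ab_group_add \<Rightarrow> 'a) \<Rightarrow>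
   ('v \<times> nat set \<Rightarrow> 'a list \<Rightarrow> 'a) \<Rightarrow> nat set \<Rightarrow> 'v ltree \<Rightarrow> (nat \<Rightarrow> 'a) \<Rightarrow> 'a" where
  "eval_Sp C V sc ops J t x = lin_eval sc (\<lambda>s. eval_tree ops s x) (Sp_tree C V J t)"

lemma eval_Sp_Leaf: "vector_space sc \<Longrightarrow> eval_Sp C V sc ops J (Leaf i) x = x i"
  by (simp add: eval_Sp_def lin_eval_single)

lemma eval_Sp_cong:
  fixes sc :: "'k::field \<Rightarrow> 'a::ab_group_add \<Rightarrow> 'a"
  assumes "C = A_family \<or> C = B_family" "labelled_tree V t" "splittable C J t"
    and "\<And>i. i \<in> Lin t \<Longrightarrow> x i = y i"
  shows "eval_Sp C V sc ops J t x = eval_Sp C V sc ops J t y"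
  unfolding eval_Sp_def
  using Sp_tree_keys[OF assms(1-3), where 'k = 'k] assms(4)
  by (intro lin_eval_cong eval_tree_cong) (simp add: Lin_def)

lemma eval_Sp_star:
  assumes sc: "vector_space sc" and C: "C = A_family \<or> C = B_family"
    and ml: "multilinear_ops (Sp_basis C V) sc ops" and t: "labelled_tree V (Node \<omega> ts)"
  shows "eval_Sp C V sc ops {} (Node \<omega> ts) x =
    (\<Sum>I\<in>C {1..arity V \<omega>}. ops (\<omega>, I) (map (\<lambda>t. eval_Sp C V sc ops {} t x) ts))"
proof -
  have "splittable C {} (Node \<omega> ts)" by (simp add: splittable_def)
  then have "lin_eval sc (\<lambda>t. eval_tree ops t x) (graft (Sp_star C V \<omega>) (map (Sp_tree C V {}) ts)) =
      lin_eval sc (\<lambda>p. ops p (map (\<lambda>t. eval_Sp C V sc ops {} t x) ts)) (Sp_star C V \<omega>)"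
    using Sp_root_keys[OF C t, of "{}"] by (subst lin_eval_graft[OF sc ml]) (auto simp: comp_def eval_Sp_def)
  then show ?thesis
    by (simp add: eval_Sp_def) (simp add: Sp_star_def lin_eval_sum lin_eval_single sc)
qed

lemma eval_Sp_Node:
  assumes sc: "vector_space sc" and C: "C = A_family \<or> C = B_family"
    and ml: "multilinear_ops (Sp_basis C V) sc ops" and t: "labelled_tree V (Node \<omega> ts)"
    and J: "J \<in> C (Lin (Node \<omega> ts))"
  shows "eval_Sp C V sc ops J (Node \<omega> ts) x =
    ops (\<omega>, meet_inputs J ts) (map (\<lambda>t. eval_Sp C V sc ops (J \<inter> Lin t) t x) ts)"
proof -
  have "splittable C J (Node \<omega> ts)" "J \<noteq> {}"
    using J family_nonempty[OF C J] by (simp_all add: splittable_def)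
  then have "lin_eval sc (\<lambda>t. eval_tree ops t x)
      (graft (basis_vec (\<omega>, meet_inputs J ts)) (map (\<lambda>t. Sp_tree C V (J \<inter> Lin t) t) ts)) =
      lin_eval sc (\<lambda>p. ops p (map (\<lambda>t. eval_Sp C V sc ops (J \<inter> Lin t) t x) ts))
        (basis_vec (\<omega>, meet_inputs J ts))"
    using Sp_root_keys[OF C t, of J] by (subst lin_eval_graft[OF sc ml]) (auto simp: comp_def eval_Sp_def)
  then show ?thesis
    using \<open>J \<noteq> {}\<close> by (simp add: eval_Sp_def) (simp add: lin_eval_single[OF sc])
qed

section \<open>Entries inside and outside a set of positions\<close>

lemma nths_agree:
  assumes "length xs = length ys" "\<And>j. \<lbrakk>j < length xs; j \<in> S\<rbrakk> \<Longrightarrow> xs ! j = ys ! j"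
  shows "nths xs S = nths ys S"
  using assms
proof (induction xs ys arbitrary: S rule: list_induct2)
  case (Cons x xs y ys)
  have "nths xs {j. Suc j \<in> S} = nths ys {j. Suc j \<in> S}"
    using Cons.prems[of "Suc _"] by (intro Cons.IH) auto
  moreover have "x = y" if "0 \<in> S" using Cons.prems[of 0] that by simp
  ultimately show ?case by (simp add: nths_Cons)
qed simp

text \<open>Uniqueness for the definite description in \<open>split_actions\<close>.\<close>

lemma nths_compl_inj:
  assumes "length xs = length ys" "nths xs S = nths ys S" "nths xs (- S) = nths ys (- S)"
  shows "xs = ys"
  using assms
proof (induction xs ys arbitrary: S rule: list_induct2)
  case (Cons x xs y ys)
  have "{j. Suc j \<in> - S} = - {j. Suc j \<in> S}" by auto
  then show ?case
    using Cons.prems Cons.IH[of "{j. Suc j \<in> S}"] by (auto simp: nths_Cons split: if_splits)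
qed simp

text \<open>Transfers linearity: changing one entry of a sublist is changing one entry of the full
  tuple, at a position k that is independent of the new value.\<close>

lemma nths_update_ex:
  assumes "i < length (nths xs S)"
  shows "\<exists>k<length xs. k \<in> S \<and> (\<forall>a. nths (xs[k := a]) S = (nths xs S)[i := a])"
  using assms
proof (induction xs arbitrary: S i)
  case (Cons x xs)
  let ?S = "{j. Suc j \<in> S}"
  show ?case
  proof (cases "0 \<in> S \<and> i = 0")
    case True
    then show ?thesis by (intro exI[of _ 0]) (simp add: nths_Cons)
  next
    case False
    \<comment> \<open>A selected head occupies position 0 of the sublist, so the position within the
      tail drops by one.\<close>
    define i' where "i' = (if 0 \<in> S then i - 1 else i)"
    have i': "i' < length (nths xs ?S)"
      using Cons.prems False by (auto simp: nths_Cons i'_def split: if_splits)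
    obtain k where "k < length xs" "k \<in> ?S" "\<forall>a. nths (xs[k := a]) ?S = (nths xs ?S)[i' := a]"
      using Cons.IH[OF i'] by blast
    then show ?thesis using False
      by (intro exI[of _ "Suc k"]) (auto simp: nths_Cons i'_def split: nat.splits)
  qed
qed simp

text \<open>\<open>ws\<close> is a template for the lengths, along which the two sublists are
  interleaved.\<close>

lemma nths_merge_ex:
  assumes "length ys = length (nths ws S)" "length zs = length (nths ws (- S))"
  shows "\<exists>xs. length xs = length ws \<and> nths xs S = ys \<and> nths xs (- S) = zs"
  using assms
proof (induction ws arbitrary: S ys zs)
  case (Cons w ws)
  let ?S = "{j. Suc j \<in> S}"
  have compl: "{j. Suc j \<in> - S} = - ?S" by auto
  show ?case
  proof (cases "0 \<in> S")
    case True
    then obtain y ys' where ys: "ys = y # ys'" "length ys' = length (nths ws ?S)"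
      using Cons.prems by (cases ys) (auto simp: nths_Cons)
    moreover have "length zs = length (nths ws (- ?S))"
      using Cons.prems True compl by (simp add: nths_Cons)
    ultimately obtain xs where "length xs = length ws" "nths xs ?S = ys'" "nths xs (- ?S) = zs"
      using Cons.IH by blast
    then show ?thesis using True ys compl by (intro exI[of _ "y # xs"]) (simp add: nths_Cons)
  next
    case False
    then obtain z zs' where zs: "zs = z # zs'" "length zs' = length (nths ws (- ?S))"
      using Cons.prems compl by (cases zs) (auto simp: nths_Cons)
    moreover have "length ys = length (nths ws ?S)"
      using Cons.prems False by (simp add: nths_Cons)
    ultimately obtain xs where "length xs = length ws" "nths xs ?S = ys" "nths xs (- ?S) = zs'"
      using Cons.IH by blast
    then show ?thesis using False zs compl by (intro exI[of _ "z # xs"]) (simp add: nths_Cons)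
  qed
qed simp

lemma del_pos_eq: "del_pos I xs = nths xs (- {j. Suc j \<in> I})"
  by (simp add: del_pos_def Compl_eq)

lemma split_actions_eq:
  assumes "length xs = arity V \<omega>"
  shows "split_actions V ops \<omega> I (del_pos I xs) (sel_pos I xs) = ops (\<omega>, I) xs"
proof -
  have "(THE ys. length ys = arity V \<omega> \<and> del_pos I ys = del_pos I xs \<and> sel_pos I ys = sel_pos I xs) = xs"
    using assms unfolding del_pos_eq sel_pos_def
    by (auto intro!: the_equality nths_compl_inj[of _ xs "{j. Suc j \<in> I}"])
  then show ?thesis by (simp add: split_actions_def)
qed

text \<open>\<open>multilinear_actions\<close> quantifies over arbitrary pairs of tuples; each pair
  arises by taking a full tuple apart, where the given operations apply.\<close>

lemma pos_merge_ex:
  assumes "I \<subseteq> {1..n}" "length ys = n - card I" "length zs = card I"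
  shows "\<exists>xs. length xs = n \<and> del_pos I xs = ys \<and> sel_pos I xs = zs"
proof -
  let ?S = "{j. Suc j \<in> I}" and ?ws = "replicate n (undefined :: 'a)"
  have "Suc ` {i. i < n \<and> i \<in> ?S} = I"
  proof
    show "I \<subseteq> Suc ` {i. i < n \<and> i \<in> ?S}"
    proof
      fix i assume "i \<in> I"
      then show "i \<in> Suc ` {i. i < n \<and> i \<in> ?S}" using assms(1) by (cases i) auto
    qed
  qed auto
  then have card: "card {i. i < n \<and> i \<in> ?S} = card I" by (metis card_image inj_Suc inj_on_subset subset_UNIV)
  have "{i. i < n \<and> i \<in> - ?S} = {..<n} - {i. i < n \<and> i \<in> ?S}" by auto
  then have "card {i. i < n \<and> i \<in> - ?S} = n - card I"
    by (simp add: card_Diff_subset card[simplified] subset_eq)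
  then show ?thesis
    using nths_merge_ex[of zs ?ws ?S ys] card assms
    by (auto simp: length_nths del_pos_eq sel_pos_def)
qed

section \<open>Multilinear expansion over choice functions\<close>

lemma linear_image_sum:
  assumes "Vector_Spaces.linear s1 s2 T"
  shows "T (\<Sum>k\<in>S. f k) = (\<Sum>k\<in>S. T (f k))"
proof -
  interpret Vector_Spaces.linear s1 s2 T by fact
  show ?thesis by (rule sum)
qed

text \<open>One input is expanded at a time. The rest \<open>w\<close> is arbitrary in the
  induction, so that the hypothesis can be used with the whole sum for the new input stored in
  \<open>w\<close>; only then is this sum pulled out by linearity.\<close>

lemma multilinear_expand:
  assumes "finite K" and "\<And>w i. i \<in> K \<Longrightarrow> Vector_Spaces.linear s1 s2 (\<lambda>a. G (w(i := a)))"
  shows "G (\<lambda>j. if j \<in> K then \<Sum>k\<in>S j. y j k else w j) =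
    (\<Sum>F\<in>PiE K S. G (\<lambda>j. if j \<in> K then y j (F j) else w j))"
  using assms
proof (induction K arbitrary: w rule: finite_induct)
  case (insert i K)
  have 1: "(\<lambda>j. if j \<in> insert i K then \<Sum>k\<in>S j. y j k else w j) =
      (\<lambda>j. if j \<in> K then \<Sum>k\<in>S j. y j k else (w(i := \<Sum>k\<in>S i. y i k)) j)"
    using insert.hyps by auto
  have 2: "(\<lambda>j. if j \<in> K then y j (F j) else (w(i := a)) j) =
      (\<lambda>j. if j \<in> K then y j (F j) else w j)(i := a)" for F a
    using insert.hyps by auto
  have 3: "(\<lambda>j. if j \<in> insert i K then y j ((F(i := k)) j) else w j) =
      (\<lambda>j. if j \<in> K then y j (F j) else w j)(i := y i k)" for F k
    using insert.hyps by auto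
  have "G (\<lambda>j. if j \<in> insert i K then \<Sum>k\<in>S j. y j k else w j) =
      (\<Sum>F\<in>PiE K S. G ((\<lambda>j. if j \<in> K then y j (F j) else w j)(i := \<Sum>k\<in>S i. y i k)))"
    unfolding 1 2[symmetric] using insert.prems by (intro insert.IH) auto
  also have "\<dots> = (\<Sum>F\<in>PiE K S. \<Sum>k\<in>S i. G ((\<lambda>j. if j \<in> K then y j (F j) else w j)(i := y i k)))"
    by (intro sum.cong refl linear_image_sum[OF insert.prems]) simp
  also have "\<dots> = (\<Sum>F\<in>PiE K S. \<Sum>k\<in>S i. G (\<lambda>j. if j \<in> insert i K then y j ((F(i := k)) j) else w j))"
    unfolding 3 ..
  also have "\<dots> = (\<Sum>(k, F)\<in>S i \<times> PiE K S. G (\<lambda>j. if j \<in> insert i K then y j ((F(i := k)) j) else w j))"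
    by (subst sum.swap) (simp add: sum.cartesian_product)
  \<comment> \<open>A choice function on \<open>insert i K\<close> is a choice at i together with a
    choice function on K.\<close>
  also have "\<dots> = (\<Sum>F\<in>PiE (insert i K) S. G (\<lambda>j. if j \<in> insert i K then y j (F j) else w j))"
    unfolding PiE_insert_eq
    by (subst sum.reindex[OF inj_combinator[OF insert.hyps(2)]]) (simp add: case_prod_unfold comp_def)
  finally show ?case .
qed simp

section \<open>The operations on A \<oplus> A\<close>

definition mix :: "nat set \<Rightarrow> ('a \<times> 'a) list \<Rightarrow> 'a list" where
  "mix I zs = map (\<lambda>j. if j \<in> I then snd (zs ! (j - 1)) else fst (zs ! (j - 1))) [1..<Suc (length zs)]"

text \<open>The operations of the module on A \<oplus> A, with the deleted and the selected sublist
  merged back into one tuple. In this form the definite description in \<open>split_actions\<close>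
  is gone and trees can be evaluated.\<close>

definition mix_ops ::
  "(nat set \<Rightarrow> nat set set) \<Rightarrow> 'v sym_basis \<Rightarrow> ('v \<times> nat set \<Rightarrow> 'a list \<Rightarrow> 'a::ab_group_add) \<Rightarrow>
   'v \<Rightarrow> ('a \<times> 'a) list \<Rightarrow> 'a \<times> 'a" where
  "mix_ops C V ops \<omega> zs =
    (star_ops C V ops \<omega> (map fst zs), \<Sum>I\<in>C {1..arity V \<omega>}. ops (\<omega>, I) (mix I zs))"

lemma length_mix [simp]: "length (mix I zs) = length zs"
  by (simp add: mix_def del: upt_Suc)

lemma mix_nth: "k < length zs \<Longrightarrow> mix I zs ! k = (if Suc k \<in> I then snd (zs ! k) else fst (zs ! k))"
  by (simp add: mix_def del: upt_Suc)

text \<open>Outside I the mixed tuple agrees with the first components, inside I with the second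
  ones; so its two sublists are those on which the action is evaluated.\<close>

lemma sum_ops_eq_mix_ops:
  assumes "length zs = arity V \<omega>"
  shows "sum_ops C V (star_ops C V ops) (split_actions V ops) \<omega> zs = mix_ops C V ops \<omega> zs"
proof -
  have "split_actions V ops \<omega> I (del_pos I (map fst zs)) (sel_pos I (map snd zs)) = ops (\<omega>, I) (mix I zs)"
    for I
  proof -
    have "del_pos I (map fst zs) = del_pos I (mix I zs)" "sel_pos I (map snd zs) = sel_pos I (mix I zs)"
      unfolding del_pos_def sel_pos_def by (auto intro!: nths_agree simp: mix_nth)
    then show ?thesis using split_actions_eq[of "mix I zs" V \<omega> ops I] assms by simp
  qed
  then show ?thesis by (simp add: sum_ops_def mix_ops_def)
qed

lemma multilinear_split_actions:
  fixes sc :: "'k::field \<Rightarrow> 'a::ab_group_add \<Rightarrow> 'a"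
  assumes C: "C = A_family \<or> C = B_family" and ml: "multilinear_ops (Sp_basis C V) sc ops"
  shows "multilinear_actions C V sc sc (split_actions V ops)"
  unfolding multilinear_actions_def
proof (intro ballI allI impI, elim conjE)
  fix \<omega> I and ys zs :: "'a list"
  assume \<omega>: "\<omega> \<in> basis V" "I \<in> C {1..arity V \<omega>}"
    and len: "length ys = arity V \<omega> - card I" "length zs = card I"
  obtain xs where xs: "length xs = arity V \<omega>" "del_pos I xs = ys" "sel_pos I xs = zs"
    using pos_merge_ex[OF family_subset[OF C \<omega>(2)] len] by blast
  have lin: "Vector_Spaces.linear sc sc (\<lambda>a. ops (\<omega>, I) (xs[k := a]))" if "k < arity V \<omega>" for k
    using ml \<omega> xs(1) that by (auto simp: multilinear_ops_def Sp_basis_sel)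
  have "Vector_Spaces.linear sc sc (\<lambda>a. split_actions V ops \<omega> I (ys[i := a]) zs)" if i: "i < length ys" for i
  proof -
    obtain k where k: "k < length xs" "Suc k \<notin> I" "\<And>a. del_pos I (xs[k := a]) = ys[i := a]"
      using nths_update_ex[of i xs "- {j. Suc j \<in> I}"] i
      unfolding del_pos_eq xs(2)[symmetric] by auto
    have "sel_pos I (xs[k := a]) = zs" for a
      unfolding xs(3)[symmetric] sel_pos_def using k(1,2) by (intro nths_agree) (auto simp: nth_list_update)
    then have "split_actions V ops \<omega> I (ys[i := a]) zs = ops (\<omega>, I) (xs[k := a])" for a
      using split_actions_eq[of "xs[k := a]" V \<omega> ops I] k(3) xs(1) by simp
    then show ?thesis using lin[of k] k(1) xs(1) by simp
  qed
  moreover have "Vector_Spaces.linear sc sc (\<lambda>a. split_actions V ops \<omega> I ys (zs[i := a]))"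
    if i: "i < length zs" for i
  proof -
    obtain k where k: "k < length xs" "Suc k \<in> I" "\<And>a. sel_pos I (xs[k := a]) = zs[i := a]"
      using nths_update_ex[of i xs "{j. Suc j \<in> I}"] i
      unfolding sel_pos_def xs(3)[symmetric] by auto
    have "del_pos I (xs[k := a]) = ys" for a
      unfolding xs(2)[symmetric] del_pos_def using k(1,2) by (intro nths_agree) (auto simp: nth_list_update)
    then have "split_actions V ops \<omega> I ys (zs[i := a]) = ops (\<omega>, I) (xs[k := a])" for a
      using split_actions_eq[of "xs[k := a]" V \<omega> ops I] k(3) xs(1) by simp
    then show ?thesis using lin[of k] k(1) xs(1) by simp
  qed
  ultimately show
    "(\<forall>i<length ys. Vector_Spaces.linear sc sc (\<lambda>a. split_actions V ops \<omega> I (ys[i := a]) zs)) \<and>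
     (\<forall>j<length zs. Vector_Spaces.linear sc sc (\<lambda>u. split_actions V ops \<omega> I ys (zs[j := u])))"
    by blast
qed

lemma vector_space_sum_scale:
  assumes "vector_space sc"
  shows "vector_space (sum_scale sc sc)"
proof -
  interpret vector_space sc by fact
  show ?thesis
    by unfold_locales (auto simp: sum_scale_def prod_eq_iff scale_right_distrib scale_left_distrib)
qed

lemma lin_eval_sum_scale:
  "lin_eval (sum_scale sc sc) F f = (lin_eval sc (\<lambda>b. fst (F b)) f, lin_eval sc (\<lambda>b. snd (F b)) f)"
  by (simp add: lin_eval_def sum_scale_def prod_eq_iff fst_sum snd_sum)

lemma multilinear_star_ops:
  fixes sc :: "'k::field \<Rightarrow> 'a::ab_group_add \<Rightarrow> 'a"
  assumes sc: "vector_space sc" and ml: "multilinear_ops (Sp_basis C V) sc ops"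
  shows "multilinear_ops V sc (star_ops C V ops)"
  unfolding multilinear_ops_def
proof (intro ballI allI impI)
  fix \<omega> and xs :: "'a list" and i
  assume \<omega>: "\<omega> \<in> basis V" "length xs = arity V \<omega>" "i < arity V \<omega>"
  interpret vector_space sc by fact
  have "Vector_Spaces.linear sc sc (\<lambda>a. ops (\<omega>, I) (xs[i := a]))" if "I \<in> C {1..arity V \<omega>}" for I
    using ml \<omega> that by (auto simp: multilinear_ops_def Sp_basis_sel)
  then show "Vector_Spaces.linear sc sc (\<lambda>a. star_ops C V ops \<omega> (xs[i := a]))"
    using sc by (simp add: Vector_Spaces.linear_iff star_ops_def sum.distrib scale_sum_right)
qed

lemma multilinear_mix_ops:
  fixes sc :: "'k::field \<Rightarrow> 'a::ab_group_add \<Rightarrow> 'a"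
  assumes sc: "vector_space sc" and ml: "multilinear_ops (Sp_basis C V) sc ops"
  shows "multilinear_ops V (sum_scale sc sc) (mix_ops C V ops)"
  unfolding multilinear_ops_def
proof (intro ballI allI impI)
  fix \<omega> and zs :: "('a \<times> 'a) list" and i
  assume \<omega>: "\<omega> \<in> basis V" "length zs = arity V \<omega>" "i < arity V \<omega>"
  interpret vector_space sc by fact
  have lin: "Vector_Spaces.linear sc sc (\<lambda>a. ops (\<omega>, I) (xs[i := a]))"
    if "I \<in> C {1..arity V \<omega>}" "length xs = arity V \<omega>" for I xs
    using ml \<omega> that by (auto simp: multilinear_ops_def Sp_basis_sel)
  have star: "Vector_Spaces.linear sc sc (\<lambda>a. star_ops C V ops \<omega> ((map fst zs)[i := a]))"
    using multilinear_star_ops[OF sc ml] \<omega> by (auto simp: multilinear_ops_def)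
  \<comment> \<open>Each mixed tuple sees just one component of the new pair, so for fixed I
    linearity in the pair is linearity in one entry.\<close>
  have mix: "mix I (zs[i := a]) = (mix I zs)[i := if Suc i \<in> I then snd a else fst a]" for I a
    using \<omega> by (intro nth_equalityI) (auto simp: mix_nth nth_list_update)
  have "ops (\<omega>, I) (mix I (zs[i := a + b])) = ops (\<omega>, I) (mix I (zs[i := a])) + ops (\<omega>, I) (mix I (zs[i := b]))"
    "ops (\<omega>, I) (mix I (zs[i := sum_scale sc sc c a])) = sc c (ops (\<omega>, I) (mix I (zs[i := a])))"
    if "I \<in> C {1..arity V \<omega>}" for I a b c
    using lin[OF that, of "mix I zs"] \<omega>
    by (simp_all add: mix Vector_Spaces.linear_iff sum_scale_def)
  then show "Vector_Spaces.linear (sum_scale sc sc) (sum_scale sc sc) (\<lambda>a. mix_ops C V ops \<omega> (zs[i := a]))"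
    using star vector_space_sum_scale[OF sc]
    by (simp add: Vector_Spaces.linear_iff mix_ops_def prod_eq_iff map_update sum.distrib scale_sum_right)
      (simp add: sum_scale_def scale_sum_right)
qed

text \<open>Substitute \<sigma>(I) for I, then use equivariance of each split operation. The
  argument h may depend on I, which covers both components of \<open>mix_ops\<close>: a constant
  tuple for the starred one, the mixed tuple for the other.\<close>

lemma star_reindex:
  assumes C: "C = A_family \<or> C = B_family" and V: "S_module_basis V"
    and eq: "equivariant_ops (Sp_basis C V) ops"
    and \<omega>: "\<omega> \<in> basis V" and \<sigma>: "\<sigma> permutes {1..arity V \<omega>}"
    and len: "\<And>I. length (h I) = arity V \<omega>"
  shows "(\<Sum>I\<in>C {1..arity V (sact V \<sigma> \<omega>)}. ops (sact V \<sigma> \<omega>, I) (h I)) =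
    (\<Sum>I\<in>C {1..arity V \<omega>}. ops (\<omega>, I) (map (\<lambda>j. h (\<sigma> ` I) ! (\<sigma> j - 1)) [1..<Suc (arity V \<omega>)]))"
proof -
  have "arity V (sact V \<sigma> \<omega>) = arity V \<omega>" using V \<omega> \<sigma> by (simp add: S_module_basis_def)
  then have "(\<Sum>I\<in>C {1..arity V (sact V \<sigma> \<omega>)}. ops (sact V \<sigma> \<omega>, I) (h I)) =
      (\<Sum>I\<in>C {1..arity V \<omega>}. ops (sact V \<sigma> \<omega>, \<sigma> ` I) (h (\<sigma> ` I)))"
    using sum.reindex_bij_betw[OF family_permutes[OF C \<sigma>], of "\<lambda>I. ops (sact V \<sigma> \<omega>, I) (h I)"] by simp
  also have "\<dots> = (\<Sum>I\<in>C {1..arity V \<omega>}. ops (\<omega>, I)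
      (map (\<lambda>j. h (\<sigma> ` I) ! (\<sigma> j - 1)) [1..<Suc (arity V \<omega>)]))"
  proof (intro sum.cong refl)
    fix I assume "I \<in> C {1..arity V \<omega>}"
    then have "(\<omega>, I) \<in> basis (Sp_basis C V)" using \<omega> by (simp add: Sp_basis_sel)
    from eq[unfolded equivariant_ops_def, rule_format, OF this, unfolded Sp_basis_sel, OF \<sigma> len]
    show "ops (sact V \<sigma> \<omega>, \<sigma> ` I) (h (\<sigma> ` I)) =
      ops (\<omega>, I) (map (\<lambda>j. h (\<sigma> ` I) ! (\<sigma> j - 1)) [1..<Suc (arity V \<omega>)])" .
  qed
  finally show ?thesis .
qed

lemma equivariant_star_ops:
  assumes "C = A_family \<or> C = B_family" "S_module_basis V" "equivariant_ops (Sp_basis C V) ops"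
  shows "equivariant_ops V (star_ops C V ops)"
  unfolding equivariant_ops_def star_ops_def using star_reindex[OF assms] by simp

lemma equivariant_mix_ops:
  fixes ops :: "'v \<times> nat set \<Rightarrow> 'a::ab_group_add list \<Rightarrow> 'a"
  assumes C: "C = A_family \<or> C = B_family" and V: "S_module_basis V"
    and eq: "equivariant_ops (Sp_basis C V) ops"
  shows "equivariant_ops V (mix_ops C V ops)"
  unfolding equivariant_ops_def
proof (intro ballI allI impI)
  fix \<omega> \<sigma> and zs :: "('a \<times> 'a) list"
  assume \<omega>: "\<omega> \<in> basis V" and \<sigma>: "\<sigma> permutes {1..arity V \<omega>}" and zs: "length zs = arity V \<omega>"
  let ?n = "arity V \<omega>"
  let ?zs = "map (\<lambda>j. zs ! (\<sigma> j - 1)) [1..<Suc ?n]"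
  have r: "\<sigma> (Suc k) - 1 < ?n" "Suc (\<sigma> (Suc k) - 1) = \<sigma> (Suc k)" if "k < ?n" for k
    using permutes_in_image[OF \<sigma>, of "Suc k"] that by auto
  \<comment> \<open>Position j of the permuted tuple is position \<sigma>(j) of the original one,
    and \<sigma>(j) lies in \<sigma>(I) exactly when j lies in I.\<close>
  have "map (\<lambda>j. mix (\<sigma> ` I) zs ! (\<sigma> j - 1)) [1..<Suc ?n] = mix I ?zs" for I
  proof (rule nth_equalityI)
    fix k assume "k < length (map (\<lambda>j. mix (\<sigma> ` I) zs ! (\<sigma> j - 1)) [1..<Suc ?n])"
    then have k: "k < ?n" by (simp del: upt_Suc)
    then have "?zs ! k = zs ! (\<sigma> (Suc k) - 1)" by (simp del: upt_Suc)
    moreover have "\<sigma> (Suc k) \<in> \<sigma> ` I \<longleftrightarrow> Suc k \<in> I"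
      using permutes_inj[OF \<sigma>] by (simp add: inj_image_mem_iff)
    ultimately show "map (\<lambda>j. mix (\<sigma> ` I) zs ! (\<sigma> j - 1)) [1..<Suc ?n] ! k = mix I ?zs ! k"
      using k r[OF k] zs by (simp add: mix_nth del: upt_Suc)
  qed (simp del: upt_Suc)
  then have "(\<Sum>I\<in>C {1..arity V (sact V \<sigma> \<omega>)}. ops (sact V \<sigma> \<omega>, I) (mix I zs)) =
      (\<Sum>I\<in>C {1..?n}. ops (\<omega>, I) (mix I ?zs))"
    using star_reindex[OF C V eq \<omega> \<sigma>, of "\<lambda>I. mix I zs"] zs by simp
  moreover have "star_ops C V ops (sact V \<sigma> \<omega>) (map fst zs) = star_ops C V ops \<omega> (map fst ?zs)"
  proof -
    have "map (\<lambda>j. map fst zs ! (\<sigma> j - 1)) [1..<Suc ?n] = map fst ?zs"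
      using r zs by (intro nth_equalityI) (simp_all del: upt_Suc)
    then show ?thesis
      using equivariant_star_ops[OF C V eq, unfolded equivariant_ops_def, rule_format, OF \<omega> \<sigma>, of "map fst zs"] zs
      by (simp only: length_map)
  qed
  ultimately show "mix_ops C V ops (sact V \<sigma> \<omega>) zs = mix_ops C V ops \<omega> ?zs"
    by (simp only: mix_ops_def)
qed

section \<open>The splitting module\<close>

lemma map_conv_upt: "map f ts = map (\<lambda>j. f (ts ! (j - 1))) [1..<Suc (length ts)]"
  by (rule nth_equalityI) (simp_all del: upt_Suc)

text \<open>The bijection behind the recursion: J corresponds to the set I of inputs that it meets
  and its traces F on the children, with the union of the traces as inverse. An input outside I has
  the single choice {}, which stands for a starred child.\<close>

lemma sum_families_Node:
  fixes V :: "'v sym_basis" and h :: "nat set \<Rightarrow> (nat \<Rightarrow> nat set) \<Rightarrow> 'a::comm_monoid_add"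
  assumes C: "C = A_family \<or> C = B_family" and t: "labelled_tree V (Node \<omega> ts)"
    and n: "n = length ts"
  shows "(\<Sum>I\<in>C {1..n}. \<Sum>F\<in>PiE {1..n} (\<lambda>j. if j \<in> I then C (Lin (ts ! (j - 1))) else {{}}). h I F) =
    (\<Sum>J\<in>C (Lin (Node \<omega> ts)). h (meet_inputs J ts) (restrict (\<lambda>j. J \<inter> Lin (ts ! (j - 1))) {1..n}))"
proof -
  let ?L = "\<lambda>j. Lin (ts ! (j - 1))"
  let ?S = "\<lambda>I j. if j \<in> I then C (?L j) else {{}}"
  have fin: "finite (C {1..n})" by (simp add: family_finite[OF C])
  have finL: "finite (Lin t)" for t :: "'v ltree" by (simp add: Lin_def)
  have finS: "finite (PiE {1..n} (?S I))" for I
    by (intro finite_PiE) (simp_all add: family_finite[OF C] finL)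
  have U: "(\<Union>j\<in>{1..n}. ?L j) = Lin (Node \<omega> ts)" unfolding n by (rule Lin_children)
  have meet: "meet_inputs J ts = {i \<in> {1..n}. J \<inter> ?L i \<noteq> {}}" for J by (simp add: meet_inputs_def n)
  \<comment> \<open>The children have disjoint leaf sets, so each F j is recovered from the
    union.\<close>
  have F_cap: "(\<Union>i\<in>{1..n}. F i) \<inter> ?L j = F j"
    if F: "F \<in> PiE {1..n} (?S I)" and j: "j \<in> {1..n}" for I F j
  proof -
    have sub: "F i \<subseteq> ?L i" if i: "i \<in> {1..n}" for i
      using PiE_mem[OF F i] family_subset[OF C, of "F i" "?L i"] by (simp split: if_splits)
    have "F i \<inter> ?L j = {}" if "i \<in> {1..n}" "i \<noteq> j" for i
      using disjoint_children[OF t, of i j] that j sub[of i] n by blast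
    then show ?thesis using sub[OF j] j by blast
  qed
  have F_ne: "F j \<noteq> {} \<longleftrightarrow> j \<in> I" if F: "F \<in> PiE {1..n} (?S I)" and j: "j \<in> {1..n}" for I F j
    using PiE_mem[OF F j] family_nonempty[OF C, of "F j"] by (auto split: if_splits)
  have F_meet: "meet_inputs (\<Union>i\<in>{1..n}. F i) ts = I"
    if I: "I \<in> C {1..n}" and F: "F \<in> PiE {1..n} (?S I)" for I F
  proof -
    have "meet_inputs (\<Union>i\<in>{1..n}. F i) ts = {j \<in> {1..n}. F j \<noteq> {}}"
      unfolding meet using F_cap[OF F] by (intro Collect_cong conj_cong) simp_all
    also have "\<dots> = I" using F_ne[OF F] family_subset[OF C I] by blast
    finally show ?thesis .
  qed
  have "(\<Sum>I\<in>C {1..n}. \<Sum>F\<in>PiE {1..n} (?S I). h I F) =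
      (\<Sum>(I, F)\<in>Sigma (C {1..n}) (\<lambda>I. PiE {1..n} (?S I)). h I F)"
    using fin finS by (simp add: sum.Sigma)
  also have "\<dots> = (\<Sum>J\<in>C (Lin (Node \<omega> ts)). h (meet_inputs J ts) (restrict (\<lambda>j. J \<inter> ?L j) {1..n}))"
  proof (rule sum.reindex_bij_witness[where j = "\<lambda>(I, F). \<Union>i\<in>{1..n}. F i"
        and i = "\<lambda>J. (meet_inputs J ts, restrict (\<lambda>j. J \<inter> ?L j) {1..n})"])
    fix p assume "p \<in> Sigma (C {1..n}) (\<lambda>I. PiE {1..n} (?S I))"
    then obtain I F where p: "p = (I, F)" and I: "I \<in> C {1..n}" and F: "F \<in> PiE {1..n} (?S I)"
      by blast
    let ?J = "\<Union>i\<in>{1..n}. F i"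
    have restr: "restrict (\<lambda>j. ?J \<inter> ?L j) {1..n} = F"
      using F_cap[OF F] PiE_arb[OF F] by (auto simp: restrict_def fun_eq_iff)
    then show "(\<lambda>J. (meet_inputs J ts, restrict (\<lambda>j. J \<inter> ?L j) {1..n}))
        (case p of (I, F) \<Rightarrow> \<Union>i\<in>{1..n}. F i) = p"
      using F_meet[OF I F] by (simp add: p)
    show "h (meet_inputs (case p of (I, F) \<Rightarrow> \<Union>i\<in>{1..n}. F i) ts)
        (restrict (\<lambda>j. (case p of (I, F) \<Rightarrow> \<Union>i\<in>{1..n}. F i) \<inter> ?L j) {1..n}) = (case p of (I, F) \<Rightarrow> h I F)"
      using F_meet[OF I F] restr by (simp add: p)
    have "F i \<subseteq> Lin (Node \<omega> ts)" if "i \<in> {1..n}" for i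
      using F_cap[OF F that] that unfolding U[symmetric] by blast
    then have "?J \<subseteq> Lin (Node \<omega> ts)" by (intro UN_least) simp
    moreover have "F i \<in> C (?L i)" if "i \<in> {1..n}" "F i \<noteq> {}" for i
      using PiE_mem[OF F that(1)] that(2) by (simp split: if_splits)
    ultimately show "(case p of (I, F) \<Rightarrow> \<Union>i\<in>{1..n}. F i) \<in> C (Lin (Node \<omega> ts))"
      unfolding family_Node[OF C t] p prod.case F_meet[OF I F] n[symmetric]
      using F_cap[OF F] I by (simp del: Lin_Node)
  next
    fix J assume J: "J \<in> C (Lin (Node \<omega> ts))"
    have "J \<subseteq> (\<Union>j\<in>{1..n}. ?L j)" unfolding U by (rule family_subset[OF C J])
    then show "(case (meet_inputs J ts, restrict (\<lambda>j. J \<inter> ?L j) {1..n}) of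
        (I, F) \<Rightarrow> \<Union>i\<in>{1..n}. F i) = J" by auto
    have "J \<inter> ?L j \<in> ?S (meet_inputs J ts) j" if "j \<in> {1..n}" for j
      using J that unfolding family_Node[OF C t] n[symmetric] by (auto simp: meet)
    then show "(meet_inputs J ts, restrict (\<lambda>j. J \<inter> ?L j) {1..n}) \<in>
        Sigma (C {1..n}) (\<lambda>I. PiE {1..n} (?S I))"
      using J unfolding family_Node[OF C t] n[symmetric] by auto
  qed
  finally show ?thesis .
qed

lemma eval_mix_ops:
  fixes sc :: "'k::field \<Rightarrow> 'a::ab_group_add \<Rightarrow> 'a"
  assumes sc: "vector_space sc" and C: "C = A_family \<or> C = B_family"
    and ml: "multilinear_ops (Sp_basis C V) sc ops" and "labelled_tree V t"
  shows "eval_tree (mix_ops C V ops) t (\<lambda>i. (x i, u i)) =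
    (eval_Sp C V sc ops {} t x, \<Sum>J\<in>C (Lin t). eval_Sp C V sc ops J t (override_on x u J))"
  using assms(4)
proof (induction t)
  case (Leaf i)
  then show ?case by (simp add: eval_Sp_Leaf[OF sc] family_singleton[OF C])
next
  case (Node \<omega> ts)
  let ?E = "eval_Sp C V sc ops" and ?n = "arity V \<omega>"
  let ?L = "\<lambda>j. Lin (ts ! (j - 1))"
  let ?z = "\<lambda>i. (x i, u i)"
  have \<omega>: "\<omega> \<in> basis V" and n: "?n = length ts" using Node.prems by (simp_all add: labelled_tree_def)
  have child: "labelled_tree V t" if "t \<in> set ts" for t using labelled_tree_child[OF Node.prems that] .
  define zs where "zs = map (\<lambda>t. eval_tree (mix_ops C V ops) t ?z) ts"
  have IH: "eval_tree (mix_ops C V ops) t ?z =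
      (?E {} t x, \<Sum>J\<in>C (Lin t). ?E J t (override_on x u J))" if "t \<in> set ts" for t
    using Node.IH[OF that child[OF that]] .
  have len: "length zs = ?n" by (simp add: zs_def n)
  have "map fst zs = map (\<lambda>t. ?E {} t x) ts"
    using IH by (simp add: zs_def)
  then have star: "star_ops C V ops \<omega> (map fst zs) = ?E {} (Node \<omega> ts) x"
    by (simp add: eval_Sp_star[OF sc C ml Node.prems] star_ops_def)
  have mixed: "ops (\<omega>, I) (mix I zs) =
      (\<Sum>F\<in>PiE {1..?n} (\<lambda>j. if j \<in> I then C (?L j) else {{}}).
        ops (\<omega>, I) (map (\<lambda>j. ?E (F j) (ts ! (j - 1)) (override_on x u (F j))) [1..<Suc ?n]))"
    if I: "I \<in> C {1..?n}" for I
  proof -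
    let ?S = "\<lambda>j. if j \<in> I then C (?L j) else {{}}"
    let ?y = "\<lambda>j J. ?E J (ts ! (j - 1)) (override_on x u J)"
    let ?G = "\<lambda>w. ops (\<omega>, I) (map w [1..<Suc ?n])"
    have lin: "Vector_Spaces.linear sc sc (\<lambda>a. ?G (w(i := a)))" if i: "i \<in> {1..?n}" for w i
    proof -
      have "map (w(i := a)) [1..<Suc ?n] = (map w [1..<Suc ?n])[i - 1 := a]" for a
        using i by (intro nth_equalityI) (auto simp: nth_list_update simp del: upt_Suc)
      moreover have "Vector_Spaces.linear sc sc (\<lambda>a. ops (\<omega>, I) ((map w [1..<Suc ?n])[i - 1 := a]))"
        using ml[unfolded multilinear_ops_def, rule_format, of "(\<omega>, I)" "map w [1..<Suc ?n]" "i - 1"] i \<omega> I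
        by (auto simp: Sp_basis_sel simp del: upt_Suc)
      ultimately show ?thesis by simp
    qed
    \<comment> \<open>An input outside I is written as a sum over the single index {}, with
      \<open>override_on x u {} = x\<close>. Now every entry is a sum and the expansion applies
      uniformly; the 0 outside 1, ..., n is never read.\<close>
    have "mix I zs = map (\<lambda>j. if j \<in> {1..?n} then \<Sum>J\<in>?S j. ?y j J else 0) [1..<Suc ?n]"
    proof (rule nth_equalityI)
      fix k assume "k < length (mix I zs)"
      then have k: "k < length ts" by (simp add: len n)
      then show "mix I zs ! k = map (\<lambda>j. if j \<in> {1..?n} then \<Sum>J\<in>?S j. ?y j J else 0) [1..<Suc ?n] ! k"
        using IH[of "ts ! k"] n by (simp add: mix_nth zs_def override_on_emptyset del: upt_Suc)
    qed (simp add: len del: upt_Suc)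
    then have "ops (\<omega>, I) (mix I zs) = ?G (\<lambda>j. if j \<in> {1..?n} then \<Sum>J\<in>?S j. ?y j J else 0)" by simp
    also have "\<dots> = (\<Sum>F\<in>PiE {1..?n} ?S. ?G (\<lambda>j. if j \<in> {1..?n} then ?y j (F j) else 0))"
      by (rule multilinear_expand[OF _ lin]) simp_all
    also have "\<dots> = (\<Sum>F\<in>PiE {1..?n} ?S. ?G (\<lambda>j. ?y j (F j)))"
      by (intro sum.cong refl arg_cong[where f = "ops _"] map_cong) auto
    finally show ?thesis .
  qed
  have "ops (\<omega>, meet_inputs J ts) (map (\<lambda>j. ?E (restrict (\<lambda>j. J \<inter> ?L j) {1..?n} j) (ts ! (j - 1))
        (override_on x u (restrict (\<lambda>j. J \<inter> ?L j) {1..?n} j))) [1..<Suc ?n]) =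
      ?E J (Node \<omega> ts) (override_on x u J)" if J: "J \<in> C (Lin (Node \<omega> ts))" for J
  proof -
    \<comment> \<open>A child reads only its own leaves, where overriding on J and on its trace
      agree. This gives all children the common assignment that \<open>eval_Sp_Node\<close>
      requires.\<close>
    have "?E (J \<inter> Lin t) t (override_on x u (J \<inter> Lin t)) = ?E (J \<inter> Lin t) t (override_on x u J)"
      if "t \<in> set ts" for t
      using J child[OF that] splittable_child[OF C Node.prems _ that]
      by (intro eval_Sp_cong[OF C]) (auto simp: splittable_def override_on_def)
    then have "map (\<lambda>t. ?E (J \<inter> Lin t) t (override_on x u (J \<inter> Lin t))) ts =
        map (\<lambda>t. ?E (J \<inter> Lin t) t (override_on x u J)) ts" by simp
    moreover have "map (\<lambda>j. ?E (restrict (\<lambda>j. J \<inter> ?L j) {1..?n} j) (ts ! (j - 1))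
        (override_on x u (restrict (\<lambda>j. J \<inter> ?L j) {1..?n} j))) [1..<Suc ?n] =
        map (\<lambda>t. ?E (J \<inter> Lin t) t (override_on x u (J \<inter> Lin t))) ts"
      by (subst (2) map_conv_upt) (auto simp: n simp del: upt_Suc)
    ultimately show ?thesis by (simp only: eval_Sp_Node[OF sc C ml Node.prems J])
  qed
  then have sums: "(\<Sum>I\<in>C {1..?n}. ops (\<omega>, I) (mix I zs)) =
      (\<Sum>J\<in>C (Lin (Node \<omega> ts)). ?E J (Node \<omega> ts) (override_on x u J))"
    using sum_families_Node[OF C Node.prems n, of "\<lambda>I F. ops (\<omega>, I)
        (map (\<lambda>j. ?E (F j) (ts ! (j - 1)) (override_on x u (F j))) [1..<Suc ?n])"]
    by (simp only: mixed cong: sum.cong)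
  have "eval_tree (mix_ops C V ops) (Node \<omega> ts) ?z = mix_ops C V ops \<omega> zs"
    by (simp only: eval_tree.simps zs_def)
  also have "mix_ops C V ops \<omega> zs = (?E {} (Node \<omega> ts) x,
      \<Sum>J\<in>C (Lin (Node \<omega> ts)). ?E J (Node \<omega> ts) (override_on x u J))"
    using star by (simp only: mix_ops_def sums)
  finally show ?case .
qed

lemma mix_diag: "mix I (map (\<lambda>a. (a, a)) xs) = xs"
  by (rule nth_equalityI) (simp_all add: mix_nth)

text \<open>The diagonal is closed under these operations because mixing a diagonal tuple gives the
  same result for all I.\<close>

lemma eval_mix_ops_diag:
  "eval_tree (mix_ops C V ops) t (\<lambda>i. (x i, x i)) =
    (eval_tree (star_ops C V ops) t x, eval_tree (star_ops C V ops) t x)"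
proof (induction t)
  case (Node \<omega> ts)
  then have "map (\<lambda>t. eval_tree (mix_ops C V ops) t (\<lambda>i. (x i, x i))) ts =
      map (\<lambda>a. (a, a)) (map (\<lambda>t. eval_tree (star_ops C V ops) t x) ts)" by simp
  moreover have "mix_ops C V ops \<omega> (map (\<lambda>a. (a, a)) xs) = (star_ops C V ops \<omega> xs, star_ops C V ops \<omega> xs)"
    for xs by (simp add: mix_ops_def mix_diag star_ops_def comp_def)
  ultimately show ?case by (simp only: eval_tree.simps)
qed simp

text \<open>
  On the diagonal, where all operations of \<open>A \<oplus> A\<close> restrict to the starred ones, the previous
  two lemmas give \<open>eval_Sp {} = (\<Sum>J. eval_Sp J)\<close>.
\<close>

lemma eval_Sp_sum:
  fixes sc :: "'k::field \<Rightarrow> 'a::ab_group_add \<Rightarrow> 'a"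
  assumes "vector_space sc" "C = A_family \<or> C = B_family"
    "multilinear_ops (Sp_basis C V) sc ops" "labelled_tree V t"
  shows "eval_Sp C V sc ops {} t x = (\<Sum>J\<in>C (Lin t). eval_Sp C V sc ops J t x)"
    and "eval_tree (star_ops C V ops) t x = eval_Sp C V sc ops {} t x"
proof -
  have "override_on x x J = x" for J by (simp add: override_on_def fun_eq_iff)
  then have "eval_tree (mix_ops C V ops) t (\<lambda>i. (x i, x i)) =
      (eval_Sp C V sc ops {} t x, \<Sum>J\<in>C (Lin t). eval_Sp C V sc ops J t x)"
    using eval_mix_ops[OF assms, of x x] by (simp only:)
  from trans[OF sym[OF this] eval_mix_ops_diag]
  show "eval_Sp C V sc ops {} t x = (\<Sum>J\<in>C (Lin t). eval_Sp C V sc ops J t x)"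
    and "eval_tree (star_ops C V ops) t x = eval_Sp C V sc ops {} t x"
    by simp_all
qed

text \<open>Bridges operations that agree only on generators and on tuples of the right length, as
  is the case for those built from \<open>split_actions\<close>.\<close>

lemma operad_algebra_cong:
  assumes "\<And>\<omega> xs. \<lbrakk>\<omega> \<in> basis V; length xs = arity V \<omega>\<rbrakk> \<Longrightarrow> ops \<omega> xs = ops' \<omega> xs"
  shows "operad_algebra V R sc ops = operad_algebra V R sc ops'"
  using assms by (simp add: operad_algebra_def)

section \<open>The algebra structures on A and on A \<oplus> A\<close>

context
  fixes V :: "'v sym_basis" and R :: "('v ltree \<Rightarrow>\<^sub>0 'k::field) set"
    and C :: "nat set \<Rightarrow> nat set set" and sc :: "'k \<Rightarrow> 'a::ab_group_add \<Rightarrow> 'a"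
    and ops :: "'v \<times> nat set \<Rightarrow> 'a list \<Rightarrow> 'a"
  assumes V: "S_module_basis V" and hom: "\<forall>r\<in>R. locally_homogeneous V r"
    and C: "C = A_family \<or> C = B_family" and alg: "Sp_algebra C V R sc ops"
begin

lemma Sp_algebra_vector_space: "vector_space sc"
  and Sp_algebra_multilinear: "multilinear_ops (Sp_basis C V) sc ops"
  and Sp_algebra_equivariant: "equivariant_ops (Sp_basis C V) ops"
  using operad_algebraD[OF S_module_basis_Sp[OF C V] alg] by auto

text \<open>If r is nonzero, some tree occurs in it and L is the leaf set of r; the splitting of r
  at J is then a homogeneous defining relation of the split operad. For r = 0, which does not
  determine L, the sum is empty.\<close>

lemma eval_Sp_relation:
  assumes r: "r \<in> R" "r \<in> tree_space V L" and J: "J \<in> C L"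
  shows "lin_eval sc (\<lambda>t. eval_Sp C V sc ops J t x) r = 0"
proof (cases "r = 0")
  case False
  have keys: "labelled_tree V t" "Lin t = L" if "t \<in> Poly_Mapping.keys r" for t
    using r(2) that by (auto simp: tree_space_def)
  have "relation_Lin r = L" using keys False by (auto simp: relation_Lin_def)
  then have rel: "lin_ext (Sp_tree C V J) r \<in> Sp_relations C V R"
    using r(1) J by (auto simp: Sp_relations_def)
  obtain t where "t \<in> Poly_Mapping.keys r" using False by (metis keys_eq_empty equals0I)
  then have "label_set L" using label_set_Lin[OF V] keys by blast
  moreover have "lin_ext (Sp_tree C V J) r \<in> tree_space (Sp_basis C V) L"
  proof (rule tree_space_lin_ext)
    fix t assume t: "t \<in> Poly_Mapping.keys r"
    then show "Sp_tree C V J t \<in> tree_space (Sp_basis C V) L"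
      using Sp_tree_space[OF C keys(1)[OF t], of J] keys(2)[OF t] J by (simp add: splittable_def)
  qed
  ultimately have "locally_homogeneous (Sp_basis C V) (lin_ext (Sp_tree C V J) r)"
    unfolding locally_homogeneous_def by blast
  from operad_algebra_relation[OF S_module_basis_Sp[OF C V] alg rel this, of x]
  show ?thesis by (simp add: lin_eval_lin_ext[OF Sp_algebra_vector_space] eval_Sp_def)
qed simp

text \<open>No defining relation says this directly, as {} is not in \<open>C L\<close>; the starred
  splitting is replaced by the sum of the splittings at the members of \<open>C L\<close>, each of
  which vanishes on r.\<close>

lemma eval_star_relation:
  assumes r: "r \<in> R"
  shows "lin_eval sc (\<lambda>t. eval_Sp C V sc ops {} t x) r = 0"
proof -
  obtain L where L: "r \<in> tree_space V L" using hom r by (auto simp: locally_homogeneous_def)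
  then have "lin_eval sc (\<lambda>t. eval_Sp C V sc ops {} t x) r =
      lin_eval sc (\<lambda>t. \<Sum>J\<in>C L. eval_Sp C V sc ops J t x) r"
    by (intro lin_eval_cong) (auto simp: tree_space_def eval_Sp_sum(1)[OF Sp_algebra_vector_space C Sp_algebra_multilinear])
  also have "\<dots> = 0"
    using eval_Sp_relation[OF r L] by (simp add: lin_eval_sum_fun[OF Sp_algebra_vector_space])
  finally show ?thesis .
qed

lemma star_algebra: "operad_algebra V R sc (star_ops C V ops)"
proof (rule operad_algebraI[OF V Sp_algebra_vector_space multilinear_star_ops[OF Sp_algebra_vector_space Sp_algebra_multilinear] equivariant_star_ops[OF C V Sp_algebra_equivariant]])
  fix r x assume r: "r \<in> R"
  then obtain L where L: "r \<in> tree_space V L" using hom by (auto simp: locally_homogeneous_def)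
  then have "lin_eval sc (\<lambda>t. eval_tree (star_ops C V ops) t x) r =
      lin_eval sc (\<lambda>t. eval_Sp C V sc ops {} t x) r"
    by (intro lin_eval_cong) (auto simp: tree_space_def eval_Sp_sum(2)[OF Sp_algebra_vector_space C Sp_algebra_multilinear])
  then show "lin_eval sc (\<lambda>t. eval_tree (star_ops C V ops) t x) r = 0"
    by (simp add: eval_star_relation[OF r])
qed

text \<open>Homogeneity is essential for the second component: all trees of r have the same leaf set
  L, so J ranges over \<open>C L\<close> for each of them, and the sum over J can be moved outside
  the relation.\<close>

lemma mix_algebra: "operad_algebra V R (sum_scale sc sc) (mix_ops C V ops)"
proof (rule operad_algebraI[OF V vector_space_sum_scale[OF Sp_algebra_vector_space] multilinear_mix_ops[OF Sp_algebra_vector_space Sp_algebra_multilinear]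
      equivariant_mix_ops[OF C V Sp_algebra_equivariant]])
  fix r and z :: "nat \<Rightarrow> 'a \<times> 'a" assume r: "r \<in> R"
  then obtain L where L: "r \<in> tree_space V L" using hom by (auto simp: locally_homogeneous_def)
  let ?x = "\<lambda>i. fst (z i)" and ?u = "\<lambda>i. snd (z i)"
  have ev: "eval_tree (mix_ops C V ops) t z = (eval_Sp C V sc ops {} t ?x,
      \<Sum>J\<in>C L. eval_Sp C V sc ops J t (override_on ?x ?u J))" if "t \<in> Poly_Mapping.keys r" for t
    using eval_mix_ops[OF Sp_algebra_vector_space C Sp_algebra_multilinear, of t ?x ?u] L that by (auto simp: tree_space_def)
  then have "lin_eval (sum_scale sc sc) (\<lambda>t. eval_tree (mix_ops C V ops) t z) r =
      (lin_eval sc (\<lambda>t. eval_Sp C V sc ops {} t ?x) r,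
       lin_eval sc (\<lambda>t. \<Sum>J\<in>C L. eval_Sp C V sc ops J t (override_on ?x ?u J)) r)"
    unfolding lin_eval_sum_scale by (intro arg_cong2[where f = Pair] lin_eval_cong) simp_all
  also have "\<dots> = 0"
    using eval_Sp_relation[OF r L] eval_star_relation[OF r]
    by (simp add: lin_eval_sum_fun[OF Sp_algebra_vector_space] zero_prod_def)
  finally show "lin_eval (sum_scale sc sc) (\<lambda>t. eval_tree (mix_ops C V ops) t z) r = 0" .
qed

lemma split_C_module: "C_module C V R sc (star_ops C V ops) sc (split_actions V ops)"
proof -
  have "operad_algebra V R (sum_scale sc sc) (sum_ops C V (star_ops C V ops) (split_actions V ops))"
    by (rule operad_algebra_cong[THEN iffD2, OF sum_ops_eq_mix_ops mix_algebra])
  then show ?thesis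
    unfolding C_module_def using star_algebra Sp_algebra_vector_space multilinear_split_actions[OF C Sp_algebra_multilinear] by blast
qed

end

theorem theorem5p12:
  fixes V :: "'v sym_basis"
    and R :: "('v ltree \<Rightarrow>\<^sub>0 'k::field) set"
    and C :: "nat set \<Rightarrow> nat set set"
    and sc :: "'k \<Rightarrow> 'a::ab_group_add \<Rightarrow> 'a"
    and ops :: "'v \<times> nat set \<Rightarrow> 'a list \<Rightarrow> 'a"
  assumes "S_module_basis V"
    and "finite R" and "\<forall>r\<in>R. locally_homogeneous V r"
    and "C = A_family \<or> C = B_family"
    and "Sp_algebra C V R sc ops"
  shows "(\<forall>\<omega>\<in>basis V. \<forall>I\<in>C {1..arity V \<omega>}. \<forall>xs. length xs = arity V \<omega> \<longrightarrow>
            split_actions V ops \<omega> I (del_pos I xs) (sel_pos I xs) = ops (\<omega>, I) xs) \<and>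
         C_module C V R sc (star_ops C V ops) sc (split_actions V ops) \<and>
         relative_Rota_Baxter C V R sc (star_ops C V ops) sc (split_actions V ops) id \<and>
         Sp_algebra C V R sc (derived_ops id (split_actions V ops)) \<and>
         (\<forall>\<omega>\<in>basis V. \<forall>I\<in>C {1..arity V \<omega>}. \<forall>us. length us = arity V \<omega> \<longrightarrow>
            derived_ops id (split_actions V ops) (\<omega>, I) us = ops (\<omega>, I) us)"
proof -
  have derived: "derived_ops id (split_actions V ops) (\<omega>, I) us = ops (\<omega>, I) us"
    if "length us = arity V \<omega>" for \<omega> I us
    using that by (simp add: derived_ops_def split_actions_eq)
  have module: "C_module C V R sc (star_ops C V ops) sc (split_actions V ops)"
    by (rule split_C_module[OF assms(1,3-5)])
  have "vector_space sc" using assms(5) by (simp add: operad_algebra_def)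
  then have "Vector_Spaces.linear sc sc id" by (simp add: Vector_Spaces.linear_iff)
  \<comment> \<open>For the identity, the Rota-Baxter equation becomes the definition of the starred
    operation once each summand is merged back by \<open>split_actions_eq\<close>.\<close>
  then have "relative_Rota_Baxter C V R sc (star_ops C V ops) sc (split_actions V ops) id"
    using module by (simp add: relative_Rota_Baxter_def star_ops_def split_actions_eq)
  moreover have "Sp_algebra C V R sc (derived_ops id (split_actions V ops)) = Sp_algebra C V R sc ops"
    by (rule operad_algebra_cong) (auto simp: derived Sp_basis_sel)
  ultimately show ?thesis
    using module assms(5) by (intro conjI ballI allI impI) (simp_all add: derived split_actions_eq)
qed

end
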